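(* Let $\varphi$ be a free holomorphic self-map of the noncommutative ball $[B(\mathcal H)^n]_1$. If $\varphi$ is elliptic or parabolic, then the spectral radius of the composition operator $C_\varphi$ on $H^2_{\bf ball}$ is $1$.
   Context: $n\ge1$; $\mathcal H$ is a separable infinite dimensional complex Hilbert space. $\mathbb F_n^+$ is the free semigroup with generators $g_1,\ldots,g_n$ and identity $g_0$; $|g_0|=0$, $|\alpha|=k$ if $\alpha=g_{i_1}\cdots g_{i_k}$; $X_\alpha:=X_{i_1}\cdots X_{i_k}$, $X_{g_0}:=I$. $[B(\mathcal H)^n]_1:=\{(X_1,\ldots,X_n)\in B(\mathcal H)^n:\ \|X_1X_1^*+\cdots+X_nX_n^*\|^{1/2}<1\}$. A free holomorphic function $f:[B(\mathcal H)^n]_1\to B(\mathcal H)$ is a map $f(X)=\sum_{k=0}^\infty\sum_{|\alpha|=k}a_\alpha X_\alpha$ (series over $k$ converging in operator norm) with $a_\alpha\in\mathbb C$ and $\limsup_{k\to\infty}(\sum_{|\alpha|=k}|a_\alpha|^2)^{1/2k}\le1$. A free holomorphic self-map $\varphi=(\varphi_1,\ldots,\varphi_n)$ of $[B(\mathcal H)^n]_1$ has each $\varphi_i$ free holomorphic and maps $[B(\mathcal H)^n]_1$ into itself. With $\varphi_\alpha:=\varphi_{i_1}\cdots\varphi_{i_k}$, the composition is $(f\circ\varphi)(X)=\sum_{k=0}^\infty\sum_{|\alpha|=k}a_\alpha\varphi_\alpha(X)$. $H^2_{\bf ball}$ is the Hilbert space of free holomorphic functions $f=\sum_\alpha a_\alpha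 X_\alpha$ on $[B(\mathcal H)^n]_1$ with $\|f\|_2^2:=\sum_\alpha|a_\alpha|^2<\infty$; $C_\varphi f:=f\circ\varphi$ is a bounded operator on $H^2_{\bf ball}$. $\mathbb B_n$ is the open Euclidean unit ball of $\mathbb C^n$; identifying $\lambda\in\mathbb B_n$ with $(\lambda_1I,\ldots,\lambda_nI)$, $\varphi$ induces the holomorphic self-map $\lambda\mapsto\varphi(\lambda)$ of $\mathbb B_n$. If $\varphi$ has no fixed point in $\mathbb B_n$, its Denjoy-Wolff point is the unique $\zeta\in\partial\mathbb B_n$ such that, for each $c\in(0,1)$, the ellipsoid ${\bf E}_c(\zeta)=\{X\in[B(\mathcal H)^n]_1:\ (I-\sum_i\overline\zeta_iX_i)(I-\sum_i\overline\zeta_iX_i)^*<\frac{c}{1-c}(I-\sum_iX_iX_i^* )\}$ is mapped into itself by every iterate of $\varphi$ (here $A<B$ means $B-A$ is positive and invertible; such $\zeta$ exists and is unique); the iterates of the scalar map $\lambda\mapsto\varphi(\lambda)$ converge to $\zeta$ uniformly on compact subsets of $\mathbb B_n$. The dilatation coefficient of $\varphi$ is then $\alpha:=\liminf_{z\to\zeta}\frac{1-\|\varphi(z)\|^2}{1-\|z\|^2}$ ($z\in\mathbb B_n$), and $0<\alpha\le1$. $\varphi$ is called elliptic if $\varphi$ fixes a point in $\mathbb B_n$, and parabolic if $\varphi$ has no fixed points in $\mathbb B_n$ and its dilatation coefficient is $\alpha=1$. *)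

theory Defs
  imports "HOL-Analysis.Analysis" "HOL-Library.Function_Algebras"
begin

section \<open>Complex Hilbert spaces\<close>

class complex_vector = ab_group_add +
  fixes scaleC :: "complex \<Rightarrow> 'a \<Rightarrow> 'a"  (infixr \<open>*\<^sub>C\<close> 75)
  assumes scaleC_add_right: "c *\<^sub>C (x + y) = c *\<^sub>C x + c *\<^sub>C y"
    and scaleC_add_left: "(c + d) *\<^sub>C x = c *\<^sub>C x + d *\<^sub>C x"
    and scaleC_scaleC: "c *\<^sub>C d *\<^sub>C x = (c * d) *\<^sub>C x"
    and scaleC_one: "1 *\<^sub>C x = x"

global_interpretation cvec: vector_space "scaleC :: complex \<Rightarrow> 'a \<Rightarrow> 'a :: complex_vector"
  defines cspan = cvec.span
  by unfold_locales (rule scaleC_add_right scaleC_add_left scaleC_scaleC scaleC_one)+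

class complex_normed_vector = complex_vector + real_normed_vector +
  assumes scaleR_scaleC: "r *\<^sub>R x = complex_of_real r *\<^sub>C x"
    and norm_scaleC: "norm (c *\<^sub>C x) = cmod c * norm x"

text \<open>The inner product is conjugate-linear in the first argument and linear in the second.\<close>

class chilbert_space = complex_normed_vector + banach +
  fixes cinner :: "'a \<Rightarrow> 'a \<Rightarrow> complex"
  assumes cinner_commute: "cinner x y = cnj (cinner y x)"
    and cinner_add_right: "cinner x (y + z) = cinner x y + cinner x z"
    and cinner_scaleC_right: "cinner x (c *\<^sub>C y) = c * cinner x y"
    and cinner_self: "cinner x x = complex_of_real ((norm x)\<^sup>2)"

definition separable :: "'a::topological_space itself \<Rightarrow> bool" where
  "separable _ \<longleftrightarrow> (\<exists>D :: 'a set. countable D \<and> closure D = UNIV)"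

definition infinite_dimensional :: "'a::complex_vector itself \<Rightarrow> bool" where
  "infinite_dimensional _ \<longleftrightarrow> \<not> (\<exists>B :: 'a set. finite B \<and> cspan B = UNIV)"

instantiation "fun" :: (type, complex_vector) complex_vector
begin

definition scaleC_fun :: "complex \<Rightarrow> ('a \<Rightarrow> 'b) \<Rightarrow> 'a \<Rightarrow> 'b" where
  "scaleC_fun c f = (\<lambda>x. c *\<^sub>C f x)"

instance
  by standard
    (auto simp: scaleC_fun_def fun_eq_iff scaleC_add_right scaleC_add_left scaleC_scaleC scaleC_one)

end

lemma bounded_linear_scaleC: "bounded_linear ((*\<^sub>C) c :: 'a \<Rightarrow> 'a::complex_normed_vector)"
  by (rule bounded_linear_intro[where K = "cmod c"])
    (auto simp: scaleC_add_right scaleR_scaleC scaleC_scaleC norm_scaleC mult.commute)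

instantiation blinfun :: (real_normed_vector, complex_normed_vector) complex_normed_vector
begin

lift_definition scaleC_blinfun :: "complex \<Rightarrow> ('a \<Rightarrow>\<^sub>L 'b) \<Rightarrow> 'a \<Rightarrow>\<^sub>L 'b" is "\<lambda>c A x. c *\<^sub>C A x"
  by (rule bounded_linear_compose[OF bounded_linear_scaleC])

instance
proof
  fix c d :: complex and r :: real and A B :: "'a \<Rightarrow>\<^sub>L 'b"
  show "c *\<^sub>C (A + B) = c *\<^sub>C A + c *\<^sub>C B"
    by (transfer; simp add: fun_eq_iff scaleC_add_right)
  show "(c + d) *\<^sub>C A = c *\<^sub>C A + d *\<^sub>C A"
    by (transfer; simp add: fun_eq_iff scaleC_add_left)
  show "c *\<^sub>C d *\<^sub>C A = (c * d) *\<^sub>C A"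
    by (transfer; simp add: fun_eq_iff scaleC_scaleC)
  show "1 *\<^sub>C A = A"
    by (transfer; simp add: fun_eq_iff scaleC_one)
  show "r *\<^sub>R A = complex_of_real r *\<^sub>C A"
    by (transfer; simp add: fun_eq_iff scaleR_scaleC)
  have le: "norm (e *\<^sub>C D) \<le> cmod e * norm D" for e and D :: "'a \<Rightarrow>\<^sub>L 'b"
  proof (rule norm_blinfun_bound)
    fix x
    have "norm (blinfun_apply (e *\<^sub>C D) x) = cmod e * norm (blinfun_apply D x)"
      by (simp add: scaleC_blinfun.rep_eq norm_scaleC)
    also have "\<dots> \<le> cmod e * (norm D * norm x)"
      by (intro mult_left_mono norm_blinfun) auto
    finally show "norm (blinfun_apply (e *\<^sub>C D) x) \<le> cmod e * norm D * norm x"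
      by (simp add: mult.assoc)
  qed auto
  show "norm (c *\<^sub>C A) = cmod c * norm A"
  proof (cases "c = 0")
    case True
    then show ?thesis using le[of c A] by simp
  next
    case False
    have "A = inverse c *\<^sub>C c *\<^sub>C A"
      using False by (transfer; simp add: fun_eq_iff scaleC_scaleC scaleC_one)
    then have "norm A \<le> cmod (inverse c) * norm (c *\<^sub>C A)"
      using le[of "inverse c" "c *\<^sub>C A"] by simp
    then have "cmod c * norm A \<le> cmod c * (cmod (inverse c) * norm (c *\<^sub>C A))"
      by (intro mult_left_mono) auto
    also have "\<dots> = norm (c *\<^sub>C A)"
      using False by (simp add: norm_inverse)
    finally have "cmod c * norm A \<le> norm (c *\<^sub>C A)" .
    then show ?thesis using le[of c A] by simp
  qed
qed

end


section \<open>Bounded operators on a complex Hilbert space\<close>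

text \<open>The type of bounded linear maps in the library consists of the real-linear ones; \<open>B(H)\<close> is
  the set of those that are complex linear. The operator norm is the norm of that type.\<close>

definition BH :: "('h::complex_normed_vector \<Rightarrow>\<^sub>L 'h) set" where
  "BH = {A. \<forall>c x. blinfun_apply A (c *\<^sub>C x) = c *\<^sub>C blinfun_apply A x}"

definition adj :: "('h::chilbert_space \<Rightarrow>\<^sub>L 'h) \<Rightarrow> 'h \<Rightarrow>\<^sub>L 'h" where
  "adj A = (THE B. \<forall>x y. cinner (blinfun_apply A x) y = cinner x (blinfun_apply B y))"

definition positive_op :: "('h::chilbert_space \<Rightarrow>\<^sub>L 'h) \<Rightarrow> bool" where
  "positive_op A \<longleftrightarrow> (\<forall>x. cinner x (blinfun_apply A x) \<in> \<real>\<^sub>\<ge>\<^sub>0)"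

definition invertible_op :: "('h::complex_normed_vector \<Rightarrow>\<^sub>L 'h) \<Rightarrow> bool" where
  "invertible_op A \<longleftrightarrow> (\<exists>B. A o\<^sub>L B = id_blinfun \<and> B o\<^sub>L A = id_blinfun)"

definition op_less :: "('h::chilbert_space \<Rightarrow>\<^sub>L 'h) \<Rightarrow> ('h \<Rightarrow>\<^sub>L 'h) \<Rightarrow> bool" where
  "op_less A B \<longleftrightarrow> positive_op (B - A) \<and> invertible_op (B - A)"


section \<open>The noncommutative ball and free holomorphic functions\<close>

definition row_square :: "('h::chilbert_space \<Rightarrow>\<^sub>L 'h) ^ 'n::finite \<Rightarrow> 'h \<Rightarrow>\<^sub>L 'h" where
  "row_square X = (\<Sum>i\<in>UNIV. X $ i o\<^sub>L adj (X $ i))"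

definition nc_ball :: "(('h::chilbert_space \<Rightarrow>\<^sub>L 'h) ^ 'n::finite) set" where
  "nc_ball = {X. (\<forall>i. X $ i \<in> BH) \<and> sqrt (norm (row_square X)) < 1}"

text \<open>Words of the free semigroup are lists of letters from the finite index type \<open>'n\<close>; the empty
  list is the identity \<open>g\<^sub>0\<close>.\<close>

definition word_op :: "('h::complex_normed_vector \<Rightarrow>\<^sub>L 'h) ^ 'n::finite \<Rightarrow> 'n list \<Rightarrow> 'h \<Rightarrow>\<^sub>L 'h" where
  "word_op X w = foldr (\<lambda>i A. X $ i o\<^sub>L A) w id_blinfun"

definition has_free_expansion ::
  "(('h::chilbert_space \<Rightarrow>\<^sub>L 'h) ^ 'n::finite \<Rightarrow> 'h \<Rightarrow>\<^sub>L 'h) \<Rightarrow> ('n list \<Rightarrow> complex) \<Rightarrow> bool" where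
  "has_free_expansion f a \<longleftrightarrow>
     limsup (\<lambda>k. ereal (root (2 * k) (\<Sum>w | length w = k. (cmod (a w))\<^sup>2))) \<le> 1 \<and>
     (\<forall>X\<in>nc_ball. (\<lambda>k. \<Sum>w | length w = k. a w *\<^sub>C word_op X w) sums f X)"

definition free_holomorphic ::
  "(('h::chilbert_space \<Rightarrow>\<^sub>L 'h) ^ 'n::finite \<Rightarrow> 'h \<Rightarrow>\<^sub>L 'h) \<Rightarrow> bool" where
  "free_holomorphic f \<longleftrightarrow> (\<exists>a. has_free_expansion f a)"

text \<open>The coefficients are determined by the function since the Hilbert space is infinite
  dimensional.\<close>

definition free_coeff ::
  "(('h::chilbert_space \<Rightarrow>\<^sub>L 'h) ^ 'n::finite \<Rightarrow> 'h \<Rightarrow>\<^sub>L 'h) \<Rightarrow> 'n list \<Rightarrow> complex" where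
  "free_coeff f = (THE a. has_free_expansion f a)"

definition free_self_map ::
  "(('h::chilbert_space \<Rightarrow>\<^sub>L 'h) ^ 'n::finite \<Rightarrow> ('h \<Rightarrow>\<^sub>L 'h) ^ 'n) \<Rightarrow> bool" where
  "free_self_map \<phi> \<longleftrightarrow>
     (\<forall>i. free_holomorphic (\<lambda>X. \<phi> X $ i)) \<and> (\<forall>X\<in>nc_ball. \<phi> X \<in> nc_ball)"


section \<open>The Hardy space and composition operators\<close>

text \<open>A function on the ball is represented by its extension by \<open>0\<close> to all tuples of operators, so
  that equality of functions is equality on the ball.\<close>

definition H2_ball :: "(('h::chilbert_space \<Rightarrow>\<^sub>L 'h) ^ 'n::finite \<Rightarrow> 'h \<Rightarrow>\<^sub>L 'h) set" where
  "H2_ball = {f. free_holomorphic f \<and> (\<forall>X. X \<notin> nc_ball \<longrightarrow> f X = 0) \<and>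
                 (\<lambda>w. (cmod (free_coeff f w))\<^sup>2) summable_on UNIV}"

definition H2_norm :: "(('h::chilbert_space \<Rightarrow>\<^sub>L 'h) ^ 'n::finite \<Rightarrow> 'h \<Rightarrow>\<^sub>L 'h) \<Rightarrow> real" where
  "H2_norm f = sqrt (\<Sum>\<^sub>\<infinity>w. (cmod (free_coeff f w))\<^sup>2)"

text \<open>If \<open>f\<close> has coefficients \<open>a\<close> and \<open>\<phi>\<close> maps the ball into itself, then \<open>f (\<phi> X)\<close> is by
  definition the sum of the series \<open>\<Sum>\<^sub>k \<Sum>\<^bsub>|w| = k\<^esub> a\<^sub>w \<phi>\<^sub>w(X)\<close>.\<close>

definition comp_op ::
  "(('h::chilbert_space \<Rightarrow>\<^sub>L 'h) ^ 'n::finite \<Rightarrow> ('h \<Rightarrow>\<^sub>L 'h) ^ 'n) \<Rightarrow>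
   (('h \<Rightarrow>\<^sub>L 'h) ^ 'n \<Rightarrow> 'h \<Rightarrow>\<^sub>L 'h) \<Rightarrow> ('h \<Rightarrow>\<^sub>L 'h) ^ 'n \<Rightarrow> 'h \<Rightarrow>\<^sub>L 'h" where
  "comp_op \<phi> f = (\<lambda>X. if X \<in> nc_ball then f (\<phi> X) else 0)"


section \<open>Spectrum of an operator on a normed space given by a carrier and a norm\<close>

definition bounded_op_on ::
  "'v::complex_vector set \<Rightarrow> ('v \<Rightarrow> real) \<Rightarrow> ('v \<Rightarrow> 'v) \<Rightarrow> bool" where
  "bounded_op_on V N T \<longleftrightarrow>
     (\<forall>f\<in>V. T f \<in> V) \<and>
     (\<forall>f\<in>V. \<forall>g\<in>V. T (f + g) = T f + T g) \<and>
     (\<forall>c. \<forall>f\<in>V. T (c *\<^sub>C f) = c *\<^sub>C T f) \<and>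
     (\<exists>K. \<forall>f\<in>V. N (T f) \<le> K * N f)"

definition spectrum_on ::
  "'v::complex_vector set \<Rightarrow> ('v \<Rightarrow> real) \<Rightarrow> ('v \<Rightarrow> 'v) \<Rightarrow> complex set" where
  "spectrum_on V N T = {z. \<not> (\<exists>S. bounded_op_on V N S \<and>
     (\<forall>f\<in>V. S (T f - z *\<^sub>C f) = f \<and> T (S f) - z *\<^sub>C S f = f))}"

definition spectral_radius_on ::
  "'v::complex_vector set \<Rightarrow> ('v \<Rightarrow> real) \<Rightarrow> ('v \<Rightarrow> 'v) \<Rightarrow> real" where
  "spectral_radius_on V N T = (SUP z\<in>spectrum_on V N T. cmod z)"


section \<open>Elliptic and parabolic self-maps\<close>

definition scalar_tuple :: "complex ^ 'n::finite \<Rightarrow> ('h::complex_normed_vector \<Rightarrow>\<^sub>L 'h) ^ 'n" where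
  "scalar_tuple z = (\<chi> i. (z $ i) *\<^sub>C id_blinfun)"

text \<open>A free holomorphic self-map sends a scalar tuple of the ball to a scalar tuple.\<close>

definition scalar_map ::
  "(('h::chilbert_space \<Rightarrow>\<^sub>L 'h) ^ 'n::finite \<Rightarrow> ('h \<Rightarrow>\<^sub>L 'h) ^ 'n) \<Rightarrow> complex ^ 'n \<Rightarrow> complex ^ 'n" where
  "scalar_map \<phi> z = (THE w. \<phi> (scalar_tuple z) = scalar_tuple w)"

definition has_fixed_point ::
  "(('h::chilbert_space \<Rightarrow>\<^sub>L 'h) ^ 'n::finite \<Rightarrow> ('h \<Rightarrow>\<^sub>L 'h) ^ 'n) \<Rightarrow> bool" where
  "has_fixed_point \<phi> \<longleftrightarrow> (\<exists>z\<in>ball 0 1. scalar_map \<phi> z = z)"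

definition ellipsoid ::
  "real \<Rightarrow> complex ^ 'n::finite \<Rightarrow> (('h::chilbert_space \<Rightarrow>\<^sub>L 'h) ^ 'n) set" where
  "ellipsoid c \<zeta> = {X \<in> nc_ball.
     (let Y = id_blinfun - (\<Sum>i\<in>UNIV. cnj (\<zeta> $ i) *\<^sub>C (X $ i))
      in op_less (Y o\<^sub>L adj Y) ((c / (1 - c)) *\<^sub>R (id_blinfun - row_square X)))}"

text \<open>For a self-map without fixed points in the Euclidean ball there is exactly one such
  \<open>\<zeta>\<close>.\<close>

definition denjoy_wolff_point ::
  "(('h::chilbert_space \<Rightarrow>\<^sub>L 'h) ^ 'n::finite \<Rightarrow> ('h \<Rightarrow>\<^sub>L 'h) ^ 'n) \<Rightarrow> complex ^ 'n \<Rightarrow> bool" where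
  "denjoy_wolff_point \<phi> \<zeta> \<longleftrightarrow> \<zeta> \<in> sphere 0 1 \<and>
     (\<forall>c\<in>{0<..<1}. \<forall>m. (\<phi> ^^ m) ` ellipsoid c \<zeta> \<subseteq> ellipsoid c \<zeta>)"

definition dilatation_coeff ::
  "(('h::chilbert_space \<Rightarrow>\<^sub>L 'h) ^ 'n::finite \<Rightarrow> ('h \<Rightarrow>\<^sub>L 'h) ^ 'n) \<Rightarrow> complex ^ 'n \<Rightarrow> ereal" where
  "dilatation_coeff \<phi> \<zeta> =
     Liminf (at \<zeta> within ball 0 1)
       (\<lambda>z. ereal ((1 - (norm (scalar_map \<phi> z))\<^sup>2) / (1 - (norm z)\<^sup>2)))"

definition elliptic ::
  "(('h::chilbert_space \<Rightarrow>\<^sub>L 'h) ^ 'n::finite \<Rightarrow> ('h \<Rightarrow>\<^sub>L 'h) ^ 'n) \<Rightarrow> bool" where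
  "elliptic \<phi> \<longleftrightarrow> has_fixed_point \<phi>"

definition parabolic ::
  "(('h::chilbert_space \<Rightarrow>\<^sub>L 'h) ^ 'n::finite \<Rightarrow> ('h \<Rightarrow>\<^sub>L 'h) ^ 'n) \<Rightarrow> bool" where
  "parabolic \<phi> \<longleftrightarrow>
     \<not> has_fixed_point \<phi> \<and> (\<exists>\<zeta>. denjoy_wolff_point \<phi> \<zeta> \<and> dilatation_coeff \<phi> \<zeta> = 1)"

end

theory Submission
  imports Defs
begin

text \<open>
  An orthonormal basis \<open>(e\<^sub>w)\<close> of the Hilbert space indexed by words turns \<open>H\<^sup>2\<close> into that
  space: a vector \<open>x\<close> is the function with coefficients \<open>\<langle>e\<^sub>w, x\<rangle>\<close>. The creation operators
  \<open>S\<^sub>i e\<^sub>w = e\<^bsub>iw\<^esub>\<close> give points \<open>rS\<close> of the ball at which a function determines its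
  coefficients.

  Let \<open>\<mu> = \<phi>(0)\<close>. The tuple \<open>\<Phi> = \<phi>(rS)\<close> is a row contraction with \<open>\<Phi>\<^sub>i\<^sup>* e = \<mu>\<^sub>i\<^sup>* e\<close> for the
  vacuum vector \<open>e\<close>. With \<open>L = \<Sum> \<mu>\<^sub>i\<^sup>* \<Phi>\<^sub>i\<close> the vector \<open>e - L e\<close> is the defect vector
  \<open>(I - \<Phi>\<Phi>\<^sup>*) e\<close>, so \<open>\<parallel>p(\<Phi>)(e - L e)\<parallel>\<^sup>2 \<le> (1 - \<parallel>\<mu>\<parallel>\<^sup>2) \<parallel>p\<parallel>\<^sup>2\<close>; since right multiplication
  by \<open>\<Sum> \<mu>\<^sub>i\<^sup>* X\<^sub>i\<close> has norm \<open>\<parallel>\<mu>\<parallel>\<close>, expanding \<open>e = \<Sum> L\<^sup>j (e - L e)\<close> gives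
  \<open>\<parallel>C\<^sub>\<phi>\<parallel> \<le> ((1 + \<parallel>\<mu>\<parallel>) / (1 - \<parallel>\<mu>\<parallel>))\<^bsup>1/2\<^esup>\<close>.

  Applied to the iterates, this bounds the powers of \<open>C\<^sub>\<phi>\<close> by the numbers
  \<open>d\<^sub>m = 1 - \<parallel>\<phi>\<^sup>m(0)\<parallel>\<^sup>2\<close>. In the elliptic case \<open>d\<^sub>m\<close> is bounded below by the Schwarz--Pick
  inequality. In the parabolic case the invariant ellipsoids show that \<open>\<phi>\<^sup>m(0)\<close> is close to \<open>\<zeta>\<close>
  whenever \<open>d\<^sub>m\<close> is small, and there dilatation coefficient \<open>1\<close> gives \<open>d\<^bsub>m+1\<^esub> \<ge> p d\<^sub>m\<close> for any
  \<open>p < 1\<close>; hence \<open>d\<^sub>m \<ge> C p\<^sup>m\<close>. So the Neumann series of the resolvent converges outside the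
  closed unit disc, while constants are eigenvectors for the eigenvalue \<open>1\<close>.
\<close>

section \<open>Complex inner products\<close>

lemma cinner_add_left: "cinner (x + y) (z::'a::chilbert_space) = cinner x z + cinner y z"
  by (metis cinner_add_right cinner_commute complex_cnj_add)

lemma cinner_scaleC_left: "cinner (c *\<^sub>C x) (y::'a::chilbert_space) = cnj c * cinner x y"
  by (metis cinner_commute cinner_scaleC_right complex_cnj_mult)

lemma cinner_zero_right [simp]: "cinner x (0::'a::chilbert_space) = 0"
  using cinner_add_right[of x 0 0] by simp

lemma cinner_zero_left [simp]: "cinner (0::'a::chilbert_space) x = 0"
  using cinner_add_left[of 0 0 x] by simp

lemma cinner_minus_right: "cinner x (- y::'a::chilbert_space) = - cinner x y"
  using cinner_add_right[of x y "- y"] by (simp add: eq_neg_iff_add_eq_0 add.commute)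

lemma cinner_minus_left: "cinner (- x) (y::'a::chilbert_space) = - cinner x y"
  using cinner_add_left[of x "- x" y] by (simp add: eq_neg_iff_add_eq_0 add.commute)

lemma cinner_diff_right: "cinner x (y - z::'a::chilbert_space) = cinner x y - cinner x z"
  using cinner_add_right[of x y "- z"] by (simp add: cinner_minus_right)

lemma cinner_diff_left: "cinner (x - y) (z::'a::chilbert_space) = cinner x z - cinner y z"
  using cinner_add_left[of x "- y" z] by (simp add: cinner_minus_left)

lemma cinner_sum_right: "cinner x (\<Sum>i\<in>A. f i::'a::chilbert_space) = (\<Sum>i\<in>A. cinner x (f i))"
  by (induction A rule: infinite_finite_induct) (auto simp: cinner_add_right)

lemma cinner_sum_left: "cinner (\<Sum>i\<in>A. f i) (x::'a::chilbert_space) = (\<Sum>i\<in>A. cinner (f i) x)"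
  by (induction A rule: infinite_finite_induct) (auto simp: cinner_add_left)

lemmas cinner_algebra = cinner_add_left cinner_add_right cinner_diff_left cinner_diff_right
  cinner_minus_left cinner_minus_right cinner_scaleC_left cinner_scaleC_right

lemma scaleC_zero_left [simp]: "0 *\<^sub>C (x::'a::complex_vector) = 0"
  using scaleC_add_left[of 0 0 x] by simp

lemma scaleC_zero_right [simp]: "c *\<^sub>C (0::'a::complex_vector) = 0"
  using scaleC_add_right[of c 0 0] by simp

lemma scaleC_minus_left: "(- c) *\<^sub>C (x::'a::complex_vector) = - (c *\<^sub>C x)"
  using scaleC_add_left[of c "- c" x] by (simp add: eq_neg_iff_add_eq_0 add.commute)

lemma scaleC_minus_right: "c *\<^sub>C (- x::'a::complex_vector) = - (c *\<^sub>C x)"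
  using scaleC_add_right[of c x "- x"] by (simp add: eq_neg_iff_add_eq_0 add.commute)

lemma scaleC_diff_left: "(c - d) *\<^sub>C (x::'a::complex_vector) = c *\<^sub>C x - d *\<^sub>C x"
  using scaleC_add_left[of c "- d" x] by (simp add: scaleC_minus_left)

lemma scaleC_diff_right: "c *\<^sub>C (x - y::'a::complex_vector) = c *\<^sub>C x - c *\<^sub>C y"
  using scaleC_add_right[of c x "- y"] by (simp add: scaleC_minus_right)

lemma scaleC_sum_right: "c *\<^sub>C (\<Sum>i\<in>A. f i::'a::complex_vector) = (\<Sum>i\<in>A. c *\<^sub>C f i)"
  by (induction A rule: infinite_finite_induct) (auto simp: scaleC_add_right)

lemma scaleC_sum_left: "(\<Sum>i\<in>A. f i) *\<^sub>C (x::'a::complex_vector) = (\<Sum>i\<in>A. f i *\<^sub>C x)"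
  by (induction A rule: infinite_finite_induct) (auto simp: scaleC_add_left)

lemma norm_eq_Re_cinner: "(norm (x::'a::chilbert_space))\<^sup>2 = Re (cinner x x)"
  by (simp add: cinner_self)

lemma norm_add_square:
  "(norm (x + y::'a::chilbert_space))\<^sup>2 = (norm x)\<^sup>2 + 2 * Re (cinner x y) + (norm y)\<^sup>2"
  using cinner_commute[of y x]
  by (simp add: norm_eq_Re_cinner cinner_add_left cinner_add_right)

text \<open>Cauchy-Schwarz. The vector \<open>N x - c y\<close> is \<open>N\<close> times the
  component of \<open>x\<close> orthogonal to \<open>y\<close>; scaling by \<open>N\<close> avoids a
  division.\<close>

lemma norm_cinner_le: "cmod (cinner x y) \<le> norm x * norm (y::'a::chilbert_space)"
proof (cases "y = 0")
  case False
  define c where "c = cinner y x"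
  define N where "N = (norm y)\<^sup>2"
  have N: "N > 0" using False by (simp add: N_def)
  have c': "cinner x y = cnj c" by (metis c_def cinner_commute)
  have yy: "cinner y y = complex_of_real N" by (simp add: cinner_self N_def)
  have "0 \<le> (norm (complex_of_real N *\<^sub>C x - c *\<^sub>C y))\<^sup>2" by simp
  also have "\<dots> = Re (complex_of_real N * complex_of_real N * cinner x x - complex_of_real N * (c * cnj c))"
    unfolding norm_eq_Re_cinner
    by (simp add: cinner_algebra c' c_def[symmetric] yy algebra_simps)
  also have "\<dots> = N * (N * (norm x)\<^sup>2 - (cmod c)\<^sup>2)"
    unfolding complex_norm_square[symmetric] cinner_self
    by (simp add: algebra_simps flip: of_real_mult of_real_diff)
  finally have "(cmod c)\<^sup>2 \<le> N * (norm x)\<^sup>2" using N by (simp add: zero_le_mult_iff)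
  then have "(cmod c)\<^sup>2 \<le> (norm x * norm y)\<^sup>2" by (simp add: N_def power_mult_distrib mult.commute)
  then have "cmod c \<le> norm x * norm y" by (rule power2_le_imp_le) simp
  then show ?thesis by (simp add: c')
qed simp

lemma bounded_linear_cinner: "bounded_linear (cinner (x::'a::chilbert_space))"
proof (rule bounded_linear_intro[where K = "norm x"])
  show "norm (cinner x y) \<le> norm y * norm x" for y
    using norm_cinner_le[of x y] by (simp add: mult.commute)
qed (auto simp: cinner_add_right scaleR_scaleC cinner_scaleC_right scaleR_conv_of_real)

lemma cinner_ext: "(\<And>z. cinner z x = cinner z (y::'a::chilbert_space)) \<Longrightarrow> x = y"
  by (metis cinner_diff_right cinner_self eq_iff_diff_eq_0 norm_eq_zero of_real_eq_0_iff
      power_eq_0_iff right_minus_eq)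

lemma bounded_linear_scaleC_left: "bounded_linear (\<lambda>c. c *\<^sub>C (x::'a::complex_normed_vector))"
  by (rule bounded_linear_intro[where K = "norm x"])
    (auto simp: scaleC_add_left scaleR_scaleC scaleC_scaleC norm_scaleC scaleR_conv_of_real)

lemma scaleC_blinfun_apply [simp]: "blinfun_apply (c *\<^sub>C A) x = c *\<^sub>C blinfun_apply A x"
  by (simp add: scaleC_blinfun.rep_eq)

section \<open>Orthogonal series and Bessel's inequality\<close>

lemma norm_orthogonal_sum:
  fixes u :: "'i \<Rightarrow> 'a::chilbert_space"
  assumes "finite F" "\<And>i j. i \<in> F \<Longrightarrow> j \<in> F \<Longrightarrow> i \<noteq> j \<Longrightarrow> cinner (u i) (u j) = 0"
  shows "(norm (\<Sum>i\<in>F. u i))\<^sup>2 = (\<Sum>i\<in>F. (norm (u i))\<^sup>2)"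
  using assms
proof (induction F rule: finite_induct)
  case (insert i F)
  have "cinner (u i) (\<Sum>j\<in>F. u j) = 0"
    using insert by (auto simp: cinner_sum_right intro!: sum.neutral)
  then show ?case using insert by (simp add: norm_add_square)
qed simp

text \<open>By Pythagoras a block of the vector series has squared norm equal to the same block of
  the scalar series, so the Cauchy criterion carries over.\<close>

lemma orthogonal_series:
  fixes u :: "nat \<Rightarrow> 'a::chilbert_space"
  assumes orth: "\<And>i j. i \<noteq> j \<Longrightarrow> cinner (u i) (u j) = 0"
    and sm: "summable (\<lambda>i. (norm (u i))\<^sup>2)"
  shows "summable u" "(norm (suminf u))\<^sup>2 = (\<Sum>i. (norm (u i))\<^sup>2)"
proof -
  show 1: "summable u"
    unfolding summable_Cauchy
  proof (intro allI impI)
    fix \<epsilon> :: real assume "\<epsilon> > 0"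
    then have "\<epsilon>\<^sup>2 > 0" by simp
    then obtain N where N: "\<And>m n. m \<ge> N \<Longrightarrow> norm (\<Sum>i\<in>{m..<n}. (norm (u i))\<^sup>2) < \<epsilon>\<^sup>2"
      using sm unfolding summable_Cauchy by meson
    show "\<exists>N. \<forall>m\<ge>N. \<forall>n. norm (sum u {m..<n}) < \<epsilon>"
    proof (intro exI allI impI)
      fix m n assume "N \<le> m"
      have "(norm (sum u {m..<n}))\<^sup>2 = (\<Sum>i\<in>{m..<n}. (norm (u i))\<^sup>2)"
        by (rule norm_orthogonal_sum) (auto intro: orth)
      also have "\<dots> < \<epsilon>\<^sup>2" using N[OF \<open>N \<le> m\<close>, of n] by (simp add: sum_nonneg)
      finally show "norm (sum u {m..<n}) < \<epsilon>"
        by (rule power2_less_imp_less) (use \<open>\<epsilon> > 0\<close> in simp)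
    qed
  qed
  have "(\<lambda>m. (norm (\<Sum>i<m. u i))\<^sup>2) \<longlonglongrightarrow> (norm (suminf u))\<^sup>2"
    using summable_LIMSEQ[OF 1] by (intro tendsto_intros)
  moreover have "(\<lambda>m. (norm (\<Sum>i<m. u i))\<^sup>2) \<longlonglongrightarrow> (\<Sum>i. (norm (u i))\<^sup>2)"
    using summable_LIMSEQ[OF sm] by (simp add: norm_orthogonal_sum orth)
  ultimately show "(norm (suminf u))\<^sup>2 = (\<Sum>i. (norm (u i))\<^sup>2)"
    by (rule LIMSEQ_unique)
qed

text \<open>The projection \<open>y\<close> of \<open>x\<close> onto the span satisfies
  \<open>cinner y x\<close> = norm of \<open>y\<close> squared, so Cauchy-Schwarz gives
  \<open>norm y \<le> norm x\<close>.\<close>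

lemma bessel:
  fixes u :: "'i \<Rightarrow> 'a::chilbert_space"
  assumes "finite F"
    and "\<And>i j. i \<in> F \<Longrightarrow> j \<in> F \<Longrightarrow> cinner (u i) (u j) = (if i = j then 1 else 0)"
  shows "(\<Sum>i\<in>F. (cmod (cinner (u i) x))\<^sup>2) \<le> (norm x)\<^sup>2"
proof -
  define y where "y = (\<Sum>i\<in>F. cinner (u i) x *\<^sub>C u i)"
  have n1: "norm (u i) = 1" if "i \<in> F" for i
  proof -
    have "(norm (u i))\<^sup>2 = 1\<^sup>2"
      using norm_eq_Re_cinner[of "u i"] assms(2)[OF that that] by simp
    then show ?thesis by (rule power2_eq_imp_eq) auto
  qed
  have ny: "(norm y)\<^sup>2 = (\<Sum>i\<in>F. (cmod (cinner (u i) x))\<^sup>2)"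
    unfolding y_def using assms(1)
    by (subst norm_orthogonal_sum) (auto simp: cinner_algebra assms(2) norm_scaleC n1)
  have *: "cnj c * c = complex_of_real ((cmod c)\<^sup>2)" for c
    by (simp only: complex_norm_square mult.commute)
  have "cinner y x = complex_of_real (\<Sum>i\<in>F. (cmod (cinner (u i) x))\<^sup>2)"
    unfolding y_def cinner_sum_left by (simp only: cinner_scaleC_left * of_real_sum)
  then have "cinner y x = complex_of_real ((norm y)\<^sup>2)" by (simp only: ny)
  then have "(norm y)\<^sup>2 \<le> norm y * norm x"
    using norm_cinner_le[of y x] by (simp add: norm_power)
  then have "norm y \<le> norm x"
    by (cases "norm y = 0") (auto simp: power2_eq_square)
  then show ?thesis unfolding ny[symmetric] by (rule power_mono) simp
qed

section \<open>Word-indexed orthonormal bases and adjoints\<close>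

lemma BH_scaleC: "A \<in> BH \<Longrightarrow> blinfun_apply A (c *\<^sub>C x) = c *\<^sub>C blinfun_apply A x"
  by (simp add: BH_def)

text \<open>Enumerating the words turns families indexed by words into ordinary series over the
  naturals.\<close>

definition nth_word :: "nat \<Rightarrow> 'n::finite list" where
  "nth_word = from_nat_into UNIV"

lemma bij_nth_word: "bij (nth_word :: nat \<Rightarrow> 'n::finite list)"
proof -
  have "countable (lists (UNIV :: 'n set))"
    by (intro countable_lists countable_finite) simp
  then have "countable (UNIV :: 'n list set)" by simp
  then show ?thesis
    unfolding nth_word_def by (intro bij_betw_from_nat_into infinite_UNIV_listI)
qed

lemma nth_word_eq_iff [simp]: "nth_word i = nth_word j \<longleftrightarrow> i = j"
  by (rule inj_eq[OF bij_is_inj[OF bij_nth_word]])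

lemma nth_word_ex: "\<exists>k. w = nth_word k"
  using bij_nth_word by (auto simp: bij_def surj_def)

locale word_basis =
  fixes e :: "'n::finite list \<Rightarrow> 'h::chilbert_space"
  assumes orth: "cinner (e v) (e w) = (if v = w then 1 else 0)"
    and total: "(\<And>w. cinner (e w) x = 0) \<Longrightarrow> x = 0"
begin

lemma norm_e [simp]: "norm (e w) = 1"
proof -
  have "(norm (e w))\<^sup>2 = 1\<^sup>2"
    using norm_eq_Re_cinner[of "e w"] by (simp add: orth)
  then show ?thesis by (rule power2_eq_imp_eq) auto
qed

lemma basis_eqI: "(\<And>w. cinner (e w) x = cinner (e w) y) \<Longrightarrow> x = y"
  using total[of "x - y"] by (simp add: cinner_diff_right)

lemma summable_coeff: "summable (\<lambda>k. (cmod (cinner (e (nth_word k)) x))\<^sup>2)"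
proof (rule summableI_nonneg_bounded)
  show "(\<Sum>k<m. (cmod (cinner (e (nth_word k)) x))\<^sup>2) \<le> (norm x)\<^sup>2" for m
    by (rule bessel) (auto simp: orth)
qed simp

text \<open>The vectors need only be orthogonal with norm at most 1. This serves both for expansions
  in the basis and for operators prescribed on the basis.\<close>

lemma orthogonal_family_series:
  fixes u :: "'n list \<Rightarrow> 'h"
  assumes "\<And>v w. v \<noteq> w \<Longrightarrow> cinner (u v) (u w) = 0" "\<And>w. norm (u w) \<le> 1"
    and "summable (\<lambda>k. (cmod (a (nth_word k)))\<^sup>2)"
  defines "f \<equiv> \<lambda>k. a (nth_word k) *\<^sub>C u (nth_word k)"
  shows "summable f" "(norm (suminf f))\<^sup>2 \<le> (\<Sum>k. (cmod (a (nth_word k)))\<^sup>2)"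
proof -
  have o: "i \<noteq> j \<Longrightarrow> cinner (f i) (f j) = 0" for i j
    using assms(1) by (simp add: f_def cinner_algebra)
  have le: "(norm (f i))\<^sup>2 \<le> (cmod (a (nth_word i)))\<^sup>2" for i
    unfolding f_def norm_scaleC using assms(2)
    by (intro power_mono) (auto simp: mult_left_le)
  have s: "summable (\<lambda>i. (norm (f i))\<^sup>2)"
    by (rule summable_comparison_test'[OF assms(3)]) (use le in simp)
  show "summable f" by (rule orthogonal_series[OF o s])
  have "(norm (suminf f))\<^sup>2 = (\<Sum>i. (norm (f i))\<^sup>2)" by (rule orthogonal_series[OF o s])
  also have "\<dots> \<le> (\<Sum>k. (cmod (a (nth_word k)))\<^sup>2)"
    by (rule suminf_le[OF le s assms(3)])
  finally show "(norm (suminf f))\<^sup>2 \<le> (\<Sum>k. (cmod (a (nth_word k)))\<^sup>2)" .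
qed

text \<open>Riesz-Fischer: every square-summable family is the coefficient family of a
  vector.\<close>

lemma synthesis:
  assumes "summable (\<lambda>k. (cmod (a (nth_word k)))\<^sup>2)"
  obtains x where "\<And>w. cinner (e w) x = a w"
    "(\<lambda>k. a (nth_word k) *\<^sub>C e (nth_word k)) sums x"
proof -
  have s: "summable (\<lambda>k. a (nth_word k) *\<^sub>C e (nth_word k))"
    by (rule orthogonal_family_series(1)[OF _ _ assms]) (auto simp: orth)
  define x where "x = (\<Sum>k. a (nth_word k) *\<^sub>C e (nth_word k))"
  have x: "(\<lambda>k. a (nth_word k) *\<^sub>C e (nth_word k)) sums x"
    unfolding x_def by (rule summable_sums[OF s])
  have "cinner (e w) x = a w" for w
  proof -
    obtain k where k: "w = nth_word k" using nth_word_ex by blast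
    have "(\<lambda>j. cinner (e w) (a (nth_word j) *\<^sub>C e (nth_word j))) sums cinner (e w) x"
      by (rule bounded_linear.sums[OF bounded_linear_cinner x])
    moreover have "(\<lambda>j. cinner (e w) (a (nth_word j) *\<^sub>C e (nth_word j))) = (\<lambda>j. if j = k then a w else 0)"
      by (auto simp: k orth cinner_scaleC_right)
    ultimately show ?thesis using sums_single[of k "\<lambda>_. a w"] sums_unique2 by fastforce
  qed
  then show ?thesis using x that by blast
qed

lemma expansion: "(\<lambda>k. cinner (e (nth_word k)) x *\<^sub>C e (nth_word k)) sums x"
proof -
  obtain y where y: "\<And>w. cinner (e w) y = cinner (e w) x"
    "(\<lambda>k. cinner (e (nth_word k)) x *\<^sub>C e (nth_word k)) sums y"
    using synthesis[OF summable_coeff] by blast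
  then have "y = x" by (intro basis_eqI)
  with y show ?thesis by simp
qed

lemma parseval: "(\<lambda>k. (cmod (cinner (e (nth_word k)) x))\<^sup>2) sums (norm x)\<^sup>2"
proof -
  have "(norm (\<Sum>k. cinner (e (nth_word k)) x *\<^sub>C e (nth_word k)))\<^sup>2
      = (\<Sum>k. (norm (cinner (e (nth_word k)) x *\<^sub>C e (nth_word k)))\<^sup>2)"
    by (rule orthogonal_series(2)) (auto simp: cinner_algebra orth norm_scaleC summable_coeff)
  then have "(norm x)\<^sup>2 = (\<Sum>k. (cmod (cinner (e (nth_word k)) x))\<^sup>2)"
    using sums_unique[OF expansion[of x]] by (simp add: norm_scaleC)
  then show ?thesis using summable_sums[OF summable_coeff[of x]] by simp
qed

lemma parseval_has_sum: "((\<lambda>w. (cmod (cinner (e w) x))\<^sup>2) has_sum (norm x)\<^sup>2) UNIV"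
proof -
  have "((\<lambda>k. (cmod (cinner (e (nth_word k)) x))\<^sup>2) has_sum (norm x)\<^sup>2) UNIV"
    using parseval[of x] by (intro norm_summable_imp_has_sum) (auto simp: sums_iff)
  then show ?thesis
    using has_sum_reindex_bij_betw[OF bij_nth_word, of "\<lambda>w. (cmod (cinner (e w) x))\<^sup>2"] by simp
qed

text \<open>\<open>bounded_linear\<close> means real-linear, so agreement is required on all complex
  multiples of basis vectors. Many later identities are proved by this principle.\<close>

lemma linear_eq_on_basis:
  fixes f g :: "'h \<Rightarrow> 'b::real_normed_vector"
  assumes "bounded_linear f" "bounded_linear g" "\<And>c w. f (c *\<^sub>C e w) = g (c *\<^sub>C e w)"
  shows "f x = g x"
  using bounded_linear.sums[OF assms(1) expansion[of x]] bounded_linear.sums[OF assms(2) expansion[of x]]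
    sums_unique2 unfolding assms(3) by blast

text \<open>An orthogonal family of vectors of norm at most 1 is the image of the basis under a
  contraction, by Parseval.\<close>

lemma basis_operator:
  fixes u :: "'n list \<Rightarrow> 'h"
  assumes "\<And>v w. v \<noteq> w \<Longrightarrow> cinner (u v) (u w) = 0" "\<And>w. norm (u w) \<le> 1"
  obtains T where "T \<in> BH" "\<And>w. blinfun_apply T (e w) = u w"
proof -
  define f where "f = (\<lambda>x k. cinner (e (nth_word k)) x *\<^sub>C u (nth_word k))"
  define T where "T = (\<lambda>x. suminf (f x))"
  have s: "summable (f x)" for x
    unfolding f_def by (rule orthogonal_family_series(1)[OF assms summable_coeff])
  have n: "norm (T x) \<le> norm x" for x
  proof -
    have "(norm (T x))\<^sup>2 \<le> (\<Sum>k. (cmod (cinner (e (nth_word k)) x))\<^sup>2)"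
      unfolding T_def f_def by (rule orthogonal_family_series(2)[OF assms summable_coeff])
    also have "\<dots> = (norm x)\<^sup>2" using sums_unique[OF parseval[of x]] by simp
    finally show ?thesis by (rule power2_le_imp_le) simp
  qed
  have add: "T (x + y) = T x + T y" for x y
    using suminf_add[OF s s, of x y]
    by (simp add: T_def f_def cinner_add_right scaleC_add_left)
  have sc: "T (c *\<^sub>C x) = c *\<^sub>C T x" for c x
    using bounded_linear.suminf[OF bounded_linear_scaleC s, of c x]
    by (simp add: T_def f_def cinner_scaleC_right scaleC_scaleC)
  have bl: "bounded_linear T"
    by (rule bounded_linear_intro[where K = 1]) (auto simp: add sc scaleR_scaleC n)
  have Te: "T (e w) = u w" for w
  proof -
    obtain k where k: "w = nth_word k" using nth_word_ex by blast
    have "f (e w) = (\<lambda>j. if j = k then u w else 0)"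
      by (auto simp: f_def k orth scaleC_one)
    then show ?thesis unfolding T_def using sums_single[of k "\<lambda>_. u w"] sums_unique by fastforce
  qed
  show ?thesis
    by (rule that[of "Blinfun T"]) (auto simp: BH_def bounded_linear_Blinfun_apply[OF bl] sc Te)
qed

section \<open>Riesz representation and adjoints\<close>

text \<open>The representing vector is synthesised from the conjugated values of \<open>f\<close> on
  the basis.\<close>

lemma riesz:
  assumes "bounded_linear f" "\<And>c x. f (c *\<^sub>C x) = c * f x"
  obtains y :: 'h where "\<And>x. f x = cinner y x"
proof -
  interpret f: bounded_linear f by fact
  obtain K where K: "K > 0" "\<And>x. cmod (f x) \<le> norm x * K" using f.pos_bounded by blast
  have "summable (\<lambda>k. (cmod (cnj (f (e (nth_word k)))))\<^sup>2)"
  proof (rule summableI_nonneg_bounded)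
    fix m
    define s where "s = (\<Sum>k<m. (cmod (f (e (nth_word k))))\<^sup>2)"
    \<comment> \<open>Testing \<open>f\<close> on this truncated candidate gives \<open>f y\<close>
      = norm of \<open>y\<close> squared, hence \<open>norm y \<le> K\<close> independently of
      \<open>m\<close>.\<close>
    define y where "y = (\<Sum>k<m. cnj (f (e (nth_word k))) *\<^sub>C e (nth_word k))"
    have ny: "(norm y)\<^sup>2 = s"
      unfolding y_def s_def by (subst norm_orthogonal_sum) (auto simp: cinner_algebra orth norm_scaleC)
    have *: "cnj c * c = complex_of_real ((cmod c)\<^sup>2)" for c
      by (simp only: complex_norm_square mult.commute)
    have "f y = complex_of_real s"
      unfolding y_def s_def f.sum of_real_sum by (simp only: assms(2) *)
    moreover have "s \<ge> 0" by (simp add: s_def sum_nonneg)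
    ultimately have "(norm y)\<^sup>2 \<le> norm y * K" using K(2)[of y] by (simp add: ny)
    then have "norm y \<le> K" using K(1) by (cases "norm y = 0") (auto simp: power2_eq_square)
    then have "(norm y)\<^sup>2 \<le> K\<^sup>2" by (rule power_mono) simp
    then show "(\<Sum>k<m. (cmod (cnj (f (e (nth_word k)))))\<^sup>2) \<le> K\<^sup>2" by (simp add: ny s_def)
  qed simp
  then obtain y where y: "\<And>w. cinner (e w) y = cnj (f (e w))"
    using synthesis[of "\<lambda>w. cnj (f (e w))"] by blast
  have "f x = cinner y x" for x
  proof (rule linear_eq_on_basis[OF assms(1) bounded_linear_cinner])
    show "f (c *\<^sub>C e w) = cinner y (c *\<^sub>C e w)" for c w
      using y[of w] cinner_commute[of y "e w"] by (simp add: assms(2) cinner_scaleC_right)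
  qed
  then show ?thesis by (rule that)
qed

lemma adj_eqI:
  assumes "\<And>x y. cinner (blinfun_apply A x) y = cinner x (blinfun_apply B (y::'h))"
  shows "adj A = B"
  unfolding adj_def
proof (rule the_equality)
  show "\<forall>x y. cinner (blinfun_apply A x) y = cinner x (blinfun_apply B y)" using assms by blast
next
  fix C assume "\<forall>x y. cinner (blinfun_apply A x) y = cinner x (blinfun_apply C y)"
  then have "blinfun_apply C y = blinfun_apply B y" for y
    by (intro cinner_ext) (metis assms)
  then show "C = B" by (rule blinfun_eqI)
qed

text \<open>\<open>adj\<close> is a definite description, so existence must be supplied: the Riesz
  vectors of the functionals \<open>cinner y (A x)\<close> depend linearly and boundedly on
  \<open>y\<close>.\<close>

lemma cinner_adj:
  assumes "A \<in> BH"
  shows "cinner (blinfun_apply A x) y = cinner x (blinfun_apply (adj A) (y::'h))"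
proof -
  have "\<exists>b. \<forall>x. cinner y (blinfun_apply A x) = cinner b x" for y
  proof -
    have "bounded_linear (\<lambda>x. cinner y (blinfun_apply A x))"
      by (intro bounded_linear_compose[OF bounded_linear_cinner] blinfun.bounded_linear_right)
    then show ?thesis
      by (rule riesz) (use assms in \<open>auto simp: BH_scaleC cinner_scaleC_right\<close>)
  qed
  then obtain B where B: "\<And>x y. cinner y (blinfun_apply A x) = cinner (B y) x" by metis
  have B': "cinner x (B y) = cinner (blinfun_apply A x) y" for x y
    by (metis B cinner_commute)
  have bl: "bounded_linear B"
  proof (rule bounded_linear_intro[where K = "norm A"])
    show "B (x + y) = B x + B y" for x y
      by (rule cinner_ext) (simp add: cinner_add_right B')
    show "B (r *\<^sub>R x) = r *\<^sub>R B x" for r x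
      by (rule cinner_ext) (simp add: scaleR_scaleC cinner_scaleC_right B')
    show "norm (B y) \<le> norm y * norm A" for y
    proof -
      have "(norm (B y))\<^sup>2 = cmod (cinner (B y) (B y))" by (simp add: cinner_self norm_power)
      also have "\<dots> = cmod (cinner y (blinfun_apply A (B y)))" by (simp add: B)
      also have "\<dots> \<le> norm y * (norm A * norm (B y))"
        by (rule order_trans[OF norm_cinner_le]) (intro mult_left_mono norm_blinfun norm_ge_zero)
      finally show ?thesis by (cases "norm (B y) = 0") (auto simp: power2_eq_square)
    qed
  qed
  then have "adj A = Blinfun B"
    by (intro adj_eqI) (simp add: bounded_linear_Blinfun_apply B')
  then show ?thesis by (simp add: bounded_linear_Blinfun_apply bl B')
qed

lemma adj_scaled_id: "adj (c *\<^sub>C id_blinfun :: 'h \<Rightarrow>\<^sub>L 'h) = cnj c *\<^sub>C id_blinfun"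
  by (rule adj_eqI) (simp add: cinner_algebra)

section \<open>Row contractions and the noncommutative ball\<close>

text \<open>The row operator from the \<open>n\<close>-fold direct sum to the Hilbert space has norm
  at most \<rho>. This form avoids adjoints.\<close>

definition row_contraction :: "real \<Rightarrow> ('h \<Rightarrow>\<^sub>L 'h) ^ 'n \<Rightarrow> bool" where
  "row_contraction \<rho> X \<longleftrightarrow> 0 \<le> \<rho> \<and>
     (\<forall>h. (norm (\<Sum>i\<in>UNIV. blinfun_apply (X $ i) (h i)))\<^sup>2 \<le> \<rho>\<^sup>2 * (\<Sum>i\<in>UNIV. (norm (h i))\<^sup>2))"

lemma cinner_row_square:
  assumes "\<forall>i. X $ i \<in> BH"
  shows "cinner y (blinfun_apply (row_square X) y) =
    complex_of_real (\<Sum>i\<in>UNIV. (norm (blinfun_apply (adj ((X :: ('h \<Rightarrow>\<^sub>L 'h) ^ 'n) $ i)) y))\<^sup>2)"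
proof -
  have "cinner y (blinfun_apply (X $ i) z) = cinner (blinfun_apply (adj (X $ i)) y) z" for i z
    by (metis assms cinner_adj cinner_commute)
  then show ?thesis
    by (simp add: row_square_def blinfun.sum_left cinner_sum_right cinner_self)
qed

lemma cinner_sum_le:
  fixes f g :: "'i \<Rightarrow> 'h"
  shows "cmod (\<Sum>i\<in>A. cinner (f i) (g i)) \<le> sqrt (\<Sum>i\<in>A. (norm (f i))\<^sup>2) * sqrt (\<Sum>i\<in>A. (norm (g i))\<^sup>2)"
proof -
  have "cmod (\<Sum>i\<in>A. cinner (f i) (g i)) \<le> (\<Sum>i\<in>A. \<bar>norm (f i)\<bar> * \<bar>norm (g i)\<bar>)"
    by (rule order_trans[OF norm_sum]) (auto intro!: sum_mono norm_cinner_le)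
  also have "\<dots> \<le> L2_set (\<lambda>i. norm (f i)) A * L2_set (\<lambda>i. norm (g i)) A"
    by (rule L2_set_mult_ineq)
  finally show ?thesis by (simp add: L2_set_def)
qed

text \<open>The norm of the row operator is the square root of the norm of
  \<open>row_square X\<close>. From here on membership in the ball is handled through row
  contractions.\<close>

lemma nc_ball_iff:
  "X \<in> nc_ball \<longleftrightarrow> (\<forall>i. X $ i \<in> BH) \<and> (\<exists>\<rho><1. row_contraction \<rho> X)"
proof -
  define R where "R = row_square X"
  \<comment> \<open>\<open>Z y\<close> is the norm of the adjoint row applied to \<open>y\<close>;
    its square is \<open>cinner y (R y)\<close>.\<close>
  define Z where "Z = (\<lambda>y. sqrt (\<Sum>i\<in>UNIV. (norm (blinfun_apply (adj (X $ i)) y))\<^sup>2))"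
  have Z0: "Z y \<ge> 0" for y by (simp add: Z_def sum_nonneg)
  have "(\<exists>\<rho><1. row_contraction \<rho> X) \<longleftrightarrow> sqrt (norm R) < 1" if bh: "\<forall>i. X $ i \<in> BH"
  proof
    assume "sqrt (norm R) < 1"
    moreover have "row_contraction (sqrt (norm R)) X"
      unfolding row_contraction_def
    proof (intro conjI allI)
      fix h
      define y where "y = (\<Sum>i\<in>UNIV. blinfun_apply (X $ i) (h i))"
      define H where "H = sqrt (\<Sum>i\<in>UNIV. (norm (h i))\<^sup>2)"
      have "cinner y y = (\<Sum>i\<in>UNIV. cinner (h i) (blinfun_apply (adj (X $ i)) y))"
        by (subst (1) y_def) (simp add: cinner_sum_left cinner_adj bh)
      moreover have "(norm y)\<^sup>2 = cmod (cinner y y)" by (simp add: cinner_self norm_power)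
      ultimately have "(norm y)\<^sup>2 \<le> H * Z y"
        using cinner_sum_le[of h "\<lambda>i. blinfun_apply (adj (X $ i)) y" UNIV]
        by (simp only: H_def Z_def)
      moreover have "Z y \<le> sqrt (norm R) * norm y"
      proof -
        have "(Z y)\<^sup>2 = cmod (cinner y (blinfun_apply R y))"
          unfolding R_def cinner_row_square[OF bh]
          by (simp add: Z_def sum_nonneg flip: of_real_power of_real_sum)
        also have "\<dots> \<le> norm y * (norm R * norm y)"
          by (rule order_trans[OF norm_cinner_le]) (intro mult_left_mono norm_blinfun norm_ge_zero)
        also have "\<dots> = (sqrt (norm R) * norm y)\<^sup>2"
          by (simp add: power_mult_distrib power2_eq_square mult.assoc[symmetric])
        finally show ?thesis by (rule power2_le_imp_le) simp
      qed
      moreover have "H \<ge> 0" by (simp add: H_def sum_nonneg)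
      ultimately have "(norm y)\<^sup>2 \<le> H * (sqrt (norm R) * norm y)"
        using mult_left_mono order_trans by blast
      then have "norm y \<le> sqrt (norm R) * H"
        using \<open>H \<ge> 0\<close> by (cases "norm y = 0") (auto simp: power2_eq_square mult_ac)
      then have "(norm y)\<^sup>2 \<le> (sqrt (norm R) * H)\<^sup>2" by (rule power_mono) simp
      then show "(norm y)\<^sup>2 \<le> (sqrt (norm R))\<^sup>2 * (\<Sum>i\<in>UNIV. (norm (h i))\<^sup>2)"
        by (simp add: H_def power_mult_distrib sum_nonneg)
    qed simp
    ultimately show "\<exists>\<rho><1. row_contraction \<rho> X" by blast
  next
    assume "\<exists>\<rho><1. row_contraction \<rho> X"
    then obtain \<rho> where \<rho>: "0 \<le> \<rho>" "\<rho> < 1" and rc: "row_contraction \<rho> X"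
      by (auto simp: row_contraction_def)
    \<comment> \<open>The row bound at the tuple of adjoint values controls the square of
      \<open>r\<close> by \<open>cinner y (R y)\<close>, which is at most \<open>norm y * r\<close>;
      then one factor \<open>r\<close> cancels.\<close>
    have "norm R \<le> \<rho>\<^sup>2"
    proof (rule norm_blinfun_bound)
      fix y
      define r where "r = norm (blinfun_apply R y)"
      have "r\<^sup>2 \<le> \<rho>\<^sup>2 * (Z y)\<^sup>2"
        using rc unfolding row_contraction_def r_def R_def
        by (simp add: row_square_def blinfun.sum_left Z_def sum_nonneg)
      also have "(Z y)\<^sup>2 = cmod (cinner y (blinfun_apply R y))"
        unfolding R_def cinner_row_square[OF bh]
        by (simp add: Z_def sum_nonneg flip: of_real_power of_real_sum)
      also have "\<rho>\<^sup>2 * cmod (cinner y (blinfun_apply R y)) \<le> \<rho>\<^sup>2 * (norm y * r)"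
        unfolding r_def by (intro mult_left_mono norm_cinner_le) simp
      finally show "r \<le> \<rho>\<^sup>2 * norm y"
        using \<rho>(1) by (cases "r = 0") (auto simp: power2_eq_square mult_ac r_def)
    qed simp
    also have "\<rho>\<^sup>2 < 1" using \<rho> by (simp add: power_less_one_iff)
    finally show "sqrt (norm R) < 1" by simp
  qed
  then show ?thesis by (auto simp: nc_ball_def R_def)
qed

end

section \<open>The Hardy space in coordinates\<close>

lemma finite_words [simp]: "finite {w :: 'n::finite list. length w = k}"
  using finite_lists_length_eq[of "UNIV :: 'n set" k] by simp

lemma sum_words_Suc:
  "(\<Sum>w | length (w :: 'n::finite list) = Suc k. f w) = (\<Sum>i\<in>UNIV. \<Sum>w | length w = k. f (i # w))"
proof -
  have "{w :: 'n list. length w = Suc k} = (\<lambda>(i, w). i # w) ` (UNIV \<times> {w. length w = k})"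
    by (auto simp: length_Suc_conv image_def)
  moreover have "inj_on (\<lambda>(i, w). i # w) (UNIV \<times> {w :: 'n list. length w = k})"
    by (auto simp: inj_on_def)
  ultimately show ?thesis by (simp add: sum.reindex sum.cartesian_product case_prod_unfold)
qed

lemma word_op_Nil [simp]: "word_op X [] = id_blinfun"
  by (simp add: word_op_def)

lemma word_op_Cons [simp]: "word_op X (i # w) = X $ i o\<^sub>L word_op X w"
  by (simp add: word_op_def)

lemma word_op_BH: "\<forall>i. X $ i \<in> BH \<Longrightarrow> word_op X w \<in> BH"
  by (induction w) (auto simp: BH_def)

context word_basis begin

text \<open>The row of all words of length \<open>k\<close> is an iterated product of rows, so its
  norm is at most \<open>\<rho> ^ k\<close>. The induction splits off the first letter.\<close>

lemma row_contraction_words: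
  assumes "row_contraction \<rho> X"
  shows "(norm (\<Sum>w | length w = k. blinfun_apply (word_op X w) (h w)))\<^sup>2
    \<le> (\<rho> ^ k)\<^sup>2 * (\<Sum>w | length w = k. (norm (h w))\<^sup>2)"
proof (induction k arbitrary: h)
  case (Suc k)
  define g where "g = (\<lambda>i. \<Sum>w | length w = k. blinfun_apply (word_op X w) (h (i # w)))"
  have "(norm (\<Sum>w | length w = Suc k. blinfun_apply (word_op X w) (h w)))\<^sup>2
      = (norm (\<Sum>i\<in>UNIV. blinfun_apply (X $ i) (g i)))\<^sup>2"
    by (simp add: sum_words_Suc g_def blinfun.sum_right)
  also have "\<dots> \<le> \<rho>\<^sup>2 * (\<Sum>i\<in>UNIV. (norm (g i))\<^sup>2)"
    using assms by (simp add: row_contraction_def)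
  also have "\<dots> \<le> \<rho>\<^sup>2 * (\<Sum>i\<in>UNIV. (\<rho> ^ k)\<^sup>2 * (\<Sum>w | length w = k. (norm (h (i # w)))\<^sup>2))"
    unfolding g_def by (intro mult_left_mono sum_mono Suc) simp
  also have "\<dots> = (\<rho> ^ Suc k)\<^sup>2 * (\<Sum>w | length w = Suc k. (norm (h w))\<^sup>2)"
    by (simp add: sum_words_Suc sum_distrib_left power_mult_distrib mult.assoc)
  finally show ?case .
qed simp

section \<open>Vectors as functions on the ball\<close>

definition homog :: "'h \<Rightarrow> ('h \<Rightarrow>\<^sub>L 'h) ^ 'n \<Rightarrow> nat \<Rightarrow> 'h \<Rightarrow>\<^sub>L 'h" where
  "homog x X k = (\<Sum>w | length w = k. cinner (e w) x *\<^sub>C word_op X w)"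

definition func :: "'h \<Rightarrow> ('h \<Rightarrow>\<^sub>L 'h) ^ 'n \<Rightarrow> 'h \<Rightarrow>\<^sub>L 'h" where
  "func x X = (if X \<in> nc_ball then suminf (homog x X) else 0)"

text \<open>Complex linearity moves the coefficients inside the word operators, so the row bound for
  words applies to the vectors \<open>cinner (e w) x *\<^sub>C v\<close>; Bessel bounds the
  coefficients.\<close>

lemma norm_homog_le:
  assumes "row_contraction \<rho> X" "\<forall>i. X $ i \<in> BH"
  shows "norm (homog x X k) \<le> \<rho> ^ k * norm x"
proof (rule norm_blinfun_bound)
  have \<rho>: "\<rho> \<ge> 0" using assms by (simp add: row_contraction_def)
  then show "0 \<le> \<rho> ^ k * norm x" by simp
  fix v
  have "(norm (blinfun_apply (homog x X k) v))\<^sup>2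
      = (norm (\<Sum>w | length w = k. blinfun_apply (word_op X w) (cinner (e w) x *\<^sub>C v)))\<^sup>2"
    by (simp add: homog_def blinfun.sum_left BH_scaleC[OF word_op_BH[OF assms(2)]])
  also have "\<dots> \<le> (\<rho> ^ k)\<^sup>2 * (\<Sum>w | length w = k. (norm (cinner (e w) x *\<^sub>C v))\<^sup>2)"
    by (rule row_contraction_words[OF assms(1)])
  also have "\<dots> = (\<rho> ^ k)\<^sup>2 * ((\<Sum>w | length w = k. (cmod (cinner (e w) x))\<^sup>2) * (norm v)\<^sup>2)"
    by (simp add: norm_scaleC power_mult_distrib sum_distrib_right)
  also have "\<dots> \<le> (\<rho> ^ k)\<^sup>2 * ((norm x)\<^sup>2 * (norm v)\<^sup>2)"
    by (intro mult_left_mono mult_right_mono bessel) (auto simp: orth)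
  also have "\<dots> = (\<rho> ^ k * norm x * norm v)\<^sup>2" by (simp add: power_mult_distrib mult.assoc)
  finally show "norm (blinfun_apply (homog x X k) v) \<le> \<rho> ^ k * norm x * norm v"
    by (rule power2_le_imp_le) (use \<rho> in simp)
qed

lemma nc_ballE:
  assumes "X \<in> nc_ball"
  obtains \<rho> where "0 \<le> \<rho>" "\<rho> < 1" "row_contraction \<rho> X" "\<forall>i. X $ i \<in> BH"
  using assms unfolding nc_ball_iff row_contraction_def by blast

lemma summable_homog:
  assumes "X \<in> nc_ball" shows "summable (homog x X)"
proof -
  obtain \<rho> where \<rho>: "0 \<le> \<rho>" "\<rho> < 1" "row_contraction \<rho> X" "\<forall>i. X $ i \<in> BH"
    using assms by (rule nc_ballE)
  show ?thesis
    by (rule summable_comparison_test'[where g = "\<lambda>k. \<rho> ^ k * norm x"])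
      (use \<rho> norm_homog_le[OF \<rho>(3,4)] in \<open>auto intro: summable_mult2 summable_geometric\<close>)
qed

lemma func_sums: "X \<in> nc_ball \<Longrightarrow> homog x X sums func x X"
  by (simp add: func_def summable_homog summable_sums)

lemma norm_func_le:
  assumes "row_contraction \<rho> X" "\<rho> < 1" "X \<in> nc_ball"
  shows "norm (func x X) \<le> norm x / (1 - \<rho>)"
proof -
  have bh: "\<forall>i. X $ i \<in> BH" and \<rho>: "\<rho> \<ge> 0"
    using assms by (auto simp: nc_ball_def row_contraction_def)
  have g: "(\<lambda>k. \<rho> ^ k * norm x) sums (1 / (1 - \<rho>) * norm x)"
    using assms \<rho> by (intro sums_mult2 geometric_sums) simp
  have "norm (suminf (homog x X)) \<le> (\<Sum>k. \<rho> ^ k * norm x)"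
    by (rule norm_suminf_le) (use norm_homog_le[OF assms(1) bh] g in \<open>auto simp: sums_iff\<close>)
  then show ?thesis using sums_unique[OF g] assms by (simp add: func_def)
qed

lemma func_outside: "X \<notin> nc_ball \<Longrightarrow> func x X = 0"
  by (simp add: func_def)

lemma homog_add: "homog (x + y) X k = homog x X k + homog y X k"
  by (simp add: homog_def cinner_add_right scaleC_add_left sum.distrib)

lemma homog_scaleC: "homog (c *\<^sub>C x) X k = c *\<^sub>C homog x X k"
  by (simp add: homog_def cinner_scaleC_right scaleC_scaleC scaleC_sum_right)

lemma func_add: "func (x + y) = func x + func y"
proof
  fix X
  show "func (x + y) X = (func x + func y) X"
  proof (cases "X \<in> nc_ball")
    case True
    have "homog (x + y) X sums (func x X + func y X)"
      unfolding homog_add[abs_def] by (intro sums_add func_sums True)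
    with func_sums[OF True] show ?thesis by (auto intro: sums_unique2)
  qed (simp add: func_outside)
qed

lemma func_scaleC: "func (c *\<^sub>C x) = c *\<^sub>C func x"
proof
  fix X
  show "func (c *\<^sub>C x) X = (c *\<^sub>C func x) X"
  proof (cases "X \<in> nc_ball")
    case True
    have "homog (c *\<^sub>C x) X sums (c *\<^sub>C func x X)"
      unfolding homog_scaleC[abs_def]
      by (intro bounded_linear.sums[OF bounded_linear_scaleC] func_sums True)
    with func_sums[OF True] show ?thesis by (auto intro: sums_unique2 simp: scaleC_fun_def)
  qed (simp add: func_outside scaleC_fun_def)
qed

lemma func_scaleC_apply: "func (c *\<^sub>C x) X = c *\<^sub>C func x X"
  by (simp add: func_scaleC scaleC_fun_def)

lemma bounded_linear_func: "bounded_linear (\<lambda>x. func x X)"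
proof (cases "X \<in> nc_ball")
  case True
  then obtain \<rho> where \<rho>: "\<rho> < 1" "row_contraction \<rho> X" by (rule nc_ballE)
  show ?thesis
    by (rule bounded_linear_intro[where K = "1 / (1 - \<rho>)"])
      (use norm_func_le[OF \<rho>(2,1) True] in \<open>auto simp: func_add func_scaleC_apply scaleR_scaleC\<close>)
qed (simp add: func_outside)

lemma func_basis:
  assumes "X \<in> nc_ball" shows "func (e w) X = word_op X w"
proof -
  have "homog (e w) X = (\<lambda>k. if k = length w then word_op X w else 0)"
  proof
    fix k
    have "homog (e w) X k = (\<Sum>v | length v = k. if v = w then word_op X w else 0)"
      unfolding homog_def by (intro sum.cong) (auto simp: orth scaleC_one)
    then show "homog (e w) X k = (if k = length w then word_op X w else 0)"
      by (simp add: sum.delta)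
  qed
  then have "homog (e w) X sums word_op X w"
    using sums_single[of "length w" "\<lambda>_. word_op X w"] by simp
  with func_sums[OF assms] show ?thesis by (rule sums_unique2)
qed

text \<open>The sums over each word length stay below a fixed constant, and the roots of a positive
  constant tend to 1.\<close>

lemma has_free_expansion_func:
  assumes "\<And>X. X \<in> nc_ball \<Longrightarrow> f X = func x X"
  shows "has_free_expansion f (\<lambda>w. cinner (e w) x)"
  unfolding has_free_expansion_def
proof
  show "\<forall>X\<in>nc_ball. (\<lambda>k. \<Sum>w | length w = k. cinner (e w) x *\<^sub>C word_op X w) sums f X"
    using func_sums[unfolded homog_def[abs_def]] assms by simp
  \<comment> \<open>The summand 1 keeps \<open>C\<close> positive even for
    \<open>x = 0\<close>.\<close>
  define C where "C = (norm x)\<^sup>2 + 1"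
  have C: "C > 0" unfolding C_def by (simp add: add_nonneg_pos)
  have "(\<lambda>k. root k (sqrt C)) \<longlonglongrightarrow> 1"
    using C by (intro LIMSEQ_root_const) simp
  then have lim: "(\<lambda>k. ereal (root k (sqrt C))) \<longlonglongrightarrow> 1"
    by (simp add: one_ereal_def)
  have "limsup (\<lambda>k. ereal (root (2 * k) (\<Sum>w | length w = k. (cmod (cinner (e w) x))\<^sup>2)))
      \<le> limsup (\<lambda>k. ereal (root k (sqrt C)))"
  proof (rule Limsup_mono, rule always_eventually, rule allI)
    fix k
    have le: "(\<Sum>w | length w = k. (cmod (cinner (e w) x))\<^sup>2) \<le> C"
      using bessel[of "{w. length w = k}" e x] by (auto simp: orth C_def)
    show "ereal (root (2 * k) (\<Sum>w | length w = k. (cmod (cinner (e w) x))\<^sup>2)) \<le> ereal (root k (sqrt C))"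
    \<comment> \<open>For \<open>k = 0\<close> both sides are 0 by the convention for
      \<open>root 0\<close>.\<close>
    proof (cases "k = 0")
      case False
      have "root (2 * k) (\<Sum>w | length w = k. (cmod (cinner (e w) x))\<^sup>2) \<le> root (2 * k) C"
        using False le by (intro real_root_le_mono) auto
      also have "\<dots> = root k (sqrt C)"
        by (simp add: sqrt_def real_root_mult_exp mult.commute)
      finally show ?thesis by simp
    qed simp
  qed
  also have "\<dots> = 1" using lim_imp_Limsup[OF _ lim] by simp
  finally show "limsup (\<lambda>k. ereal (root (2 * k) (\<Sum>w | length w = k. (cmod (cinner (e w) x))\<^sup>2))) \<le> 1" .
qed

section \<open>Creation operators and the recovery of coefficients\<close>

definition shift :: "'n \<Rightarrow> 'h \<Rightarrow>\<^sub>L 'h" where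
  "shift i = (SOME T. T \<in> BH \<and> (\<forall>w. blinfun_apply T (e w) = e (i # w)))"

lemma shift: "shift i \<in> BH" "blinfun_apply (shift i) (e w) = e (i # w)"
proof -
  obtain T where "T \<in> BH" "\<And>w. blinfun_apply T (e w) = e (i # w)"
    by (rule basis_operator[of "\<lambda>w. e (i # w)"]) (auto simp: orth)
  then have "\<exists>T. T \<in> BH \<and> (\<forall>w. blinfun_apply T (e w) = e (i # w))" by blast
  from someI_ex[OF this] show "shift i \<in> BH" "blinfun_apply (shift i) (e w) = e (i # w)"
    unfolding shift_def by auto
qed

text \<open>The adjoints of the creation operators annihilate the vacuum: it is a joint eigenvector
  with eigenvalue 0, which is how the value of a self-map at the origin enters later.\<close>

lemma cinner_shift_Nil: "cinner (e []) (blinfun_apply (shift i) x) = 0"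
  by (rule linear_eq_on_basis)
    (auto simp: BH_scaleC shift cinner_scaleC_right orth
      intro!: bounded_linear_compose[OF bounded_linear_cinner] blinfun.bounded_linear_right)

lemma cinner_shift_Cons:
  "cinner (e (j # w)) (blinfun_apply (shift i) x) = (if i = j then cinner (e w) x else 0)"
proof (rule linear_eq_on_basis[of _ "\<lambda>x. if i = j then cinner (e w) x else 0"])
  show "bounded_linear (\<lambda>x. if i = j then cinner (e w) x else 0)"
    by (cases "i = j") (auto simp: bounded_linear_cinner)
qed (auto simp: BH_scaleC shift cinner_scaleC_right orth
      intro!: bounded_linear_compose[OF bounded_linear_cinner] blinfun.bounded_linear_right)

text \<open>The creation operators are isometries with mutually orthogonal ranges.\<close>

lemma cinner_shift_shift:
  "cinner (blinfun_apply (shift i) x) (blinfun_apply (shift j) y) = (if i = j then cinner x y else 0)"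
proof (rule linear_eq_on_basis[of _ "\<lambda>y. if i = j then cinner x y else 0"])
  show "bounded_linear (\<lambda>y. if i = j then cinner x y else 0)"
    by (cases "i = j") (auto simp: bounded_linear_cinner)
  show "cinner (blinfun_apply (shift i) x) (blinfun_apply (shift j) (c *\<^sub>C e w))
      = (if i = j then cinner x (c *\<^sub>C e w) else 0)" for c w
    using cinner_shift_Cons[of j w i x] cinner_commute[of x "e w"]
      cinner_commute[of "blinfun_apply (shift i) x" "e (j # w)"]
    by (simp add: BH_scaleC shift cinner_scaleC_right)
qed (intro bounded_linear_compose[OF bounded_linear_cinner] blinfun.bounded_linear_right)

definition creation :: "real \<Rightarrow> ('h \<Rightarrow>\<^sub>L 'h) ^ 'n" where
  "creation r = (\<chi> i. complex_of_real r *\<^sub>C shift i)"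

lemma row_contraction_creation:
  assumes "r \<ge> 0" shows "row_contraction r (creation r)"
  unfolding row_contraction_def
proof (intro conjI allI)
  fix h
  have n: "(norm (blinfun_apply (shift i) y))\<^sup>2 = (norm y)\<^sup>2" for i y
    unfolding norm_eq_Re_cinner by (simp add: cinner_shift_shift)
  have "(norm (\<Sum>i\<in>UNIV. blinfun_apply (creation r $ i) (h i)))\<^sup>2
      = (\<Sum>i\<in>UNIV. (norm (blinfun_apply (creation r $ i) (h i)))\<^sup>2)"
    by (rule norm_orthogonal_sum) (auto simp: creation_def cinner_algebra cinner_shift_shift)
  also have "\<dots> = r\<^sup>2 * (\<Sum>i\<in>UNIV. (norm (h i))\<^sup>2)"
    by (simp add: creation_def norm_scaleC power_mult_distrib n sum_distrib_left)
  finally show "(norm (\<Sum>i\<in>UNIV. blinfun_apply (creation r $ i) (h i)))\<^sup>2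
      \<le> r\<^sup>2 * (\<Sum>i\<in>UNIV. (norm (h i))\<^sup>2)" by simp
qed (rule assms)

lemma creation_in_nc_ball: "0 \<le> r \<Longrightarrow> r < 1 \<Longrightarrow> creation r \<in> nc_ball"
  unfolding nc_ball_iff
proof (intro conjI allI)
  show "creation r $ i \<in> BH" for i
    using shift(1)[of i] by (simp add: creation_def BH_def scaleC_scaleC mult.commute)
qed (use row_contraction_creation[of r] in blast)

lemma word_op_creation:
  "blinfun_apply (word_op (creation r) w) (e []) = complex_of_real (r ^ length w) *\<^sub>C e w"
  by (induction w) (auto simp: creation_def BH_scaleC shift scaleC_scaleC scaleC_one)

text \<open>Applied to the vacuum, the word \<open>w\<close> in \<open>creation r\<close> gives a
  multiple of \<open>e w\<close>, so distinct words do not interfere and each coefficient can be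
  read off.\<close>

lemma coeff_creation:
  assumes "(\<lambda>k. \<Sum>w | length w = k. a w *\<^sub>C word_op (creation r) w) sums A"
  shows "cinner (e w) (blinfun_apply A (e [])) = complex_of_real (r ^ length w) * a w"
proof -
  have "bounded_linear (\<lambda>A. cinner (e w) (blinfun_apply A (e [])))"
    by (intro bounded_linear_compose[OF bounded_linear_cinner] blinfun.bounded_linear_left)
  from bounded_linear.sums[OF this assms]
  have "(\<lambda>k. cinner (e w) (blinfun_apply (\<Sum>w | length w = k. a w *\<^sub>C word_op (creation r) w) (e [])))
      sums cinner (e w) (blinfun_apply A (e []))" .
  moreover have "cinner (e w) (blinfun_apply (\<Sum>w | length w = k. a w *\<^sub>C word_op (creation r) w) (e []))
      = (if k = length w then complex_of_real (r ^ length w) * a w else 0)" for k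
  proof -
    have "cinner (e w) (blinfun_apply (\<Sum>w | length w = k. a w *\<^sub>C word_op (creation r) w) (e []))
        = (\<Sum>v | length v = k. if v = w then complex_of_real (r ^ length w) * a w else 0)"
      unfolding blinfun.sum_left cinner_sum_right
      by (rule sum.cong) (auto simp: word_op_creation cinner_scaleC_right orth)
    then show ?thesis by (simp add: sum.delta)
  qed
  ultimately have "(\<lambda>k. if k = length w then complex_of_real (r ^ length w) * a w else 0)
      sums cinner (e w) (blinfun_apply A (e []))" by (simp only:)
  then show ?thesis
    using sums_single[of "length w" "\<lambda>_. complex_of_real (r ^ length w) * a w"] by (rule sums_unique2)
qed

lemma free_coeff_eq:
  assumes "has_free_expansion (f :: ('h \<Rightarrow>\<^sub>L 'h) ^ 'n \<Rightarrow> _) a" shows "free_coeff f = a"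
  unfolding free_coeff_def
proof (rule the_equality)
  fix b assume b: "has_free_expansion f b"
  have B: "creation (1/2) \<in> nc_ball" by (rule creation_in_nc_ball) auto
  have *: "(\<lambda>k. \<Sum>w | length w = k. c w *\<^sub>C word_op (creation (1/2)) w) sums f (creation (1/2))"
    if "has_free_expansion f c" for c
    using that B unfolding has_free_expansion_def by blast
  have "complex_of_real ((1/2) ^ length w) * b w = complex_of_real ((1/2) ^ length w) * a w" for w
    by (rule trans[OF coeff_creation[OF *[OF b], symmetric] coeff_creation[OF *[OF assms]]])
  then show "b = a" by (intro ext) simp
qed (rule assms)

lemma coeff_func_creation:
  assumes "0 \<le> r" "r < 1"
  shows "cinner (e w) (blinfun_apply (func x (creation r)) (e [])) = complex_of_real (r ^ length w) * cinner (e w) x"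
  using func_sums[OF creation_in_nc_ball[OF assms]] unfolding homog_def[abs_def] by (rule coeff_creation)

text \<open>Passing to \<open>creation r\<close> damps the coefficient of \<open>w\<close> by
  \<open>r ^ length w\<close>, so Parseval can be compared termwise.\<close>

lemma norm_func_creation_le:
  assumes "0 \<le> r" "r < 1"
  shows "norm (blinfun_apply (func x (creation r)) (e [])) \<le> norm x"
proof -
  define y where "y = blinfun_apply (func x (creation r)) (e [])"
  have "(cmod (cinner (e w) y))\<^sup>2 \<le> (cmod (cinner (e w) x))\<^sup>2" for w
    unfolding y_def coeff_func_creation[OF assms] norm_mult using assms
    by (intro power_mono mult_left_le_one_le) (auto simp: norm_power power_le_one)
  then have "(norm y)\<^sup>2 \<le> (norm x)\<^sup>2"
    by (intro sums_le[OF _ parseval parseval])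
  then show ?thesis unfolding y_def by (rule power2_le_imp_le) simp
qed

text \<open>Radial criterion for membership in the Hardy space: Bessel bounds the damped
  coefficients by \<open>K\<close>, and letting \<open>r\<close> tend to 1 removes the
  damping.\<close>

lemma bounded_expansion_func:
  fixes f :: "('h \<Rightarrow>\<^sub>L 'h) ^ 'n \<Rightarrow> 'h \<Rightarrow>\<^sub>L 'h"
  assumes f: "has_free_expansion f a" and K: "K \<ge> 0"
    and le: "\<And>r. 0 < r \<Longrightarrow> r < 1 \<Longrightarrow> norm (blinfun_apply (f (creation r)) (e [])) \<le> K"
  shows "\<exists>x. norm x \<le> K \<and> (\<forall>w. cinner (e w) x = a w) \<and> (\<forall>X\<in>nc_ball. f X = func x X)"
proof -
  have bd: "(\<Sum>w\<in>F. (cmod (a w))\<^sup>2) \<le> K\<^sup>2" if F: "finite F" for F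
  proof -
    have "((\<lambda>r. \<Sum>w\<in>F. (r ^ length w * cmod (a w))\<^sup>2) \<longlongrightarrow> (\<Sum>w\<in>F. (1 ^ length w * cmod (a w))\<^sup>2)) (at_left (1::real))"
      by (intro tendsto_intros)
    moreover have "eventually (\<lambda>r. (\<Sum>w\<in>F. (r ^ length w * cmod (a w))\<^sup>2) \<le> K\<^sup>2) (at_left 1)"
      using eventually_at_left_real[of 0 1, simplified]
    proof (eventually_elim)
      case (elim r)
      then have r: "0 < r" "r < 1" by auto
      then have B: "creation r \<in> nc_ball" by (intro creation_in_nc_ball) auto
      have "(\<Sum>w\<in>F. (r ^ length w * cmod (a w))\<^sup>2)
          = (\<Sum>w\<in>F. (cmod (cinner (e w) (blinfun_apply (f (creation r)) (e []))))\<^sup>2)"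
        using f B coeff_creation[of a r "f (creation r)"] r
        unfolding has_free_expansion_def by (simp add: norm_mult norm_power)
      also have "\<dots> \<le> (norm (blinfun_apply (f (creation r)) (e [])))\<^sup>2"
        by (rule bessel[OF F]) (simp add: orth)
      also have "\<dots> \<le> K\<^sup>2" using le[OF r] by (rule power_mono) simp
      finally show ?case .
    qed
    ultimately have "(\<Sum>w\<in>F. (1 ^ length w * cmod (a w))\<^sup>2) \<le> K\<^sup>2"
      by (rule tendsto_upperbound) simp
    then show ?thesis by simp
  qed
  have sm: "summable (\<lambda>k. (cmod (a (nth_word k)))\<^sup>2)"
  proof (rule summableI_nonneg_bounded)
    show "(\<Sum>k<m. (cmod (a (nth_word k)))\<^sup>2) \<le> K\<^sup>2" for m
      using bd[of "nth_word ` {..<m}"] by (simp add: sum.reindex inj_on_def)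
  qed simp
  then obtain x where x: "\<And>w. cinner (e w) x = a w" using synthesis by blast
  have "(norm x)\<^sup>2 \<le> K\<^sup>2"
  proof (rule LIMSEQ_le_const2)
    show "(\<lambda>m. \<Sum>k<m. (cmod (cinner (e (nth_word k)) x))\<^sup>2) \<longlonglongrightarrow> (norm x)\<^sup>2"
      using parseval by (simp add: sums_def)
    have "(\<Sum>k<m. (cmod (cinner (e (nth_word k)) x))\<^sup>2) \<le> K\<^sup>2" for m
      using bd[of "nth_word ` {..<m}"] by (simp add: sum.reindex inj_on_def x)
    then show "\<exists>N. \<forall>m\<ge>N. (\<Sum>k<m. (cmod (cinner (e (nth_word k)) x))\<^sup>2) \<le> K\<^sup>2" by blast
  qed
  then have "norm x \<le> K" by (rule power2_le_imp_le) (rule K)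
  moreover have "f X = func x X" if X: "X \<in> nc_ball" for X
  proof (rule sums_unique2)
    show "homog x X sums f X"
      unfolding homog_def[abs_def] x using f X by (simp add: has_free_expansion_def)
  qed (rule func_sums[OF X])
  ultimately show ?thesis using x by blast
qed

section \<open>Identification of the Hardy space with the Hilbert space\<close>

lemma func_eq_iff: "(\<forall>X\<in>nc_ball. func x X = func y X) \<longleftrightarrow> x = y"
proof
  assume *: "\<forall>X\<in>nc_ball. func x X = func y X"
  have "creation (1/2) \<in> nc_ball" by (rule creation_in_nc_ball) auto
  then have "func x (creation (1/2)) = func y (creation (1/2))" using * by blast
  then show "x = y"
    using coeff_func_creation[of "1/2" _ x] coeff_func_creation[of "1/2" _ y]
    by (intro basis_eqI) simp
qed simp

lemma inj_func: "inj func"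
  by (rule injI) (metis func_eq_iff)

lemma free_coeff_func: "free_coeff (func x) = (\<lambda>w. cinner (e w) x)"
  by (intro free_coeff_eq has_free_expansion_func) simp

lemma H2_norm_func: "H2_norm (func x) = norm x"
  unfolding H2_norm_def free_coeff_func infsumI[OF parseval_has_sum] by simp

lemma H2_ball_eq: "H2_ball = range func"
proof (intro equalityI subsetI)
  fix f :: "('h \<Rightarrow>\<^sub>L 'h) ^ 'n \<Rightarrow> 'h \<Rightarrow>\<^sub>L 'h" assume "f \<in> H2_ball"
  then obtain a where a: "has_free_expansion f a"
    and sm: "(\<lambda>w. (cmod (free_coeff f w))\<^sup>2) summable_on UNIV"
    and out: "\<And>X. X \<notin> nc_ball \<Longrightarrow> f X = 0"
    unfolding H2_ball_def free_holomorphic_def by blast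
  have "(\<lambda>k. (cmod (a (nth_word k)))\<^sup>2) summable_on UNIV"
    using sm summable_on_reindex_bij_betw[OF bij_nth_word, of "\<lambda>w. (cmod (a w))\<^sup>2"]
    by (simp add: free_coeff_eq[OF a])
  then have "summable (\<lambda>k. (cmod (a (nth_word k)))\<^sup>2)"
    by (subst (asm) summable_on_UNIV_nonneg_real_iff) auto
  then obtain x where x: "\<And>w. cinner (e w) x = a w" using synthesis by blast
  have "f X = func x X" for X
  proof (cases "X \<in> nc_ball")
    case True
    have "homog x X sums f X"
      unfolding homog_def[abs_def] x using a True by (simp add: has_free_expansion_def)
    with func_sums[OF True] show ?thesis by (rule sums_unique2[rotated])
  qed (simp add: out func_outside)
  then show "f \<in> range func" by blast
next
  fix f assume "f \<in> range func"
  then obtain x where f: "f = func x" by blast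
  show "f \<in> H2_ball"
    unfolding H2_ball_def f free_holomorphic_def
    using has_free_expansion_func[of "func x" x] has_sum_imp_summable[OF parseval_has_sum[of x]]
    by (auto simp: func_outside free_coeff_func)
qed

end

section \<open>Row contractions with an eigenvector of the adjoint\<close>

lemma sum_words_snoc:
  "(\<Sum>w | length (w :: 'n::finite list) = Suc k. f w) = (\<Sum>w | length w = k. \<Sum>i\<in>UNIV. f (w @ [i]))"
proof (induction k arbitrary: f)
  case 0
  show ?case unfolding sum_words_Suc by simp
next
  case (Suc k)
  show ?case by (subst sum_words_Suc, subst Suc) (simp add: sum_words_Suc)
qed

lemma word_op_append: "word_op X (v @ w) = word_op X v o\<^sub>L word_op X w"
  by (induction v) (auto intro!: blinfun_eqI)

lemma norm_vec_square: "(norm (z :: complex ^ 'n::finite))\<^sup>2 = (\<Sum>i\<in>UNIV. (cmod (z $ i))\<^sup>2)"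
  by (simp add: norm_vec_def L2_set_def sum_nonneg)

text \<open>A noncommutative polynomial of degree below \<open>K\<close>, evaluated at
  \<open>X\<close> and applied to \<open>v\<close>; coefficients of longer words are
  ignored.\<close>

definition word_poly ::
  "nat \<Rightarrow> ('n::finite list \<Rightarrow> complex) \<Rightarrow> ('h::complex_normed_vector \<Rightarrow>\<^sub>L 'h) ^ 'n \<Rightarrow> 'h \<Rightarrow> 'h" where
  "word_poly K a X v = (\<Sum>k<K. \<Sum>w | length w = k. a w *\<^sub>C blinfun_apply (word_op X w) v)"

definition coeff_square :: "nat \<Rightarrow> ('n::finite list \<Rightarrow> complex) \<Rightarrow> real" where
  "coeff_square K a = (\<Sum>k<K. \<Sum>w | length w = k. (cmod (a w))\<^sup>2)"

lemma coeff_square_nonneg: "coeff_square K a \<ge> 0"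
  by (simp add: coeff_square_def sum_nonneg)

lemma coeff_square_Suc:
  "coeff_square (Suc K) a = (cmod (a []))\<^sup>2 + (\<Sum>i\<in>UNIV. coeff_square K (\<lambda>w. a (i # w)))"
  unfolding coeff_square_def by (subst sum.lessThan_Suc_shift) (simp add: sum_words_Suc sum.swap[of _ UNIV])

lemma word_poly_Suc:
  assumes "\<forall>i. X $ i \<in> BH"
  shows "word_poly (Suc K) a X v =
    a [] *\<^sub>C v + (\<Sum>i\<in>UNIV. blinfun_apply (X $ i) (word_poly K (\<lambda>w. a (i # w)) X v))"
  unfolding word_poly_def
  by (subst sum.lessThan_Suc_shift)
    (simp add: sum_words_Suc sum.swap[of _ UNIV] blinfun.sum_right BH_scaleC assms)

lemma bounded_linear_word_poly: "bounded_linear (word_poly K a X)"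
  unfolding word_poly_def[abs_def]
  by (intro bounded_linear_sum bounded_linear_compose[OF bounded_linear_scaleC]
      blinfun.bounded_linear_right)

text \<open>Coefficients of the product of the series \<open>a\<close> with the linear form whose
  coefficients are the conjugates of those of \<mu>, placed on the right.\<close>

definition right_mult :: "complex ^ 'n::finite \<Rightarrow> ('n list \<Rightarrow> complex) \<Rightarrow> 'n list \<Rightarrow> complex" where
  "right_mult \<mu> a w = (if w = [] then 0 else a (butlast w) * cnj (\<mu> $ last w))"

text \<open>Each nonempty word splits uniquely into an initial part and a last letter, so products
  with different letters do not overlap and the factor is exact.\<close>

lemma coeff_square_right_mult:
  "coeff_square (Suc K) (right_mult \<mu> a) = (norm \<mu>)\<^sup>2 * coeff_square K a"
  unfolding coeff_square_def
  by (subst sum.lessThan_Suc_shift)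
    (simp add: sum_words_snoc right_mult_def norm_mult power_mult_distrib norm_vec_square
      flip: sum_distrib_left sum_distrib_right)

lemma word_poly_right_mult:
  assumes "\<forall>i. X $ i \<in> BH"
  shows "word_poly (Suc K) (right_mult \<mu> a) X v =
    word_poly K a X (\<Sum>i\<in>UNIV. cnj (\<mu> $ i) *\<^sub>C blinfun_apply (X $ i) v)"
  unfolding word_poly_def
  by (subst sum.lessThan_Suc_shift)
    (simp add: sum_words_snoc right_mult_def word_op_append blinfun.sum_right
      BH_scaleC[OF word_op_BH[OF assms]] scaleC_sum_right scaleC_scaleC)

text \<open>The assumption \<open>eigen\<close> says that \<open>u\<close> is a joint eigenvector of
  the adjoints of the \<open>X $ i\<close>, with eigenvalues conjugate to the
  \<open>\<mu> $ i\<close>.\<close>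

locale contractive_eigen = word_basis e
  for e :: "'n::finite list \<Rightarrow> 'h::chilbert_space" +
  fixes X :: "('h \<Rightarrow>\<^sub>L 'h) ^ 'n" and u :: 'h and \<mu> :: "complex ^ 'n"
  assumes bh: "\<forall>i. X $ i \<in> BH" and contr: "row_contraction 1 X"
    and unit: "norm u = 1" and \<mu>: "norm \<mu> < 1"
    and eigen: "cinner u (blinfun_apply (X $ i) h) = \<mu> $ i * cinner u h"
begin

definition L :: "'h \<Rightarrow> 'h" where
  "L v = (\<Sum>i\<in>UNIV. cnj (\<mu> $ i) *\<^sub>C blinfun_apply (X $ i) v)"

lemma row_le: "(norm (\<Sum>i\<in>UNIV. blinfun_apply (X $ i) (h i)))\<^sup>2 \<le> (\<Sum>i\<in>UNIV. (norm (h i))\<^sup>2)"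
  using contr by (simp add: row_contraction_def)

lemma norm_L: "norm (L v) \<le> norm \<mu> * norm v"
proof (rule power2_le_imp_le)
  have "L v = (\<Sum>i\<in>UNIV. blinfun_apply (X $ i) (cnj (\<mu> $ i) *\<^sub>C v))"
    by (simp add: L_def BH_scaleC bh)
  then have "(norm (L v))\<^sup>2 \<le> (\<Sum>i\<in>UNIV. (norm (cnj (\<mu> $ i) *\<^sub>C v))\<^sup>2)"
    using row_le by simp
  also have "\<dots> = (norm \<mu> * norm v)\<^sup>2"
    by (simp add: norm_scaleC power_mult_distrib norm_vec_square sum_distrib_right)
  finally show "(norm (L v))\<^sup>2 \<le> (norm \<mu> * norm v)\<^sup>2" .
qed simp

text \<open>Since \<open>u - L u\<close> equals \<open>(I - \<Sum>X\<^sub>iX\<^sub>i\<^sup>*) u\<close>, it is a defect vector of the row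
  contraction.\<close>

lemma defect_step:
  "(norm (a *\<^sub>C (u - L u) + (\<Sum>i\<in>UNIV. blinfun_apply (X $ i) (h i))))\<^sup>2
    \<le> (1 - (norm \<mu>)\<^sup>2) * (cmod a)\<^sup>2 + (\<Sum>i\<in>UNIV. (norm (h i))\<^sup>2)"
proof -
  \<comment> \<open>The term \<open>- a *\<^sub>C L u\<close> is itself a value of the row operator,
    so it is absorbed into the arguments \<open>h\<close>. The cross terms \<open>t i\<close> are
    then computed from \<open>eigen\<close>.\<close>
  define g where "g = (\<lambda>i. h i - (a * cnj (\<mu> $ i)) *\<^sub>C u)"
  define t where "t = (\<lambda>i. Re (cnj a * (\<mu> $ i) * cinner u (g i)))"
  have "a *\<^sub>C (u - L u) + (\<Sum>i\<in>UNIV. blinfun_apply (X $ i) (h i))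
      = a *\<^sub>C u + (\<Sum>i\<in>UNIV. blinfun_apply (X $ i) (g i))"
    by (simp add: g_def L_def blinfun.diff_right BH_scaleC bh sum_subtractf scaleC_diff_right
        scaleC_sum_right scaleC_scaleC)
  then have "(norm (a *\<^sub>C (u - L u) + (\<Sum>i\<in>UNIV. blinfun_apply (X $ i) (h i))))\<^sup>2
      = (cmod a)\<^sup>2 + 2 * (\<Sum>i\<in>UNIV. t i) + (norm (\<Sum>i\<in>UNIV. blinfun_apply (X $ i) (g i)))\<^sup>2"
    by (simp add: norm_add_square norm_scaleC unit cinner_scaleC_left cinner_sum_right eigen t_def
        sum_distrib_left mult.assoc)
  also have "\<dots> \<le> (cmod a)\<^sup>2 + 2 * (\<Sum>i\<in>UNIV. t i) + (\<Sum>i\<in>UNIV. (norm (g i))\<^sup>2)"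
    using row_le by simp
  also have "\<dots> = (1 - (norm \<mu>)\<^sup>2) * (cmod a)\<^sup>2 + (\<Sum>i\<in>UNIV. (norm (h i))\<^sup>2)"
  proof -
    have "(norm (h i))\<^sup>2 = (norm (g i))\<^sup>2 + 2 * t i + (cmod a)\<^sup>2 * (cmod (\<mu> $ i))\<^sup>2" for i
    proof -
      have "Re (cinner (g i) ((a * cnj (\<mu> $ i)) *\<^sub>C u)) = t i"
        using arg_cong[OF cinner_commute[of "g i" "(a * cnj (\<mu> $ i)) *\<^sub>C u"], of Re]
        by (simp add: t_def cinner_scaleC_left algebra_simps)
      then show ?thesis
        using norm_add_square[of "g i" "(a * cnj (\<mu> $ i)) *\<^sub>C u"]
        by (simp add: g_def norm_scaleC unit norm_mult power_mult_distrib)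
    qed
    then show ?thesis
      by (simp add: norm_vec_square sum.distrib sum_distrib_left sum_distrib_right algebra_simps)
  qed
  finally show ?thesis .
qed

text \<open>Peeling off the first letter writes the polynomial in the shape of
  \<open>defect_step\<close>, applied with the tails as the vectors \<open>h i\<close>.\<close>

lemma word_poly_defect:
  "(norm (word_poly K a X (u - L u)))\<^sup>2 \<le> (1 - (norm \<mu>)\<^sup>2) * coeff_square K a"
proof (induction K arbitrary: a)
  case (Suc K)
  have "(norm (word_poly (Suc K) a X (u - L u)))\<^sup>2
      \<le> (1 - (norm \<mu>)\<^sup>2) * (cmod (a []))\<^sup>2 + (\<Sum>i\<in>UNIV. (norm (word_poly K (\<lambda>w. a (i # w)) X (u - L u)))\<^sup>2)"
    unfolding word_poly_Suc[OF bh] by (rule defect_step)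
  also have "\<dots> \<le> (1 - (norm \<mu>)\<^sup>2) * (cmod (a []))\<^sup>2
      + (\<Sum>i\<in>UNIV. (1 - (norm \<mu>)\<^sup>2) * coeff_square K (\<lambda>w. a (i # w)))"
    by (intro add_left_mono sum_mono Suc)
  also have "\<dots> = (1 - (norm \<mu>)\<^sup>2) * coeff_square (Suc K) a"
    by (simp add: coeff_square_Suc sum_distrib_left algebra_simps)
  finally show ?case .
qed (simp add: word_poly_def coeff_square_def)

text \<open>Each application of \<open>L\<close> is traded for one right multiplication of the
  coefficients, which costs the factor \<open>norm \<mu>\<close>.\<close>

lemma word_poly_L_defect:
  "norm (word_poly K a X ((L ^^ j) (u - L u)))
    \<le> norm \<mu> ^ j * (sqrt (1 - (norm \<mu>)\<^sup>2) * sqrt (coeff_square K a))"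
proof (induction j arbitrary: K a)
  case 0
  show ?case
    using real_sqrt_le_mono[OF word_poly_defect[of K a]] by (simp add: real_sqrt_mult)
next
  case (Suc j)
  have "word_poly K a X ((L ^^ Suc j) (u - L u)) = word_poly (Suc K) (right_mult \<mu> a) X ((L ^^ j) (u - L u))"
    by (simp add: word_poly_right_mult[OF bh] L_def)
  with Suc[of "Suc K" "right_mult \<mu> a"] show ?case
    by (simp add: coeff_square_right_mult real_sqrt_mult mult_ac)
qed

lemma telescope: "u = (\<Sum>j<N. (L ^^ j) (u - L u)) + (L ^^ N) u"
proof (induction N)
  case (Suc N)
  have d: "L (x - y) = L x - L y" for x y
    by (simp add: L_def blinfun.diff_right scaleC_diff_right sum_subtractf)
  have "(L ^^ j) (x - y) = (L ^^ j) x - (L ^^ j) y" for j x y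
    by (induction j) (auto simp: d)
  then show ?case using Suc by (simp add: funpow_swap1)
qed simp

text \<open>Expanding \<open>u\<close> by \<open>telescope\<close> and summing the bounds of
  \<open>word_poly_L_defect\<close> gives a geometric series with ratio
  \<open>norm \<mu>\<close>.\<close>

lemma word_poly_bound:
  "norm (word_poly K a X u) \<le> sqrt (1 - (norm \<mu>)\<^sup>2) / (1 - norm \<mu>) * sqrt (coeff_square K a)"
proof -
  define s where "s = sqrt (1 - (norm \<mu>)\<^sup>2) * sqrt (coeff_square K a)"
  have s: "s \<ge> 0" using \<mu> by (simp add: s_def coeff_square_nonneg power_le_one)
  interpret p: bounded_linear "word_poly K a X" by (rule bounded_linear_word_poly)
  \<comment> \<open>\<open>C\<close> may depend on \<open>K\<close> and \<open>a\<close> but not on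
    \<open>N\<close>, so the remainder term vanishes as \<open>N\<close> grows.\<close>
  obtain C where C: "C > 0" "\<And>v. norm (word_poly K a X v) \<le> norm v * C" using p.pos_bounded by blast
  have LN: "norm ((L ^^ N) u) \<le> norm \<mu> ^ N" for N
  proof (induction N)
    case (Suc N)
    show ?case
      using norm_L[of "(L ^^ N) u"] mult_left_mono[OF Suc, of "norm \<mu>"] by simp
  qed (simp add: unit)
  have le: "norm (word_poly K a X u) \<le> s / (1 - norm \<mu>) + norm \<mu> ^ N * C" for N
  proof -
    have "word_poly K a X u = (\<Sum>j<N. word_poly K a X ((L ^^ j) (u - L u))) + word_poly K a X ((L ^^ N) u)"
      by (subst telescope[of N]) (simp add: p.add p.sum)
    also have "norm \<dots> \<le> (\<Sum>j<N. norm \<mu> ^ j * s) + norm ((L ^^ N) u) * C"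
      by (intro norm_triangle_mono sum_norm_le C(2)) (simp add: s_def word_poly_L_defect)
    also have "\<dots> \<le> 1 / (1 - norm \<mu>) * s + norm \<mu> ^ N * C"
    proof (intro add_mono mult_right_mono LN)
      have "(\<Sum>j<N. norm \<mu> ^ j) \<le> (\<Sum>j. norm \<mu> ^ j)"
        by (intro sum_le_suminf) (auto simp: \<mu> summable_geometric)
      then have "(\<Sum>j<N. norm \<mu> ^ j) \<le> 1 / (1 - norm \<mu>)" using \<mu> by (simp add: suminf_geometric)
      then show "(\<Sum>j<N. norm \<mu> ^ j * s) \<le> 1 / (1 - norm \<mu>) * s"
        unfolding sum_distrib_right[symmetric] using s by (rule mult_right_mono)
    qed (use C in simp)
    finally show ?thesis by simp
  qed
  have "(\<lambda>N. s / (1 - norm \<mu>) + norm \<mu> ^ N * C) \<longlonglongrightarrow> s / (1 - norm \<mu>) + 0 * C"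
    using \<mu> by (intro tendsto_intros LIMSEQ_power_zero) simp
  then have "norm (word_poly K a X u) \<le> s / (1 - norm \<mu>) + 0 * C"
    by (rule LIMSEQ_le_const) (use le in blast)
  then show ?thesis by (simp add: s_def)
qed

end

section \<open>Composition operators\<close>

lemma scalar_tuple_apply [simp]: "blinfun_apply (scalar_tuple z $ i) x = (z $ i) *\<^sub>C x"
  by (simp add: scalar_tuple_def)

context word_basis begin

section \<open>Scalar tuples\<close>

lemma id_blinfun_nonzero [simp]: "(id_blinfun :: 'h \<Rightarrow>\<^sub>L 'h) \<noteq> 0"
proof
  assume "(id_blinfun :: 'h \<Rightarrow>\<^sub>L 'h) = 0"
  then have "blinfun_apply id_blinfun (e []) = blinfun_apply 0 (e [])" by (rule arg_cong)
  then show False using norm_e[of "[]"] by simp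
qed

lemma scalar_tuple_eq_iff: "(scalar_tuple z :: ('h \<Rightarrow>\<^sub>L 'h) ^ 'n) = scalar_tuple w \<longleftrightarrow> z = w"
  by (simp add: scalar_tuple_def vec_eq_iff)

lemma row_contraction_scalar: "row_contraction (norm z) (scalar_tuple z)"
  unfolding row_contraction_def
proof (intro conjI allI)
  fix h :: "'n \<Rightarrow> 'h"
  have "norm (\<Sum>i\<in>UNIV. blinfun_apply (scalar_tuple z $ i) (h i)) \<le> (\<Sum>i\<in>UNIV. \<bar>cmod (z $ i)\<bar> * \<bar>norm (h i)\<bar>)"
    by (rule order_trans[OF norm_sum]) (simp add: norm_scaleC)
  also have "\<dots> \<le> L2_set (\<lambda>i. cmod (z $ i)) UNIV * L2_set (\<lambda>i. norm (h i)) UNIV"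
    by (rule L2_set_mult_ineq)
  finally have "norm (\<Sum>i\<in>UNIV. blinfun_apply (scalar_tuple z $ i) (h i)) \<le> norm z * L2_set (\<lambda>i. norm (h i)) UNIV"
    by (simp add: norm_vec_def)
  from power_mono[OF this, of 2] show
    "(norm (\<Sum>i\<in>UNIV. blinfun_apply (scalar_tuple z $ i) (h i)))\<^sup>2 \<le> (norm z)\<^sup>2 * (\<Sum>i\<in>UNIV. (norm (h i))\<^sup>2)"
    by (simp add: power_mult_distrib L2_set_def sum_nonneg)
qed simp

lemma scalar_tuple_in_nc_ball: "(scalar_tuple z :: ('h \<Rightarrow>\<^sub>L 'h) ^ 'n) \<in> nc_ball \<longleftrightarrow> norm z < 1"
proof
  assume "norm z < 1"
  then show "(scalar_tuple z :: ('h \<Rightarrow>\<^sub>L 'h) ^ 'n) \<in> nc_ball"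
    unfolding nc_ball_iff using row_contraction_scalar[of z]
    by (auto simp: BH_def scaleC_scaleC mult.commute)
next
  assume "(scalar_tuple z :: ('h \<Rightarrow>\<^sub>L 'h) ^ 'n) \<in> nc_ball"
  then obtain \<rho> where \<rho>: "0 \<le> \<rho>" "\<rho> < 1" "row_contraction \<rho> (scalar_tuple z)"
    by (rule nc_ballE)
  \<comment> \<open>The conjugate tuple is the extremal choice in Cauchy-Schwarz, so it detects the
    full norm of \<open>z\<close>.\<close>
  have "(\<Sum>i\<in>UNIV. blinfun_apply (scalar_tuple z $ i) (cnj (z $ i) *\<^sub>C e [])) = complex_of_real ((norm z)\<^sup>2) *\<^sub>C e []"
    unfolding norm_vec_square of_real_sum complex_norm_square
    by (simp add: scaleC_scaleC scaleC_sum_left)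
  then have "(norm (complex_of_real ((norm z)\<^sup>2) *\<^sub>C e []))\<^sup>2 \<le> \<rho>\<^sup>2 * (\<Sum>i\<in>UNIV. (norm (cnj (z $ i) *\<^sub>C e []))\<^sup>2)"
    using \<rho>(3) unfolding row_contraction_def by metis
  then have *: "((norm z)\<^sup>2)\<^sup>2 \<le> \<rho>\<^sup>2 * (norm z)\<^sup>2"
    unfolding norm_vec_square[symmetric] by (simp add: norm_scaleC norm_power flip: norm_vec_square)
  show "norm z < 1"
  proof (cases "z = 0")
    case False
    have "(norm z)\<^sup>2 * (norm z)\<^sup>2 \<le> \<rho>\<^sup>2 * (norm z)\<^sup>2" using * by (simp only: power2_eq_square)
    then have "(norm z)\<^sup>2 \<le> \<rho>\<^sup>2" by (rule mult_right_le_imp_le) (use False in simp)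
    with \<rho> show ?thesis using power2_le_imp_le[of "norm z" \<rho>] by simp
  qed simp
qed

lemma word_op_scalar: "\<exists>t. word_op (scalar_tuple z :: ('h \<Rightarrow>\<^sub>L 'h) ^ 'n) w = t *\<^sub>C id_blinfun"
proof (induction w)
  case (Cons i w)
  then obtain t where "word_op (scalar_tuple z :: ('h \<Rightarrow>\<^sub>L 'h) ^ 'n) w = t *\<^sub>C id_blinfun" by blast
  then have "word_op (scalar_tuple z :: ('h \<Rightarrow>\<^sub>L 'h) ^ 'n) (i # w) = (z $ i * t) *\<^sub>C id_blinfun"
    by (auto intro!: blinfun_eqI simp: scaleC_scaleC)
  then show ?case by blast
qed (auto intro!: exI[of _ 1] simp: scaleC_one)

text \<open>All homogeneous parts are multiples of the identity. The vacuum matrix entry shows that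
  their scalar factors form a convergent series.\<close>

lemma func_scalar_tuple:
  assumes "norm z < 1"
  shows "\<exists>s. func x (scalar_tuple z) = s *\<^sub>C id_blinfun"
proof -
  have B: "(scalar_tuple z :: ('h \<Rightarrow>\<^sub>L 'h) ^ 'n) \<in> nc_ball" using assms by (simp add: scalar_tuple_in_nc_ball)
  have "\<forall>k. \<exists>t. homog x (scalar_tuple z) k = t *\<^sub>C id_blinfun"
  proof
    fix k
    obtain t where t: "\<And>w. word_op (scalar_tuple z :: ('h \<Rightarrow>\<^sub>L 'h) ^ 'n) w = t w *\<^sub>C id_blinfun"
      using word_op_scalar by metis
    have "homog x (scalar_tuple z) k = (\<Sum>w | length w = k. cinner (e w) x * t w) *\<^sub>C id_blinfun"
      by (simp add: homog_def t scaleC_scaleC scaleC_sum_left)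
    then show "\<exists>t. homog x (scalar_tuple z) k = t *\<^sub>C id_blinfun" by blast
  qed
  then obtain t where t: "\<And>k. homog x (scalar_tuple z) k = t k *\<^sub>C id_blinfun" by metis
  define s where "s = cinner (e []) (blinfun_apply (func x (scalar_tuple z)) (e []))"
  have "bounded_linear (\<lambda>A. cinner (e []) (blinfun_apply A (e [])))"
    by (intro bounded_linear_compose[OF bounded_linear_cinner] blinfun.bounded_linear_left)
  from bounded_linear.sums[OF this func_sums[OF B, of x]]
  have "t sums s" by (simp add: t s_def cinner_scaleC_right orth)
  from bounded_linear.sums[OF bounded_linear_scaleC_left this]
  have "homog x (scalar_tuple z) sums (s *\<^sub>C id_blinfun)" unfolding t[abs_def] .
  with func_sums[OF B] have "func x (scalar_tuple z) = s *\<^sub>C id_blinfun" by (rule sums_unique2)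
  then show ?thesis by blast
qed

text \<open>Seen through a joint eigenvector \<open>k\<close> of the adjoints, every word in
  \<open>X\<close> acts as the same word in the scalars \<open>w\<close>; summation extends this to
  all functions.\<close>

lemma cinner_func_eigen:
  assumes X: "X \<in> nc_ball" and w: "norm w < 1"
    and ev: "\<And>i h. cinner k (blinfun_apply (X $ i) h) = w $ i * cinner k h"
  shows "cinner k (blinfun_apply (func x X) h) = cinner k (blinfun_apply (func x (scalar_tuple w)) h)"
proof -
  have W: "cinner k (blinfun_apply (word_op X v) h) = cinner k (blinfun_apply (word_op (scalar_tuple w) v) h)" for v
    by (induction v) (auto simp: ev cinner_scaleC_right)
  have bl: "bounded_linear (\<lambda>A. cinner k (blinfun_apply A h))"
    by (intro bounded_linear_compose[OF bounded_linear_cinner] blinfun.bounded_linear_left)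
  have *: "cinner k (blinfun_apply (homog x X j) h) = cinner k (blinfun_apply (homog x (scalar_tuple w) j) h)" for j
    by (simp add: homog_def blinfun.sum_left cinner_sum_right cinner_scaleC_right W)
  have "(scalar_tuple w :: ('h \<Rightarrow>\<^sub>L 'h) ^ 'n) \<in> nc_ball" using w by (simp add: scalar_tuple_in_nc_ball)
  then have "(\<lambda>j. cinner k (blinfun_apply (homog x (scalar_tuple w) j) h)) sums cinner k (blinfun_apply (func x (scalar_tuple w)) h)"
    by (rule bounded_linear.sums[OF bl func_sums])
  with bounded_linear.sums[OF bl func_sums[OF X, of x]] show ?thesis
    unfolding * by (rule sums_unique2)
qed

lemma norm_le_creation:
  assumes "K \<ge> 0" "\<And>r. 0 < r \<Longrightarrow> r < 1 \<Longrightarrow> norm (blinfun_apply (func y (creation r)) (e [])) \<le> K"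
  shows "norm y \<le> K"
proof -
  have he: "has_free_expansion (func y) (\<lambda>w. cinner (e w) y)"
    by (rule has_free_expansion_func) simp
  obtain x where "norm x \<le> K" "\<And>w. cinner (e w) x = cinner (e w) y"
    using bounded_expansion_func[OF he assms] by blast
  then show ?thesis using basis_eqI[of x y] by simp
qed

section \<open>Products of functions\<close>

text \<open>The bound \<open>bd\<close> is assumed only where \<open>F X x\<close> is already known
  to be represented by some \<open>y\<close>. Finite combinations of basis vectors are, which makes
  their representing vectors Cauchy.\<close>

lemma extend_from_basis:
  fixes F :: "('h \<Rightarrow>\<^sub>L 'h) ^ 'n \<Rightarrow> 'h \<Rightarrow> 'h \<Rightarrow>\<^sub>L 'h"
  assumes bl: "\<And>X. X \<in> nc_ball \<Longrightarrow> bounded_linear (F X)"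
    and sc: "\<And>X c x. X \<in> nc_ball \<Longrightarrow> F X (c *\<^sub>C x) = c *\<^sub>C F X x"
    and basis: "\<And>w. \<exists>y. \<forall>X\<in>nc_ball. F X (e w) = func y X"
    and bd: "\<And>x y. \<forall>X\<in>nc_ball. F X x = func y X \<Longrightarrow> norm y \<le> K * norm x"
  shows "\<exists>y. \<forall>X\<in>nc_ball. F X x = func y X"
proof -
  have "\<forall>w. \<exists>y. \<forall>X\<in>nc_ball. F X (e w) = func y X" using basis by blast
  from choice[OF this] obtain b where "\<forall>w. \<forall>X\<in>nc_ball. F X (e w) = func (b w) X" by blast
  then have b: "F X (e w) = func (b w) X" if "X \<in> nc_ball" for X w using that by blast
  define p where "p = (\<lambda>k. cinner (e (nth_word k)) x *\<^sub>C e (nth_word k))"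
  define q where "q = (\<lambda>k. cinner (e (nth_word k)) x *\<^sub>C b (nth_word k))"
  have p: "p sums x" unfolding p_def by (rule expansion)
  have pq: "F X (p k) = func (q k) X" if "X \<in> nc_ball" for X k
    by (simp add: p_def q_def sc that b func_scaleC_apply)
  have le: "norm (sum q A) \<le> K * norm (sum p A)" if "finite A" for A
  proof (rule bd, rule ballI)
    fix X :: "('h \<Rightarrow>\<^sub>L 'h) ^ 'n" assume X: "X \<in> nc_ball"
    show "F X (sum p A) = func (sum q A) X"
      unfolding linear_sum[OF bounded_linear.linear[OF bl[OF X]]]
        linear_sum[OF bounded_linear.linear[OF bounded_linear_func]] pq[OF X] ..
  qed
  have "summable q"
    unfolding summable_Cauchy
  proof (intro allI impI)
    fix \<epsilon> :: real assume "\<epsilon> > 0"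
    define K' where "K' = \<bar>K\<bar> + 1"
    have K': "K' > 0" "K \<le> K'" by (auto simp: K'_def)
    then have "\<epsilon> / K' > 0" using \<open>\<epsilon> > 0\<close> by simp
    then obtain N where N: "\<And>m n. m \<ge> N \<Longrightarrow> norm (sum p {m..<n}) < \<epsilon> / K'"
      using sums_summable[OF p] unfolding summable_Cauchy by meson
    have "norm (sum q {m..<n}) < \<epsilon>" if "m \<ge> N" for m n
    proof -
      have "norm (sum q {m..<n}) \<le> K' * norm (sum p {m..<n})"
        by (rule order_trans[OF le mult_right_mono]) (use K' in auto)
      also have "\<dots> < \<epsilon>" using N[OF that, of n] K' by (simp add: field_simps)
      finally show ?thesis .
    qed
    then show "\<exists>N. \<forall>m\<ge>N. \<forall>n. norm (sum q {m..<n}) < \<epsilon>" by blast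
  qed
  then obtain y where y: "q sums y" by (auto simp: summable_def)
  have "F X x = func y X" if X: "X \<in> nc_ball" for X
    using bounded_linear.sums[OF bl[OF X] p] bounded_linear.sums[OF bounded_linear_func y, of X]
    unfolding pq[OF X] by (rule sums_unique2)
  then show ?thesis by blast
qed

lemma bounded_linear_compose_func_right: "bounded_linear (\<lambda>x. A o\<^sub>L func x X)"
  by (rule bounded_linear_compose[OF
        bounded_bilinear.bounded_linear_right[OF bounded_bilinear_blinfun_compose] bounded_linear_func])

lemma bounded_linear_compose_func_left: "bounded_linear (\<lambda>x. func x X o\<^sub>L A)"
  by (rule bounded_linear_compose[OF
        bounded_bilinear.bounded_linear_left[OF bounded_bilinear_blinfun_compose] bounded_linear_func])

lemma func_BH:
  assumes "X \<in> nc_ball" shows "func x X \<in> BH"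
proof -
  have bh: "\<forall>i. X $ i \<in> BH" using assms by (simp add: nc_ball_def)
  have "blinfun_apply (func x X) (c *\<^sub>C h) = c *\<^sub>C blinfun_apply (func x X) h" for c h
  proof (rule linear_eq_on_basis[of "\<lambda>x. blinfun_apply (func x X) (c *\<^sub>C h)"])
    have ev: "bounded_linear (\<lambda>x. blinfun_apply (func x X) g)" for g
      by (rule bounded_linear_compose[OF blinfun.bounded_linear_left bounded_linear_func])
    then show "bounded_linear (\<lambda>x. blinfun_apply (func x X) (c *\<^sub>C h))" .
    show "bounded_linear (\<lambda>x. c *\<^sub>C blinfun_apply (func x X) h)"
      by (rule bounded_linear_compose[OF bounded_linear_scaleC ev])
  qed (simp add: func_scaleC_apply func_basis[OF assms] BH_scaleC[OF word_op_BH[OF bh]] scaleC_scaleC mult.commute)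
  then show ?thesis by (simp add: BH_def)
qed

text \<open>Appending \<open>v\<close> sends the basis to an orthonormal family, so right
  multiplication by a word is an operator \<open>R\<close> on coefficients.\<close>

lemma func_right_word: "\<exists>y. \<forall>X\<in>nc_ball. func x X o\<^sub>L word_op X v = func y X"
proof -
  obtain R where R: "R \<in> BH" "\<And>w. blinfun_apply R (e w) = e (w @ v)"
    by (rule basis_operator[of "\<lambda>w. e (w @ v)"]) (auto simp: orth)
  have "func x X o\<^sub>L word_op X v = func (blinfun_apply R x) X" if X: "X \<in> nc_ball" for X
  proof (rule linear_eq_on_basis[of "\<lambda>x. func x X o\<^sub>L word_op X v"])
    show "bounded_linear (\<lambda>x. func (blinfun_apply R x) X)"
      by (intro bounded_linear_compose[OF bounded_linear_func] blinfun.bounded_linear_right)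
    show "func (c *\<^sub>C e w) X o\<^sub>L word_op X v = func (blinfun_apply R (c *\<^sub>C e w)) X" for c w
      by (rule blinfun_eqI) (simp add: BH_scaleC R func_scaleC_apply func_basis X word_op_append)
  qed (rule bounded_linear_compose_func_left)
  then show ?thesis by blast
qed

text \<open>A function bounded by 1 on the ball is a contractive multiplier. On a basis vector the
  product is a right multiplication by a word; the bound comes from evaluating at
  \<open>creation r\<close>.\<close>

lemma func_mult:
  assumes c: "\<And>X. X \<in> nc_ball \<Longrightarrow> norm (func c X) \<le> 1"
  shows "\<exists>y. \<forall>X\<in>nc_ball. func c X o\<^sub>L func x X = func y X"
proof (rule extend_from_basis[where K = 1 and F = "\<lambda>X x. func c X o\<^sub>L func x X"])
  show "func c X o\<^sub>L func (a *\<^sub>C x) X = a *\<^sub>C (func c X o\<^sub>L func x X)" if "X \<in> nc_ball" for X a x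
    by (rule blinfun_eqI) (simp add: func_scaleC_apply BH_scaleC[OF func_BH[OF that]])
  show "\<exists>y. \<forall>X\<in>nc_ball. func c X o\<^sub>L func (e w) X = func y X" for w
    using func_right_word[of c w] by (simp add: func_basis)
  fix x y assume y: "\<forall>X\<in>nc_ball. func c X o\<^sub>L func x X = func y X"
  show "norm y \<le> 1 * norm x"
  proof (rule norm_le_creation)
    fix r :: real assume r: "0 < r" "r < 1"
    then have B: "creation r \<in> nc_ball" by (intro creation_in_nc_ball) auto
    have "func y (creation r) = func c (creation r) o\<^sub>L func x (creation r)" using y B by simp
    then have "norm (blinfun_apply (func y (creation r)) (e []))
        \<le> norm (func c (creation r)) * norm (blinfun_apply (func x (creation r)) (e []))"
      using norm_blinfun by simp
    also have "\<dots> \<le> 1 * norm x"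
      using c[OF B] r by (intro mult_mono norm_func_creation_le) auto
    finally show "norm (blinfun_apply (func y (creation r)) (e [])) \<le> 1 * norm x" .
  qed simp
qed (rule bounded_linear_compose_func_right)

section \<open>Free self-maps and their values on scalars\<close>

lemma nc_ball_contraction:
  assumes "X \<in> nc_ball" shows "row_contraction 1 X"
proof -
  obtain \<rho> where \<rho>: "0 \<le> \<rho>" "\<rho> < 1" "row_contraction \<rho> X" using assms by (rule nc_ballE)
  have "\<rho>\<^sup>2 * (\<Sum>i\<in>UNIV. (norm (h i))\<^sup>2) \<le> 1 * (\<Sum>i\<in>UNIV. (norm (h i))\<^sup>2)" for h :: "'n \<Rightarrow> 'h"
    using \<rho> by (intro mult_right_mono) (auto simp: power_le_one sum_nonneg)
  then have "(norm (\<Sum>i\<in>UNIV. blinfun_apply (X $ i) (h i)))\<^sup>2 \<le> 1 * (\<Sum>i\<in>UNIV. (norm (h i))\<^sup>2)" for h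
    using \<rho>(3) order_trans unfolding row_contraction_def by blast
  then show ?thesis by (simp add: row_contraction_def)
qed

lemma nc_ball_norm_le:
  fixes X :: "('h \<Rightarrow>\<^sub>L 'h) ^ 'n"
  assumes "X \<in> nc_ball" shows "norm (X $ i) \<le> 1"
proof (rule norm_blinfun_bound)
  fix h :: 'h
  define g where "g = (\<lambda>j. if j = i then h else 0)"
  have "(norm (\<Sum>j\<in>UNIV. blinfun_apply (X $ j) (g j)))\<^sup>2 \<le> 1\<^sup>2 * (\<Sum>j\<in>UNIV. (norm (g j))\<^sup>2)"
    using nc_ball_contraction[OF assms] unfolding row_contraction_def by blast
  also have "(\<Sum>j\<in>UNIV. blinfun_apply (X $ j) (g j)) = (\<Sum>j\<in>UNIV. if j = i then blinfun_apply (X $ i) h else 0)"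
    by (rule sum.cong) (auto simp: g_def)
  also have "(\<Sum>j\<in>UNIV. (norm (g j))\<^sup>2) = (\<Sum>j\<in>UNIV. if j = i then (norm h)\<^sup>2 else 0)"
    by (rule sum.cong) (auto simp: g_def)
  finally have "(norm (blinfun_apply (X $ i) h))\<^sup>2 \<le> (norm h)\<^sup>2" by simp
  then show "norm (blinfun_apply (X $ i) h) \<le> 1 * norm h" by (simp add: abs_le_square_iff[symmetric])
qed simp

text \<open>Components of points of the ball have norm at most 1, so the radial criterion places
  every component of the map in the Hardy space.\<close>

lemma free_self_map_func:
  fixes \<phi> :: "('h \<Rightarrow>\<^sub>L 'h) ^ 'n \<Rightarrow> ('h \<Rightarrow>\<^sub>L 'h) ^ 'n"
  assumes "free_self_map \<phi>"
  obtains c where "\<And>X i. X \<in> nc_ball \<Longrightarrow> \<phi> X $ i = func (c i) X"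
proof -
  have "\<exists>c. \<forall>X\<in>nc_ball. \<phi> X $ i = func c X" for i
  proof -
    obtain a where a: "has_free_expansion (\<lambda>X. \<phi> X $ i) a"
      using assms by (auto simp: free_self_map_def free_holomorphic_def)
    have "norm (blinfun_apply (\<phi> (creation r) $ i) (e [])) \<le> 1" if "0 < r" "r < 1" for r
    proof -
      have "\<phi> (creation r) \<in> nc_ball"
        using assms creation_in_nc_ball[of r] that by (auto simp: free_self_map_def)
      from nc_ball_norm_le[OF this, of i] show ?thesis
        using norm_blinfun[of "\<phi> (creation r) $ i" "e []"] by simp
    qed
    from bounded_expansion_func[OF a zero_le_one this] show ?thesis by blast
  qed
  then have "\<forall>i. \<exists>c. \<forall>X\<in>nc_ball. \<phi> X $ i = func c X" by blast
  from choice[OF this] show ?thesis using that by blast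
qed

lemma free_self_map_scalar:
  fixes \<phi> :: "('h \<Rightarrow>\<^sub>L 'h) ^ 'n \<Rightarrow> ('h \<Rightarrow>\<^sub>L 'h) ^ 'n"
  assumes "free_self_map \<phi>" "norm z < 1"
  shows "\<phi> (scalar_tuple z) = scalar_tuple (scalar_map \<phi> z)" "norm (scalar_map \<phi> z) < 1"
proof -
  have B: "(scalar_tuple z :: ('h \<Rightarrow>\<^sub>L 'h) ^ 'n) \<in> nc_ball" using assms by (simp add: scalar_tuple_in_nc_ball)
  obtain c where c: "\<And>X i. X \<in> nc_ball \<Longrightarrow> \<phi> X $ i = func (c i) X"
    using free_self_map_func[OF assms(1)] by blast
  have "\<forall>i. \<exists>s. func (c i) (scalar_tuple z) = s *\<^sub>C id_blinfun"
    using func_scalar_tuple[OF assms(2)] by blast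
  then obtain s where "\<And>i. func (c i) (scalar_tuple z) = s i *\<^sub>C id_blinfun" by metis
  then have "\<phi> (scalar_tuple z) = scalar_tuple (\<chi> i. s i)"
    by (simp only: vec_eq_iff c[OF B]) (simp add: scalar_tuple_def)
  then have "scalar_map \<phi> z = (\<chi> i. s i)" "\<phi> (scalar_tuple z) = scalar_tuple (\<chi> i. s i)"
    by (auto simp: scalar_map_def scalar_tuple_eq_iff)
  then show *: "\<phi> (scalar_tuple z) = scalar_tuple (scalar_map \<phi> z)" by simp
  have "\<phi> (scalar_tuple z) \<in> nc_ball" using assms(1) B by (auto simp: free_self_map_def)
  then show "norm (scalar_map \<phi> z) < 1" by (simp add: * scalar_tuple_in_nc_ball)
qed

text \<open>Joint eigenvectors of the adjoints persist under \<phi>, and their eigenvalues are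
  transported by the scalar map.\<close>

lemma free_self_map_eigen:
  fixes \<phi> :: "('h \<Rightarrow>\<^sub>L 'h) ^ 'n \<Rightarrow> ('h \<Rightarrow>\<^sub>L 'h) ^ 'n"
  assumes \<phi>: "free_self_map \<phi>" and X: "X \<in> nc_ball" and w: "norm w < 1"
    and ev: "\<And>i h. cinner k (blinfun_apply (X $ i) h) = w $ i * cinner k h"
  shows "cinner k (blinfun_apply (\<phi> X $ i) h) = scalar_map \<phi> w $ i * cinner k h"
proof -
  have B: "(scalar_tuple w :: ('h \<Rightarrow>\<^sub>L 'h) ^ 'n) \<in> nc_ball" using w by (simp add: scalar_tuple_in_nc_ball)
  obtain c where c: "\<And>X i. X \<in> nc_ball \<Longrightarrow> \<phi> X $ i = func (c i) X"
    using free_self_map_func[OF \<phi>] by blast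
  have "cinner k (blinfun_apply (\<phi> X $ i) h) = cinner k (blinfun_apply (\<phi> (scalar_tuple w) $ i) h)"
    unfolding c[OF X] c[OF B] by (rule cinner_func_eigen[OF X w ev])
  then show ?thesis by (simp add: free_self_map_scalar(1)[OF \<phi> w] cinner_scaleC_right)
qed

lemma coeff_square_le: "coeff_square K (\<lambda>w. cinner (e w) x) \<le> (norm x)\<^sup>2"
proof -
  have "coeff_square K (\<lambda>w. cinner (e w) x) = (\<Sum>w\<in>(\<Union>k\<in>{..<K}. {w. length w = k}). (cmod (cinner (e w) x))\<^sup>2)"
    unfolding coeff_square_def by (rule sum.UNION_disjoint[symmetric]) auto
  also have "\<dots> \<le> (norm x)\<^sup>2" by (rule bessel) (auto simp: orth)
  finally show ?thesis .
qed

section \<open>Composition operators and their norms\<close>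

text \<open>For a self-map this is the square root of \<open>(1 + q) / (1 - q)\<close> with
  \<open>q\<close> the norm of the image of 0, in the form delivered by
  \<open>word_poly_bound\<close>.\<close>

definition comp_bound :: "(('h \<Rightarrow>\<^sub>L 'h) ^ 'n \<Rightarrow> ('h \<Rightarrow>\<^sub>L 'h) ^ 'n) \<Rightarrow> real" where
  "comp_bound \<phi> = sqrt (1 - (norm (scalar_map \<phi> 0))\<^sup>2) / (1 - norm (scalar_map \<phi> 0))"

text \<open>An a priori bound: the composition is assumed to be represented by \<open>y\<close>.
  Existence of \<open>y\<close> is derived from it in \<open>func_comp\<close>.\<close>

lemma comp_norm_le:
  assumes \<phi>: "free_self_map \<phi>" and y: "\<And>X. X \<in> nc_ball \<Longrightarrow> func x (\<phi> X) = func y X"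
  shows "norm y \<le> comp_bound \<phi> * norm x"
proof -
  let ?\<mu> = "scalar_map \<phi> 0"
  have \<mu>: "norm ?\<mu> < 1" using free_self_map_scalar(2)[OF \<phi>, of 0] by simp
  have M: "comp_bound \<phi> \<ge> 0" using \<mu> by (simp add: comp_bound_def power_le_one)
  show ?thesis
  proof (rule norm_le_creation)
    show "comp_bound \<phi> * norm x \<ge> 0" using M by simp
    fix r :: real assume r: "0 < r" "r < 1"
    then have B: "creation r \<in> nc_ball" by (intro creation_in_nc_ball) auto
    then have B': "\<phi> (creation r) \<in> nc_ball" using \<phi> by (auto simp: free_self_map_def)
    \<comment> \<open>The vacuum is an eigenvector for \<open>creation r\<close> with eigenvalue 0,
      hence one for its image under \<phi> with eigenvalue the image of 0.\<close>
    interpret contractive_eigen e "\<phi> (creation r)" "e []" ?\<mu>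
    proof
      show "cinner (e []) (blinfun_apply (\<phi> (creation r) $ i) h) = ?\<mu> $ i * cinner (e []) h" for i h
        by (rule free_self_map_eigen[OF \<phi> B])
          (auto simp: creation_def cinner_scaleC_right cinner_shift_Nil)
    qed (use B' \<mu> nc_ball_contraction in \<open>auto simp: nc_ball_def\<close>)
    have "(\<lambda>k. blinfun_apply (homog x (\<phi> (creation r)) k) (e [])) sums blinfun_apply (func x (\<phi> (creation r))) (e [])"
      by (rule bounded_linear.sums[OF blinfun.bounded_linear_left func_sums[OF B']])
    then have "(\<lambda>K. word_poly K (\<lambda>w. cinner (e w) x) (\<phi> (creation r)) (e []))
        \<longlonglongrightarrow> blinfun_apply (func x (\<phi> (creation r))) (e [])"
      by (simp add: sums_def word_poly_def homog_def blinfun.sum_left)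
    from tendsto_norm[OF this]
    have "norm (blinfun_apply (func x (\<phi> (creation r))) (e [])) \<le> comp_bound \<phi> * norm x"
    proof (rule LIMSEQ_le_const2, intro exI allI impI)
      fix K
      have "norm (word_poly K (\<lambda>w. cinner (e w) x) (\<phi> (creation r)) (e []))
          \<le> comp_bound \<phi> * sqrt (coeff_square K (\<lambda>w. cinner (e w) x))"
        unfolding comp_bound_def by (rule word_poly_bound)
      also have "\<dots> \<le> comp_bound \<phi> * norm x"
        using real_sqrt_le_mono[OF coeff_square_le[of K x]] M by (intro mult_left_mono) auto
      finally show "norm (word_poly K (\<lambda>w. cinner (e w) x) (\<phi> (creation r)) (e [])) \<le> comp_bound \<phi> * norm x" .
    qed
    then show "norm (blinfun_apply (func y (creation r)) (e [])) \<le> comp_bound \<phi> * norm x"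
      by (simp add: y[OF B])
  qed
qed

text \<open>A basis vector composed with \<phi> is a word in the components of \<phi>, a product of
  contractive multipliers. The general case extends from the basis by the a priori bound.\<close>

lemma func_comp:
  assumes \<phi>: "free_self_map \<phi>"
  shows "\<exists>y. \<forall>X\<in>nc_ball. func x (\<phi> X) = func y X"
proof (rule extend_from_basis[where K = "comp_bound \<phi>" and F = "\<lambda>X x. func x (\<phi> X)"])
  fix w
  obtain c where c: "\<And>X i. X \<in> nc_ball \<Longrightarrow> \<phi> X $ i = func (c i) X"
    using free_self_map_func[OF \<phi>] by blast
  have in_ball: "X \<in> nc_ball \<Longrightarrow> \<phi> X \<in> nc_ball" for X using \<phi> by (auto simp: free_self_map_def)
  have "\<exists>y. \<forall>X\<in>nc_ball. word_op (\<phi> X) w = func y X"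
  proof (induction w)
    case Nil
    show ?case by (rule exI[of _ "e []"]) (simp add: func_basis)
  next
    case (Cons i w)
    then obtain y where y: "\<And>X. X \<in> nc_ball \<Longrightarrow> word_op (\<phi> X) w = func y X" by blast
    have "norm (func (c i) X) \<le> 1" if "X \<in> nc_ball" for X
      using nc_ball_norm_le[OF in_ball[OF that], of i] c[OF that] by simp
    from func_mult[OF this] show ?case by (simp add: y c)
  qed
  then show "\<exists>y. \<forall>X\<in>nc_ball. func (e w) (\<phi> X) = func y X" by (simp add: func_basis in_ball)
next
  show "norm y \<le> comp_bound \<phi> * norm x" if "\<forall>X\<in>nc_ball. func x (\<phi> X) = func y X" for x y
    by (rule comp_norm_le[OF \<phi>]) (use that in blast)
qed (simp_all add: bounded_linear_func func_scaleC_apply)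

section \<open>Iterates of a self-map\<close>

lemma free_self_map_compose:
  fixes \<phi> \<psi> :: "('h \<Rightarrow>\<^sub>L 'h) ^ 'n \<Rightarrow> ('h \<Rightarrow>\<^sub>L 'h) ^ 'n"
  assumes \<phi>: "free_self_map \<phi>" and \<psi>: "free_self_map \<psi>"
  shows "free_self_map (\<phi> \<circ> \<psi>)"
  unfolding free_self_map_def
proof (intro conjI allI ballI)
  have in_ball: "X \<in> nc_ball \<Longrightarrow> \<psi> X \<in> nc_ball" for X using \<psi> by (auto simp: free_self_map_def)
  then show "(\<phi> \<circ> \<psi>) X \<in> nc_ball" if "X \<in> nc_ball" for X
    using \<phi> that by (auto simp: free_self_map_def)
  fix i
  obtain c where c: "\<And>X i. X \<in> nc_ball \<Longrightarrow> \<phi> X $ i = func (c i) X"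
    using free_self_map_func[OF \<phi>] by blast
  obtain y where "\<And>X. X \<in> nc_ball \<Longrightarrow> func (c i) (\<psi> X) = func y X"
    using func_comp[OF \<psi>] by blast
  then have "has_free_expansion (\<lambda>X. (\<phi> \<circ> \<psi>) X $ i) (\<lambda>w. cinner (e w) y)"
    by (intro has_free_expansion_func) (simp add: c in_ball)
  then show "free_holomorphic (\<lambda>X. (\<phi> \<circ> \<psi>) X $ i)" unfolding free_holomorphic_def by blast
qed

lemma free_self_map_id: "free_self_map (id :: ('h \<Rightarrow>\<^sub>L 'h) ^ 'n \<Rightarrow> _)"
  unfolding free_self_map_def free_holomorphic_def
proof (intro conjI allI ballI exI)
  show "has_free_expansion (\<lambda>X. (id X :: ('h \<Rightarrow>\<^sub>L 'h) ^ 'n) $ i) (\<lambda>w. cinner (e w) (e [i]))" for i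
    by (rule has_free_expansion_func) (auto simp: func_basis intro: blinfun_eqI)
qed simp

lemma free_self_map_funpow:
  fixes \<phi> :: "('h \<Rightarrow>\<^sub>L 'h) ^ 'n \<Rightarrow> ('h \<Rightarrow>\<^sub>L 'h) ^ 'n"
  assumes "free_self_map \<phi>" shows "free_self_map (\<phi> ^^ m)"
proof (induction m)
  case 0
  show ?case unfolding funpow.simps by (rule free_self_map_id)
next
  case (Suc m)
  then show ?case unfolding funpow.simps by (rule free_self_map_compose[OF assms])
qed

end

section \<open>The orbit of the origin\<close>

context word_basis begin

text \<open>\<open>k\<close> is the reproducing kernel at \<open>w\<close>, obtained by Riesz from
  the functional evaluating at the scalar point \<open>w\<close>. The norm bound is a rough one,
  from the geometric series.\<close>

lemma kernel_vector:
  fixes w :: "complex ^ 'n"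
  assumes w: "norm w < 1"
  obtains k where "norm k \<le> 1 / (1 - norm w)" "cinner k (e []) = 1"
    "\<And>i h. cinner k (blinfun_apply (shift i) h) = w $ i * cinner k h"
proof -
  let ?W = "scalar_tuple w :: ('h \<Rightarrow>\<^sub>L 'h) ^ 'n"
  have B: "?W \<in> nc_ball" using w by (simp add: scalar_tuple_in_nc_ball)
  define f where "f = (\<lambda>h. cinner (e []) (blinfun_apply (func h ?W) (e [])))"
  have "bounded_linear f"
    unfolding f_def
    by (rule bounded_linear_compose[OF bounded_linear_cinner
          bounded_linear_compose[OF blinfun.bounded_linear_left bounded_linear_func]])
  moreover have "f (c *\<^sub>C x) = c * f x" for c x
    by (simp add: f_def func_scaleC_apply cinner_scaleC_right)
  ultimately obtain k where k: "\<And>h. f h = cinner k h" by (rule riesz) blast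
  have fe: "f (e v) = cinner (e []) (blinfun_apply (word_op ?W v) (e []))" for v
    by (simp add: f_def func_basis[OF B])
  have 1: "cinner k (e []) = 1"
    using fe[of "[]"] by (simp add: k orth)
  have 2: "cinner k (blinfun_apply (shift i) h) = w $ i * cinner k h" for i h
  proof (rule linear_eq_on_basis[of "\<lambda>h. cinner k (blinfun_apply (shift i) h)"])
    show "bounded_linear (\<lambda>h. cinner k (blinfun_apply (shift i) h))"
      by (rule bounded_linear_compose[OF bounded_linear_cinner blinfun.bounded_linear_right])
    show "bounded_linear (\<lambda>h. w $ i * cinner k h)"
      by (rule bounded_linear_compose[OF bounded_linear_mult_right bounded_linear_cinner])
    have "f (e (i # v)) = w $ i * f (e v)" for v
      unfolding fe by (simp add: cinner_scaleC_right)
    then show "cinner k (blinfun_apply (shift i) (c *\<^sub>C e v)) = w $ i * cinner k (c *\<^sub>C e v)" for c v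
      by (simp add: BH_scaleC shift cinner_scaleC_right k)
  qed
  have 3: "norm k \<le> 1 / (1 - norm w)"
  proof -
    have "(norm k)\<^sup>2 = cmod (f k)" by (simp add: k cinner_self norm_power)
    also have "\<dots> \<le> norm (blinfun_apply (func k ?W) (e []))"
      unfolding f_def using norm_cinner_le[of "e []"] by simp
    also have "\<dots> \<le> norm (func k ?W)" using norm_blinfun[of "func k ?W" "e []"] by simp
    also have "\<dots> \<le> norm k / (1 - norm w)"
      by (rule norm_func_le[OF row_contraction_scalar w B])
    finally have "norm k * norm k \<le> norm k * (1 / (1 - norm w))" by (simp add: power2_eq_square)
    then show ?thesis
      using w by (cases "k = 0") (auto dest: mult_left_le_imp_le simp del: times_divide_eq_right)
  qed
  show ?thesis using 1 2 3 that by blast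
qed

text \<open>The Schwarz--Pick inequality for the points \<open>0\<close> and \<open>z\<close>, with the norm of a kernel vector
  at a point slightly further out than \<open>z\<close> in place of \<open>1 / (1 - \<parallel>z\<parallel>\<^sup>2)\<close>.\<close>

lemma schwarz_pick:
  fixes \<psi> :: "('h \<Rightarrow>\<^sub>L 'h) ^ 'n \<Rightarrow> ('h \<Rightarrow>\<^sub>L 'h) ^ 'n"
  assumes \<psi>: "free_self_map \<psi>" and z: "norm z \<le> \<rho>" "\<rho> < 1"
  defines "a \<equiv> scalar_map \<psi> 0" and "b \<equiv> scalar_map \<psi> z"
  shows "(1 - norm a * norm b)\<^sup>2 \<le> (1 - (norm a)\<^sup>2) * (1 - (norm b)\<^sup>2) * (2 / (1 - \<rho>))\<^sup>2"
proof -
  have z1: "norm z < 1" and \<rho>0: "0 \<le> \<rho>" using z norm_ge_zero[of z] by linarith+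
  have a1: "norm a < 1" and b1: "norm b < 1"
    unfolding a_def b_def using free_self_map_scalar(2)[OF \<psi>] z1 by auto
  \<comment> \<open>With \<open>r\<close> strictly between \<rho> and 1, \<open>z\<close> is
    \<open>r\<close> times a point \<open>w\<close> of the open ball. The kernel at \<open>w\<close>
    is then an eigenvector for \<open>creation r\<close> with eigenvalue \<open>z\<close>.\<close>
  define r where "r = (1 + \<rho>) / 2"
  have r: "0 < r" "r < 1" "\<rho> < r" using z \<rho>0 by (auto simp: r_def)
  define w where "w = (1 / r) *\<^sub>R z"
  have zw: "z $ i = complex_of_real r * w $ i" for i
    unfolding w_def vector_scaleR_component using r by (simp add: scaleR_conv_of_real)
  have nw: "norm w \<le> \<rho> / r" using r z by (simp add: w_def divide_right_mono)
  also have "\<dots> < 1" using r by simp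
  finally have w1: "norm w < 1" .
  obtain k where nk: "norm k \<le> 1 / (1 - norm w)" and ke: "cinner k (e []) = 1"
    and k: "\<And>i h. cinner k (blinfun_apply (shift i) h) = w $ i * cinner k h"
    using kernel_vector[OF w1] by blast
  have "norm k \<le> 2 / (1 - \<rho>)"
  proof -
    have "1 - norm w \<ge> 1 - \<rho> / r" using nw by simp
    also have "1 - \<rho> / r = (1 - \<rho>) / (1 + \<rho>)" using \<rho>0 by (simp add: r_def field_simps)
    also have "\<dots> \<ge> (1 - \<rho>) / 2" using \<rho>0 z by (intro divide_left_mono) auto
    finally have "1 / (1 - norm w) \<le> 1 / ((1 - \<rho>) / 2)"
      using z by (intro divide_left_mono) (auto simp: w1)
    with nk show ?thesis by simp
  qed
  then have N: "(norm k)\<^sup>2 \<le> (2 / (1 - \<rho>))\<^sup>2" by (rule power_mono) simp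
  have B: "creation r \<in> nc_ball" using r by (intro creation_in_nc_ball) auto
  have B': "\<psi> (creation r) \<in> nc_ball" using \<psi> B by (auto simp: free_self_map_def)
  define \<Phi> where "\<Phi> = \<psi> (creation r)"
  have \<Phi>e: "cinner (e []) (blinfun_apply (\<Phi> $ i) h) = a $ i * cinner (e []) h" for i h
    unfolding \<Phi>_def a_def
    by (rule free_self_map_eigen[OF \<psi> B]) (auto simp: creation_def cinner_scaleC_right cinner_shift_Nil)
  have \<Phi>k: "cinner k (blinfun_apply (\<Phi> $ i) h) = b $ i * cinner k h" for i h
    unfolding \<Phi>_def b_def
    by (rule free_self_map_eigen[OF \<psi> B z1]) (simp add: creation_def cinner_scaleC_right k zw)
  define s where "s = (\<Sum>i\<in>UNIV. a $ i * cnj (b $ i))"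
  define c where "c = 1 - s"
  define A where "A = (norm a)\<^sup>2"
  define t where "t = 1 - A"
  have t: "t > 0" using a1 by (simp add: t_def A_def power_less_one_iff)
  \<comment> \<open>Positivity of the identity minus the row square of \<Phi>, restricted to the
    span of the vacuum and \<open>k\<close>, is a 2 by 2 condition. The coefficients
    \<open>c\<close> and \<open>-t\<close> are the choice that produces its determinant
    inequality.\<close>
  define y where "y = c *\<^sub>C e [] + (- complex_of_real t) *\<^sub>C k"
  define g where "g = (\<lambda>i. (c * cnj (a $ i)) *\<^sub>C e [] + (- complex_of_real t * cnj (b $ i)) *\<^sub>C k)"
  define G where "G = (\<Sum>i\<in>UNIV. (norm (g i))\<^sup>2)"
  \<comment> \<open>Thus \<open>g i\<close> is the adjoint of \<open>\<Phi> $ i\<close> applied to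
    \<open>y\<close>, and the next claim is contractivity of the adjoint row.\<close>
  have yg: "cinner y (blinfun_apply (\<Phi> $ i) h) = cinner (g i) h" for i h
    by (simp add: y_def g_def cinner_algebra \<Phi>e \<Phi>k algebra_simps)
  have "G \<le> (norm y)\<^sup>2"
  proof -
    define v where "v = (\<Sum>i\<in>UNIV. blinfun_apply (\<Phi> $ i) (g i))"
    have G0: "G \<ge> 0" by (simp add: G_def sum_nonneg)
    have "cinner y v = complex_of_real G"
      by (simp add: v_def cinner_sum_right yg cinner_self G_def)
    then have "G \<le> norm y * norm v" using norm_cinner_le[of y v] G0 by simp
    then have "G\<^sup>2 \<le> (norm y * norm v)\<^sup>2" by (rule power_mono) (rule G0)
    also have "\<dots> \<le> (norm y)\<^sup>2 * G"
      using nc_ball_contraction[OF B'] unfolding row_contraction_def v_def \<Phi>_def G_def power_mult_distrib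
      by (intro mult_left_mono) auto
    finally show ?thesis using G0 by (cases "G = 0") (auto simp: power2_eq_square)
  qed
  moreover have ek: "cinner (e []) k = 1" using ke cinner_commute[of "e []" k] by simp
  have "(norm y)\<^sup>2 = (cmod c)\<^sup>2 - 2 * t * Re c + t\<^sup>2 * (norm k)\<^sup>2"
    unfolding y_def norm_add_square norm_scaleC cinner_scaleC_left cinner_scaleC_right ek
    by (simp add: power_mult_distrib)
  moreover have "G = (cmod c)\<^sup>2 * A - 2 * t * Re (cnj c * s) + t\<^sup>2 * (norm b)\<^sup>2 * (norm k)\<^sup>2"
  proof -
    have "(norm (g i))\<^sup>2 = (cmod c)\<^sup>2 * (cmod (a $ i))\<^sup>2 - 2 * t * Re (cnj c * (a $ i * cnj (b $ i)))
        + t\<^sup>2 * (norm k)\<^sup>2 * (cmod (b $ i))\<^sup>2" for i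
    proof -
      have "cinner ((c * cnj (a $ i)) *\<^sub>C e []) ((- complex_of_real t * cnj (b $ i)) *\<^sub>C k)
          = - (complex_of_real t * (cnj c * (a $ i * cnj (b $ i))))"
        by (simp add: cinner_algebra ek)
      then have "Re (cinner ((c * cnj (a $ i)) *\<^sub>C e []) ((- complex_of_real t * cnj (b $ i)) *\<^sub>C k))
          = - (t * Re (cnj c * (a $ i * cnj (b $ i))))" by simp
      then show ?thesis
        unfolding g_def norm_add_square norm_scaleC by (simp add: norm_mult power_mult_distrib)
    qed
    then have "G = (cmod c)\<^sup>2 * (\<Sum>i\<in>UNIV. (cmod (a $ i))\<^sup>2)
        - 2 * t * (\<Sum>i\<in>UNIV. Re (cnj c * (a $ i * cnj (b $ i))))
        + t\<^sup>2 * (norm k)\<^sup>2 * (\<Sum>i\<in>UNIV. (cmod (b $ i))\<^sup>2)"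
      unfolding G_def by (simp only: sum.distrib sum_subtractf sum_distrib_left)
    moreover have "(\<Sum>i\<in>UNIV. Re (cnj c * (a $ i * cnj (b $ i)))) = Re (cnj c * s)"
      unfolding s_def sum_distrib_left by simp
    ultimately show ?thesis by (simp add: A_def norm_vec_square mult_ac)
  qed
  \<comment> \<open>This identity lets the unknown term \<open>Re (cnj c * s)\<close> cancel between
    the two norm formulas.\<close>
  moreover have "Re c = Re (cnj c * s) + (cmod c)\<^sup>2"
  proof -
    have "Re c - Re (cnj c * s) = Re (cnj c * (1 - s))" by (simp add: algebra_simps)
    also have "\<dots> = (cmod c)\<^sup>2"
      unfolding c_def[symmetric] cmod_power2 by (simp add: power2_eq_square)
    finally show ?thesis by simp
  qed
  moreover define P where "P = Re (cnj c * s)"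
  ultimately have "(cmod c)\<^sup>2 * A - 2 * t * P + t\<^sup>2 * (norm b)\<^sup>2 * (norm k)\<^sup>2
      \<le> (cmod c)\<^sup>2 - 2 * t * (P + (cmod c)\<^sup>2) + t\<^sup>2 * (norm k)\<^sup>2"
    by (simp only:)
  then have "0 \<le> (cmod c)\<^sup>2 * (1 - A) - 2 * t * (cmod c)\<^sup>2 + t\<^sup>2 * (norm k)\<^sup>2 * (1 - (norm b)\<^sup>2)"
    by (simp add: algebra_simps)
  then have "0 \<le> t * (t * (norm k)\<^sup>2 * (1 - (norm b)\<^sup>2) - (cmod c)\<^sup>2)"
    by (simp add: t_def power2_eq_square algebra_simps)
  then have cle: "(cmod c)\<^sup>2 \<le> t * (1 - (norm b)\<^sup>2) * (norm k)\<^sup>2"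
    using t by (simp add: zero_le_mult_iff mult_ac)
  have "cmod s \<le> norm a * norm b"
  proof -
    have "cmod s \<le> (\<Sum>i\<in>UNIV. \<bar>cmod (a $ i)\<bar> * \<bar>cmod (b $ i)\<bar>)"
      unfolding s_def by (rule order_trans[OF norm_sum]) (simp add: norm_mult)
    also have "\<dots> \<le> L2_set (\<lambda>i. cmod (a $ i)) UNIV * L2_set (\<lambda>i. cmod (b $ i)) UNIV"
      by (rule L2_set_mult_ineq)
    finally show ?thesis by (simp add: norm_vec_def)
  qed
  then have "1 - norm a * norm b \<le> cmod c"
    using norm_triangle_ineq2[of 1 s] by (simp add: c_def)
  moreover have "norm a * norm b \<le> 1" using a1 b1 by (intro mult_le_one) auto
  ultimately have "(1 - norm a * norm b)\<^sup>2 \<le> (cmod c)\<^sup>2" by (intro power_mono) auto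
  also note cle
  also have "t * (1 - (norm b)\<^sup>2) * (norm k)\<^sup>2 \<le> t * (1 - (norm b)\<^sup>2) * (2 / (1 - \<rho>))\<^sup>2"
    using t b1 N by (intro mult_left_mono mult_nonneg_nonneg) (auto simp: power_le_one)
  finally show ?thesis by (simp add: t_def A_def)
qed

section \<open>Orbits in the elliptic case\<close>

lemma scalar_map_eqI:
  fixes \<psi> :: "('h \<Rightarrow>\<^sub>L 'h) ^ 'n \<Rightarrow> ('h \<Rightarrow>\<^sub>L 'h) ^ 'n"
  shows "\<psi> (scalar_tuple z) = scalar_tuple w \<Longrightarrow> scalar_map \<psi> z = w"
  by (simp add: scalar_map_def scalar_tuple_eq_iff)

lemma scalar_map_funpow_Suc:
  fixes \<phi> :: "('h \<Rightarrow>\<^sub>L 'h) ^ 'n \<Rightarrow> ('h \<Rightarrow>\<^sub>L 'h) ^ 'n"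
  assumes "free_self_map \<phi>" "norm z < 1"
  shows "scalar_map (\<phi> ^^ Suc m) z = scalar_map \<phi> (scalar_map (\<phi> ^^ m) z)"
proof (rule scalar_map_eqI)
  have *: "(\<phi> ^^ m) (scalar_tuple z) = scalar_tuple (scalar_map (\<phi> ^^ m) z)"
    "norm (scalar_map (\<phi> ^^ m) z) < 1"
    using free_self_map_scalar[OF free_self_map_funpow[OF assms(1)] assms(2)] by auto
  show "(\<phi> ^^ Suc m) (scalar_tuple z) = scalar_tuple (scalar_map \<phi> (scalar_map (\<phi> ^^ m) z))"
    using free_self_map_scalar(1)[OF assms(1) *(2)] by (simp add: *(1))
qed

lemma scalar_map_funpow_0:
  "scalar_map ((\<phi> :: ('h \<Rightarrow>\<^sub>L 'h) ^ 'n \<Rightarrow> ('h \<Rightarrow>\<^sub>L 'h) ^ 'n) ^^ 0) z = z"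
  by (rule scalar_map_eqI) simp

text \<open>Schwarz-Pick is applied to each iterate at the fixed point \<open>z\<close>, where the
  image point is always \<open>z\<close> itself. The resulting constant is independent of
  \<open>m\<close>.\<close>

lemma elliptic_orbit:
  fixes \<phi> :: "('h \<Rightarrow>\<^sub>L 'h) ^ 'n \<Rightarrow> ('h \<Rightarrow>\<^sub>L 'h) ^ 'n"
  assumes \<phi>: "free_self_map \<phi>" and "elliptic \<phi>"
  obtains C where "C > 0" "\<And>m. C \<le> 1 - (norm (scalar_map (\<phi> ^^ m) 0))\<^sup>2"
proof -
  obtain z where z: "norm z < 1" "scalar_map \<phi> z = z"
    using assms by (auto simp: elliptic_def has_fixed_point_def)
  have fixed: "scalar_map (\<phi> ^^ m) z = z" for m
  proof (induction m)
    case (Suc m)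
    then show ?case unfolding scalar_map_funpow_Suc[OF \<phi> z(1)] by (simp add: z)
  qed (rule scalar_map_funpow_0)
  define N where "N = (2 / (1 - norm z))\<^sup>2"
  have N: "N > 0" using z by (simp add: N_def)
  have "(1 - norm z)\<^sup>2 / N \<le> 1 - (norm (scalar_map (\<phi> ^^ m) 0))\<^sup>2" for m
  proof -
    let ?a = "scalar_map (\<phi> ^^ m) 0"
    have a: "norm ?a < 1" using free_self_map_scalar(2)[OF free_self_map_funpow[OF \<phi>], of 0] by simp
    have d: "0 \<le> 1 - (norm ?a)\<^sup>2" using a by (simp add: power_le_one)
    have "norm ?a * norm z \<le> norm z" using a by (intro mult_left_le_one_le) auto
    then have "(1 - norm z)\<^sup>2 \<le> (1 - norm ?a * norm z)\<^sup>2" using z by (intro power_mono) auto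
    also have "\<dots> \<le> (1 - (norm ?a)\<^sup>2) * (1 - (norm z)\<^sup>2) * N"
      using schwarz_pick[OF free_self_map_funpow[OF \<phi>] order_refl z(1), of m]
      by (simp add: fixed N_def)
    also have "\<dots> \<le> (1 - (norm ?a)\<^sup>2) * 1 * N"
      using N d by (intro mult_right_mono mult_left_mono) auto
    finally show ?thesis using N by (simp add: field_simps)
  qed
  then show ?thesis using that[of "(1 - norm z)\<^sup>2 / N"] z N by simp
qed

section \<open>Ellipsoids and orbits in the parabolic case\<close>

lemma row_square_scalar:
  "row_square (scalar_tuple z :: ('h \<Rightarrow>\<^sub>L 'h) ^ 'n) = complex_of_real ((norm z)\<^sup>2) *\<^sub>C id_blinfun"
proof (rule blinfun_eqI)
  fix x :: 'h
  have "adj ((scalar_tuple z :: ('h \<Rightarrow>\<^sub>L 'h) ^ 'n) $ i) = cnj (z $ i) *\<^sub>C id_blinfun" for i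
    by (simp add: scalar_tuple_def adj_scaled_id)
  then show "blinfun_apply (row_square (scalar_tuple z)) x = blinfun_apply (complex_of_real ((norm z)\<^sup>2) *\<^sub>C id_blinfun) x"
    unfolding row_square_def norm_vec_square of_real_sum complex_norm_square
    by (simp add: blinfun.sum_left scaleC_scaleC scaleC_sum_left)
qed

text \<open>On scalar tuples the operator in the definition of the ellipsoid is \<kappa> times the
  identity. The parameter 2/3 gives \<open>c / (1 - c) = 2\<close>, large enough for the origin to
  lie inside.\<close>

lemma scalar_tuple_ellipsoid:
  fixes z \<zeta> :: "complex ^ 'n"
  defines "\<kappa> \<equiv> 2 * (1 - (norm z)\<^sup>2) - (cmod (1 - (\<Sum>i\<in>UNIV. cnj (\<zeta> $ i) * z $ i)))\<^sup>2"
  assumes z: "norm z < 1"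
  shows "(scalar_tuple z :: ('h \<Rightarrow>\<^sub>L 'h) ^ 'n) \<in> ellipsoid (2/3) \<zeta> \<Longrightarrow> 0 \<le> \<kappa>"
    and "0 < \<kappa> \<Longrightarrow> (scalar_tuple z :: ('h \<Rightarrow>\<^sub>L 'h) ^ 'n) \<in> ellipsoid (2/3) \<zeta>"
proof -
  let ?Z = "scalar_tuple z :: ('h \<Rightarrow>\<^sub>L 'h) ^ 'n"
  define s where "s = 1 - (\<Sum>i\<in>UNIV. cnj (\<zeta> $ i) * z $ i)"
  define Y where "Y = id_blinfun - (\<Sum>i\<in>UNIV. cnj (\<zeta> $ i) *\<^sub>C (?Z $ i))"
  define D where "D = ((2/3) / (1 - 2/3)) *\<^sub>R (id_blinfun - row_square ?Z) - (Y o\<^sub>L adj Y)"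
  have Y: "Y = s *\<^sub>C id_blinfun"
    unfolding Y_def s_def
    by (rule blinfun_eqI)
      (simp add: blinfun.diff_left blinfun.sum_left scaleC_scaleC scaleC_diff_left scaleC_one scaleC_sum_left)
  have "s * cnj s = complex_of_real ((cmod s)\<^sup>2)" by (rule complex_norm_square[symmetric])
  then have D: "blinfun_apply D x = complex_of_real \<kappa> *\<^sub>C x" for x
    unfolding D_def Y adj_scaled_id row_square_scalar \<kappa>_def s_def[symmetric]
    by (simp add: blinfun.diff_left blinfun.scaleR_left scaleR_scaleC scaleC_scaleC
        scaleC_diff_left scaleC_diff_right scaleC_one)
  have pos: "cinner x (blinfun_apply D x) = complex_of_real (\<kappa> * (norm x)\<^sup>2)" for x
    by (simp add: D cinner_scaleC_right cinner_self)
  have mem: "?Z \<in> ellipsoid (2/3) \<zeta> \<longleftrightarrow> positive_op D \<and> invertible_op D"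
    using z by (simp add: ellipsoid_def scalar_tuple_in_nc_ball op_less_def Let_def D_def Y_def)
  show "0 \<le> \<kappa>" if "?Z \<in> ellipsoid (2/3) \<zeta>"
  proof -
    have "cinner (e []) (blinfun_apply D (e [])) \<in> \<real>\<^sub>\<ge>\<^sub>0"
      using that mem unfolding positive_op_def by blast
    then show ?thesis by (simp add: pos)
  qed
  show "?Z \<in> ellipsoid (2/3) \<zeta>" if "0 < \<kappa>"
  proof -
    have "positive_op D" unfolding positive_op_def pos using that by simp
    moreover have "invertible_op D"
      unfolding invertible_op_def
      by (rule exI[of _ "complex_of_real (1 / \<kappa>) *\<^sub>C id_blinfun"])
        (use that in \<open>auto intro!: blinfun_eqI simp: D scaleC_scaleC scaleC_one\<close>)
    ultimately show ?thesis using mem by blast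
  qed
qed

lemma norm_diff_unit_square:
  fixes z \<zeta> :: "complex ^ 'n"
  assumes "norm \<zeta> = 1"
  shows "(norm (z - \<zeta>))\<^sup>2 = (norm z)\<^sup>2 + 1 - 2 * Re (\<Sum>i\<in>UNIV. cnj (\<zeta> $ i) * z $ i)"
proof -
  have "(cmod (x - y))\<^sup>2 = (cmod x)\<^sup>2 + (cmod y)\<^sup>2 - 2 * Re (cnj y * x)" for x y
    unfolding cmod_power2 by (simp add: power2_eq_square algebra_simps)
  then have "(norm (z - \<zeta>))\<^sup>2 = (norm z)\<^sup>2 + (norm \<zeta>)\<^sup>2 - 2 * Re (\<Sum>i\<in>UNIV. cnj (\<zeta> $ i) * z $ i)"
    by (simp add: norm_vec_square sum.distrib sum_subtractf sum_distrib_left)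
  then show ?thesis by (simp add: assms)
qed

text \<open>If \<open>d m\<close> is small, the orbit is near \<zeta> and the dilatation coefficient
  limits the decrease to a factor \<open>p\<close>. Otherwise the orbit lies in a fixed compact
  ball, and Schwarz-Pick keeps the next point away from the boundary.\<close>

lemma parabolic_orbit:
  fixes \<phi> :: "('h \<Rightarrow>\<^sub>L 'h) ^ 'n \<Rightarrow> ('h \<Rightarrow>\<^sub>L 'h) ^ 'n"
  assumes \<phi>: "free_self_map \<phi>" and "parabolic \<phi>" and p: "0 < p" "p < 1"
  obtains C where "C > 0" "\<And>m. C * p ^ m \<le> 1 - (norm (scalar_map (\<phi> ^^ m) 0))\<^sup>2"
proof -
  obtain \<zeta> where dw: "denjoy_wolff_point \<phi> \<zeta>" and dil: "dilatation_coeff \<phi> \<zeta> = 1"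
    using assms by (auto simp: parabolic_def)
  have \<zeta>: "norm \<zeta> = 1" using dw by (simp add: denjoy_wolff_point_def)
  define orb where "orb = (\<lambda>m. scalar_map (\<phi> ^^ m) 0)"
  define d where "d = (\<lambda>m. 1 - (norm (orb m))\<^sup>2)"
  have o1: "norm (orb m) < 1" for m
    unfolding orb_def using free_self_map_scalar(2)[OF free_self_map_funpow[OF \<phi>], of 0] by simp
  have d0: "d m > 0" for m using o1[of m] by (simp add: d_def power_less_one_iff)
  have o_Suc: "orb (Suc m) = scalar_map \<phi> (orb m)" for m
    unfolding orb_def by (rule scalar_map_funpow_Suc[OF \<phi>]) simp
  \<comment> \<open>The orbit of 0 stays in one invariant ellipsoid, so \<open>1 - s\<close> is
    bounded by the square root of \<open>2 * d m\<close>; the squared distance to \<zeta> is at most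
    \<open>2 * (1 - Re s)\<close>.\<close>
  have near: "(norm (orb m - \<zeta>))\<^sup>2 \<le> 2 * sqrt (2 * d m)" for m
  proof -
    define s where "s = (\<Sum>i\<in>UNIV. cnj (\<zeta> $ i) * orb m $ i)"
    have "(scalar_tuple 0 :: ('h \<Rightarrow>\<^sub>L 'h) ^ 'n) \<in> ellipsoid (2/3) \<zeta>"
      by (rule scalar_tuple_ellipsoid(2)) auto
    moreover have "(\<phi> ^^ m) ` ellipsoid (2/3) \<zeta> \<subseteq> ellipsoid (2/3) \<zeta>"
      using dw by (auto simp: denjoy_wolff_point_def)
    moreover have "(\<phi> ^^ m) (scalar_tuple 0) = scalar_tuple (orb m)"
      unfolding orb_def by (rule free_self_map_scalar(1)[OF free_self_map_funpow[OF \<phi>]]) simp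
    ultimately have "(scalar_tuple (orb m) :: ('h \<Rightarrow>\<^sub>L 'h) ^ 'n) \<in> ellipsoid (2/3) \<zeta>"
      by (metis image_subset_iff)
    from scalar_tuple_ellipsoid(1)[OF o1 this]
    have "(cmod (1 - s))\<^sup>2 \<le> 2 * d m" by (simp add: s_def d_def)
    then have "cmod (1 - s) \<le> sqrt (2 * d m)" using real_le_rsqrt by blast
    moreover have "1 - Re s \<le> cmod (1 - s)" using complex_Re_le_cmod[of "1 - s"] by simp
    moreover have "(norm (orb m))\<^sup>2 \<le> 1" using o1[of m] by (simp add: power_le_one)
    ultimately show ?thesis
      using norm_diff_unit_square[OF \<zeta>, of "orb m"] by (simp add: s_def[symmetric])
  qed
  have "ereal p < dilatation_coeff \<phi> \<zeta>" using p by (simp add: dil)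
  then have "eventually (\<lambda>z. ereal p < ereal ((1 - (norm (scalar_map \<phi> z))\<^sup>2) / (1 - (norm z)\<^sup>2)))
      (at \<zeta> within ball 0 1)"
    unfolding dilatation_coeff_def by (rule less_LiminfD)
  then obtain \<eta> where \<eta>: "\<eta> > 0" "\<And>z. norm z < 1 \<Longrightarrow> z \<noteq> \<zeta> \<Longrightarrow> dist z \<zeta> < \<eta> \<Longrightarrow>
      p < (1 - (norm (scalar_map \<phi> z))\<^sup>2) / (1 - (norm z)\<^sup>2)"
    unfolding eventually_at by auto
  \<comment> \<open>With \<open>d m\<close> below \<open>\<eta> ^ 4 / 8\<close> the bound
    \<open>near\<close> falls below the square of \<eta>; the minimum with 1/2 keeps \<delta> below
    1.\<close>
  define \<delta> where "\<delta> = min (\<eta> ^ 4 / 8) (1 / 2)"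
  have \<delta>: "0 < \<delta>" "\<delta> < 1" "\<delta> \<le> \<eta> ^ 4 / 8" using \<eta>(1) by (auto simp: \<delta>_def)
  have step1: "p * d m \<le> d (Suc m)" if "d m < \<delta>" for m
  proof -
    have "2 * d m < (\<eta>\<^sup>2 / 2)\<^sup>2" using that \<delta>(3) by (simp add: power_divide flip: power_mult)
    then have "sqrt (2 * d m) < sqrt ((\<eta>\<^sup>2 / 2)\<^sup>2)" by (rule real_sqrt_less_mono)
    then have "sqrt (2 * d m) < \<eta>\<^sup>2 / 2" unfolding real_sqrt_abs by simp
    then have "(norm (orb m - \<zeta>))\<^sup>2 < \<eta>\<^sup>2" using near[of m] by simp
    then have "dist (orb m) \<zeta> < \<eta>" unfolding dist_norm by (rule power2_less_imp_less) (use \<eta> in simp)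
    moreover have "orb m \<noteq> \<zeta>" using o1[of m] \<zeta> by auto
    ultimately have "p < d (Suc m) / d m" using \<eta>(2)[OF o1, of m] by (simp add: d_def o_Suc)
    then show ?thesis using d0[of m] by (simp add: field_simps)
  qed
  define \<rho> where "\<rho> = sqrt (1 - \<delta>)"
  define N where "N = (2 / (1 - \<rho>))\<^sup>2"
  define a where "a = scalar_map \<phi> 0"
  define c where "c = (1 - norm a)\<^sup>2 / N"
  have \<rho>: "\<rho> < 1" using \<delta> by (simp add: \<rho>_def)
  have N: "N > 0" using \<rho> by (simp add: N_def)
  have a: "norm a < 1" unfolding a_def by (rule free_self_map_scalar(2)[OF \<phi>]) simp
  have c: "c > 0" using a N by (simp add: c_def)
  have step2: "c \<le> d (Suc m)" if "\<not> d m < \<delta>" for m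
  proof -
    have "(norm (orb m))\<^sup>2 \<le> 1 - \<delta>" using that by (simp add: d_def)
    then have o\<rho>: "norm (orb m) \<le> \<rho>" unfolding \<rho>_def by (rule real_le_rsqrt)
    have "norm a * norm (orb (Suc m)) \<le> norm a"
      using o1[of "Suc m"] by (intro mult_right_le_one_le) auto
    then have "(1 - norm a)\<^sup>2 \<le> (1 - norm a * norm (orb (Suc m)))\<^sup>2"
      using a by (intro power_mono) auto
    also have "\<dots> \<le> (1 - (norm a)\<^sup>2) * d (Suc m) * N"
      using schwarz_pick[OF \<phi> o\<rho> \<rho>] by (simp add: a_def d_def N_def o_Suc)
    also have "\<dots> \<le> 1 * d (Suc m) * N"
      using d0[of "Suc m"] N by (intro mult_right_mono) auto
    finally show ?thesis using N by (simp add: c_def field_simps)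
  qed
  \<comment> \<open>The 1 accounts for the start \<open>d 0 = 1\<close>; the bound \<open>c\<close>
    restarts the estimate after every visit to the compact ball.\<close>
  have "min 1 c * p ^ m \<le> d m" for m
  proof (induction m)
    case 0
    have "orb 0 = 0" unfolding orb_def by (rule scalar_map_funpow_0)
    then show ?case by (simp add: d_def)
  next
    case (Suc m)
    show ?case
    proof (cases "d m < \<delta>")
      case True
      have "min 1 c * p ^ Suc m \<le> p * d m" using mult_left_mono[OF Suc, of p] p by (simp add: mult_ac)
      then show ?thesis using step1[OF True] by simp
    next
      case False
      have "min 1 c * p ^ Suc m \<le> min 1 c * 1"
        using p c by (intro mult_left_mono power_le_one) auto
      then show ?thesis using step2[OF False] by simp
    qed
  qed
  then show ?thesis using that[of "min 1 c"] c by (simp add: d_def orb_def)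
qed

text \<open>With \<open>s\<close> the square root of \<open>(1 - q) * (1 + q)\<close> and
  \<open>1 + q \<le> 2\<close>, the quotient \<open>s / (1 - q)\<close> is at most
  \<open>2 / s\<close>.\<close>

lemma comp_bound_le:
  assumes \<psi>: "free_self_map \<psi>" and d: "0 < d" "d \<le> 1 - (norm (scalar_map \<psi> 0))\<^sup>2"
  shows "comp_bound \<psi> \<le> 2 / sqrt d"
proof -
  define q where "q = norm (scalar_map \<psi> 0)"
  have q: "0 \<le> q" "q < 1" using free_self_map_scalar(2)[OF \<psi>, of 0] by (auto simp: q_def)
  define s where "s = sqrt (1 - q\<^sup>2)"
  have dq: "d \<le> 1 - q\<^sup>2" using d by (simp add: q_def)
  have s: "sqrt d \<le> s" "sqrt d > 0" using dq d by (auto simp: s_def)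
  have s0: "s > 0" using less_le_trans[OF s(2,1)] .
  have "s * s = (1 - q) * (1 + q)" using dq d by (simp add: s_def algebra_simps power2_eq_square)
  also have "\<dots> \<le> (1 - q) * 2" using q by (intro mult_left_mono) auto
  finally have "s \<le> (1 - q) * 2 / s" using s0 by (subst pos_le_divide_eq) auto
  then have "s / (1 - q) \<le> 2 / s" using q by (subst pos_divide_le_eq) (auto simp: mult.commute)
  also have "\<dots> \<le> 2 / sqrt d" using s s0 by (intro divide_left_mono mult_pos_pos) auto
  finally show ?thesis by (simp add: comp_bound_def q_def s_def)
qed

end

section \<open>The spectrum\<close>

text \<open>The series \<open>S\<close> is the Neumann series for the inverse of
  \<open>z - T\<close>, so the resolvent in the present sign convention is \<open>- S\<close>. Only
  bounds on the powers of \<open>T\<close> enter its convergence.\<close>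

lemma neumann_resolvent:
  fixes T :: "'a::{complex_normed_vector, banach} \<Rightarrow> 'a"
  assumes add: "\<And>x y. T (x + y) = T x + T y" and sc: "\<And>c x. T (c *\<^sub>C x) = c *\<^sub>C T x"
    and M: "\<And>m x. norm ((T ^^ m) x) \<le> M m * norm x"
    and z: "z \<noteq> 0" and sm: "summable (\<lambda>m. M m * (1 / cmod z) ^ m)"
  obtains R K where "\<And>x y. R (x + y) = R x + R y" "\<And>c x. R (c *\<^sub>C x) = c *\<^sub>C R x"
    "\<And>x. norm (R x) \<le> K * norm x" "\<And>x. R (T x - z *\<^sub>C x) = x" "\<And>x. T (R x) - z *\<^sub>C R x = x"
proof -
  have T: "bounded_linear T"
    by (rule bounded_linear_intro[where K = "M 1"])
      (use M[of 1] in \<open>auto simp: add sc scaleR_scaleC mult.commute\<close>)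
  have addm: "(T ^^ m) (x + y) = (T ^^ m) x + (T ^^ m) y" for m x y
    by (induction m) (auto simp: add)
  have scm: "(T ^^ m) (c *\<^sub>C x) = c *\<^sub>C (T ^^ m) x" for m c x
    by (induction m) (auto simp: sc)
  define t where "t = (\<lambda>x m. (inverse z) ^ Suc m *\<^sub>C (T ^^ m) x)"
  define S where "S = (\<lambda>x. suminf (t x))"
  define K where "K = (\<Sum>m. (1 / cmod z) * (M m * (1 / cmod z) ^ m))"
  have le: "norm (t x m) \<le> (1 / cmod z) * (M m * (1 / cmod z) ^ m) * norm x" for x m
  proof -
    have "norm (t x m) = inverse (cmod z) ^ Suc m * norm ((T ^^ m) x)"
      unfolding t_def norm_scaleC norm_power norm_inverse ..
    also have "\<dots> \<le> inverse (cmod z) ^ Suc m * (M m * norm x)"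
      by (intro mult_left_mono M) simp
    finally show ?thesis by (simp add: inverse_eq_divide mult_ac)
  qed
  have smK: "summable (\<lambda>m. (1 / cmod z) * (M m * (1 / cmod z) ^ m))"
    by (rule summable_mult[OF sm])
  have s: "summable (t x)" for x
    by (rule summable_comparison_test'[OF summable_mult2[OF smK]]) (rule le)
  have S_add: "S (x + y) = S x + S y" for x y
    using suminf_add[OF s s, of x y] by (simp add: S_def t_def addm scaleC_add_right)
  have S_sc: "S (c *\<^sub>C x) = c *\<^sub>C S x" for c x
    using bounded_linear.suminf[OF bounded_linear_scaleC s, of c x]
    by (simp add: S_def t_def scm scaleC_scaleC mult.commute)
  have S_le: "norm (S x) \<le> K * norm x" for x
    unfolding S_def K_def suminf_mult2[OF smK]
    by (rule norm_suminf_le[OF le summable_mult2[OF smK]])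
  \<comment> \<open>Applying \<open>T\<close> to the argument shifts the series by one place and
    multiplies it by \<open>z\<close>; the lost first term is \<open>x / z\<close>.\<close>
  have tail: "(\<lambda>m. t (T x) m) sums (z *\<^sub>C S x - x)" for x
  proof -
    have "(\<lambda>m. t x (Suc m)) sums (S x - t x 0)"
      using summable_sums[OF s[of x]] sums_Suc_iff[of "t x" "S x - t x 0"] by (simp add: S_def)
    from bounded_linear.sums[OF bounded_linear_scaleC this, of z]
    moreover have "z *\<^sub>C t x (Suc m) = t (T x) m" for m
    proof -
      have "z * inverse z ^ Suc (Suc m) = inverse z ^ Suc m" using z by simp
      then show ?thesis by (simp only: t_def scaleC_scaleC funpow_Suc_right o_apply)
    qed
    moreover have "z *\<^sub>C (S x - t x 0) = z *\<^sub>C S x - x"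
      using z by (simp add: t_def scaleC_diff_right scaleC_scaleC scaleC_one)
    ultimately show ?thesis by simp
  qed
  have ST: "S (T x) = z *\<^sub>C S x - x" for x
    using sums_unique[OF tail[of x]] by (simp add: S_def)
  have TS: "T (S x) = S (T x)" for x
    using bounded_linear.suminf[OF T s, of x] by (simp add: S_def t_def sc funpow_swap1)
  have S_diff: "S (x - y) = S x - S y" for x y
    using S_add[of "x - y" y] by (simp add: algebra_simps)
  have T_minus: "T (- x) = - T x" for x
    using linear_neg[OF bounded_linear.linear[OF T]] .
  show ?thesis
    by (rule that[of "\<lambda>x. - S x" K])
      (auto simp: S_add S_sc S_le S_diff ST TS T_minus scaleC_minus_right)
qed

context word_basis begin

text \<open>Powers of the composition operator are composition operators of iterates, so
  \<open>comp_norm_le\<close> bounds them by the orbit of the origin.\<close>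

lemma comp_op_funpow:
  fixes \<phi> :: "('h \<Rightarrow>\<^sub>L 'h) ^ 'n \<Rightarrow> ('h \<Rightarrow>\<^sub>L 'h) ^ 'n"
  assumes \<phi>: "free_self_map \<phi>" and \<tau>: "\<And>x. comp_op \<phi> (func x) = func (\<tau> x)"
  shows "comp_op (\<phi> ^^ m) (func x) = func ((\<tau> ^^ m) x)"
proof (induction m)
  case 0
  show ?case by (auto simp: comp_op_def func_outside)
next
  case (Suc m)
  have "comp_op (\<phi> ^^ Suc m) (func x) = comp_op \<phi> (comp_op (\<phi> ^^ m) (func x))"
    using \<phi> by (auto simp: comp_op_def free_self_map_def funpow_swap1)
  also have "\<dots> = func (\<tau> ((\<tau> ^^ m) x))" by (simp only: Suc \<tau>)
  also have "\<tau> ((\<tau> ^^ m) x) = (\<tau> ^^ Suc m) x" by simp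
  finally show ?case .
qed

lemma comp_op_spectrum_le:
  fixes \<phi> :: "('h \<Rightarrow>\<^sub>L 'h) ^ 'n \<Rightarrow> ('h \<Rightarrow>\<^sub>L 'h) ^ 'n"
  assumes \<phi>: "free_self_map \<phi>"
    and orbit: "\<And>p. 0 < p \<Longrightarrow> p < 1 \<Longrightarrow> \<exists>C>0. \<forall>m. C * p ^ m \<le> 1 - (norm (scalar_map (\<phi> ^^ m) 0))\<^sup>2"
    and z: "z \<in> spectrum_on H2_ball H2_norm (comp_op \<phi>)"
  shows "cmod z \<le> 1"
proof (rule ccontr)
  assume "\<not> cmod z \<le> 1"
  then have z1: "cmod z > 1" by simp
  have "\<exists>y. comp_op \<phi> (func x) = func y" for x
  proof -
    obtain y where "\<forall>X\<in>nc_ball. func x (\<phi> X) = func y X" using func_comp[OF \<phi>] by blast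
    then have "comp_op \<phi> (func x) = func y" by (auto simp: comp_op_def func_outside)
    then show ?thesis ..
  qed
  then obtain \<tau> where \<tau>: "\<And>x. comp_op \<phi> (func x) = func (\<tau> x)" by metis
  have \<tau>_add: "\<tau> (x + y) = \<tau> x + \<tau> y" for x y
  proof (rule injD[OF inj_func])
    have "comp_op \<phi> (func x + func y) = comp_op \<phi> (func x) + comp_op \<phi> (func y)"
      by (auto simp: comp_op_def)
    then show "func (\<tau> (x + y)) = func (\<tau> x + \<tau> y)" by (simp add: \<tau> flip: func_add)
  qed
  have \<tau>_sc: "\<tau> (c *\<^sub>C x) = c *\<^sub>C \<tau> x" for c x
  proof (rule injD[OF inj_func])
    have "comp_op \<phi> (c *\<^sub>C func x) = c *\<^sub>C comp_op \<phi> (func x)"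
      by (auto simp: comp_op_def scaleC_fun_def)
    then show "func (\<tau> (c *\<^sub>C x)) = func (c *\<^sub>C \<tau> x)" by (simp add: \<tau> flip: func_scaleC)
  qed
  have \<tau>_le: "norm ((\<tau> ^^ m) x) \<le> comp_bound (\<phi> ^^ m) * norm x" for m x
  proof (rule comp_norm_le[OF free_self_map_funpow[OF \<phi>]])
    show "func x ((\<phi> ^^ m) X) = func ((\<tau> ^^ m) x) X" if "X \<in> nc_ball" for X
      using fun_cong[OF comp_op_funpow[OF \<phi> \<tau>, of m x], of X] that by (simp add: comp_op_def)
  qed
  define q where "q = 1 / cmod z"
  have q: "0 < q" "q < 1" using z1 by (auto simp: q_def divide_less_eq)
  \<comment> \<open>The midpoint between the square of \<open>q\<close> and 1. The power bounds grow
    like the inverse square root of \<open>p ^ m\<close>, so the Neumann series is geometric with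
    ratio \<open>q / sqrt p\<close> below 1.\<close>
  define p where "p = (1 + q\<^sup>2) / 2"
  have "q\<^sup>2 < 1" using q by (simp add: power_less_one_iff)
  then have p: "0 < p" "p < 1" "q\<^sup>2 < p" by (auto simp: p_def add_pos_nonneg)
  obtain C where C: "C > 0" "\<And>m. C * p ^ m \<le> 1 - (norm (scalar_map (\<phi> ^^ m) 0))\<^sup>2"
    using orbit[OF p(1,2)] by blast
  define M where "M = (\<lambda>m. 2 / sqrt (C * p ^ m))"
  have M: "norm ((\<tau> ^^ m) x) \<le> M m * norm x" for m x
  proof -
    have "comp_bound (\<phi> ^^ m) \<le> M m"
      unfolding M_def using C p by (intro comp_bound_le free_self_map_funpow \<phi>) auto
    then show ?thesis using \<tau>_le[of m x] by (meson mult_right_mono norm_ge_zero order_trans)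
  qed
  have sm: "summable (\<lambda>m. M m * (1 / cmod z) ^ m)"
  proof -
    have "q / sqrt p < 1" using p q real_less_rsqrt[of q p] by simp
    then have "summable (\<lambda>m. 2 / sqrt C * (q / sqrt p) ^ m)"
      using p q by (intro summable_mult summable_geometric) simp
    moreover have "M m * (1 / cmod z) ^ m = 2 / sqrt C * (q / sqrt p) ^ m" for m
      unfolding M_def q_def[symmetric] power_divide real_sqrt_mult real_sqrt_power by simp
    ultimately show ?thesis by simp
  qed
  have "z \<noteq> 0" using z1 by auto
  obtain R K where R_add: "\<And>x y. R (x + y) = R x + R y"
    and R_sc: "\<And>c x. R (c *\<^sub>C x) = c *\<^sub>C R x" and R_le: "\<And>x. norm (R x) \<le> K * norm x"
    and RT: "\<And>x. R (\<tau> x - z *\<^sub>C x) = x" and TR: "\<And>x. \<tau> (R x) - z *\<^sub>C R x = x"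
    by (rule neumann_resolvent[OF \<tau>_add \<tau>_sc M \<open>z \<noteq> 0\<close> sm]) blast
  \<comment> \<open>The resolvent on the Hilbert space is transported to the Hardy space through the
    injection \<open>func\<close>.\<close>
  define S where "S = (\<lambda>f. func (R (inv func f)))"
  have S: "S (func x) = func (R x)" for x by (simp add: S_def inv_f_f[OF inj_func])
  have shifted: "comp_op \<phi> (func x) - z *\<^sub>C func x = func (\<tau> x - z *\<^sub>C x)" for x
  proof -
    have "func (\<tau> x - z *\<^sub>C x) + func (z *\<^sub>C x) = func (\<tau> x)" by (simp flip: func_add)
    then show ?thesis by (simp add: \<tau> func_scaleC algebra_simps)
  qed
  have "bounded_op_on H2_ball H2_norm S"
    unfolding bounded_op_on_def H2_ball_eq
    by (intro conjI exI[of _ K])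
      (auto simp: S R_add R_sc R_le H2_norm_func simp flip: func_add func_scaleC)
  moreover have "S (comp_op \<phi> f - z *\<^sub>C f) = f \<and> comp_op \<phi> (S f) - z *\<^sub>C S f = f" if "f \<in> H2_ball" for f
    using that unfolding H2_ball_eq by (auto simp: shifted S RT TR)
  ultimately show False using z unfolding spectrum_on_def by blast
qed

text \<open>The constant function \<open>func (e [])\<close> is fixed by composition, so a left
  inverse of the operator minus 1 would send 0 to a nonzero function.\<close>

lemma one_in_comp_op_spectrum:
  fixes \<phi> :: "('h \<Rightarrow>\<^sub>L 'h) ^ 'n \<Rightarrow> ('h \<Rightarrow>\<^sub>L 'h) ^ 'n"
  assumes \<phi>: "free_self_map \<phi>"
  shows "1 \<in> spectrum_on H2_ball H2_norm (comp_op \<phi>)"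
  unfolding spectrum_on_def
proof (clarify)
  fix S assume S: "bounded_op_on H2_ball H2_norm S"
    and inv: "\<forall>f\<in>H2_ball. S (comp_op \<phi> f - 1 *\<^sub>C f) = f \<and> comp_op \<phi> (S f) - 1 *\<^sub>C S f = f"
  have 1: "comp_op \<phi> (func (e [])) = func (e [])"
    using \<phi> by (auto simp: comp_op_def func_outside func_basis free_self_map_def)
  have in_H2: "func (e []) \<in> H2_ball" by (simp add: H2_ball_eq)
  have "S (0 *\<^sub>C func (e [])) = 0 *\<^sub>C S (func (e []))"
    using S in_H2 unfolding bounded_op_on_def by blast
  then have "S 0 = 0" by simp
  moreover have "S (comp_op \<phi> (func (e [])) - 1 *\<^sub>C func (e [])) = func (e [])" using inv in_H2 by blast
  ultimately have "func (e []) = 0" by (simp add: 1 scaleC_one)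
  then have "norm (e []) = H2_norm (func 0)" unfolding H2_norm_func[symmetric]
    using func_scaleC[of 0 0] by simp
  then show False by (simp add: H2_norm_func)
qed

text \<open>The constant lower bound of the elliptic case also dominates a multiple of
  \<open>p ^ m\<close>, so both cases meet the same orbit condition; the supremum is attained at
  1.\<close>

theorem spectral_radius_comp_op:
  fixes \<phi> :: "('h \<Rightarrow>\<^sub>L 'h) ^ 'n \<Rightarrow> ('h \<Rightarrow>\<^sub>L 'h) ^ 'n"
  assumes \<phi>: "free_self_map \<phi>" and "elliptic \<phi> \<or> parabolic \<phi>"
  shows "spectral_radius_on H2_ball H2_norm (comp_op \<phi>) = 1"
proof -
  have orbit: "\<exists>C>0. \<forall>m. C * p ^ m \<le> 1 - (norm (scalar_map (\<phi> ^^ m) 0))\<^sup>2" if p: "0 < p" "p < 1" for p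
    using assms(2)
  proof
    assume "elliptic \<phi>"
    then obtain C where C: "C > 0" "\<And>m. C \<le> 1 - (norm (scalar_map (\<phi> ^^ m) 0))\<^sup>2"
      using elliptic_orbit[OF \<phi>] by blast
    have "C * p ^ m \<le> C * 1" for m using C p by (intro mult_left_mono power_le_one) auto
    then have "C * p ^ m \<le> 1 - (norm (scalar_map (\<phi> ^^ m) 0))\<^sup>2" for m
      using order_trans[OF _ C(2), of "C * p ^ m" m] by simp
    then show ?thesis using C(1) by blast
  next
    assume "parabolic \<phi>"
    then show ?thesis using parabolic_orbit[OF \<phi> _ p] by blast
  qed
  show ?thesis
    unfolding spectral_radius_on_def
  proof (rule cSup_eq_maximum)
    show "1 \<in> cmod ` spectrum_on H2_ball H2_norm (comp_op \<phi>)"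
      using one_in_comp_op_spectrum[OF \<phi>] by force
    show "x \<le> 1" if "x \<in> cmod ` spectrum_on H2_ball H2_norm (comp_op \<phi>)" for x
      using that comp_op_spectrum_le[OF \<phi> orbit] by auto
  qed
qed

end

section \<open>Existence of a basis indexed by words\<close>

text \<open>Zorn gives a maximal orthonormal set, which is total. Separability makes it countable
  and infinite dimension makes it infinite, so it can be matched with the words.\<close>

lemma ex_word_basis:
  assumes sep: "separable TYPE('h::chilbert_space)" and inf: "infinite_dimensional TYPE('h::chilbert_space)"
  obtains e :: "'n::finite list \<Rightarrow> 'h::chilbert_space" where "word_basis e"
proof -
  define A where "A = {B :: 'h set. \<forall>x\<in>B. \<forall>y\<in>B. cinner x y = (if x = y then 1 else 0)}"
  have "\<exists>B\<in>A. \<forall>X\<in>A. B \<subseteq> X \<longrightarrow> X = B"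
  proof (rule subset_Zorn')
    fix \<C> assume \<C>: "subset.chain A \<C>"
    have "cinner x y = (if x = y then 1 else 0)" if xy: "x \<in> \<Union>\<C>" "y \<in> \<Union>\<C>" for x y
    proof -
      obtain U V where UV: "x \<in> U" "U \<in> \<C>" "y \<in> V" "V \<in> \<C>" using xy by blast
      then have "U \<subseteq> V \<or> V \<subseteq> U" using \<C> by (auto simp: subset_chain_def)
      then obtain W where "x \<in> W" "y \<in> W" "W \<in> \<C>" using UV by blast
      then show ?thesis using \<C> by (auto simp: subset_chain_def A_def)
    qed
    then show "\<Union>\<C> \<in> A" by (simp add: A_def)
  qed
  then obtain B where B: "B \<in> A" and max: "\<And>X. X \<in> A \<Longrightarrow> B \<subseteq> X \<Longrightarrow> X = B" by blast
  have orth: "cinner x y = (if x = y then 1 else 0)" if "x \<in> B" "y \<in> B" for x y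
    using B that by (simp add: A_def)
  have total: "x = 0" if x: "\<And>b. b \<in> B \<Longrightarrow> cinner b x = 0" for x
  proof (rule ccontr)
    assume "x \<noteq> 0"
    define y where "y = complex_of_real (1 / norm x) *\<^sub>C x"
    have yy: "cinner y y = 1"
    proof -
      have "norm y = 1" using \<open>x \<noteq> 0\<close> by (simp add: y_def norm_scaleC norm_divide)
      then show ?thesis by (simp add: cinner_self)
    qed
    have by0: "cinner b y = 0" if "b \<in> B" for b by (simp add: y_def cinner_scaleC_right x that)
    then have y0: "cinner y b = 0" if "b \<in> B" for b
      using that cinner_commute[of y b] by simp
    have "y \<notin> B" using by0[of y] yy by auto
    have "cinner u v = (if u = v then 1 else 0)" if "u \<in> insert y B" "v \<in> insert y B" for u v
      using that \<open>y \<notin> B\<close> by (cases "u = y"; cases "v = y") (simp_all add: yy y0 by0 orth)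
    then have "insert y B \<in> A" unfolding A_def by blast
    from max[OF this] \<open>y \<notin> B\<close> show False by blast
  qed
  have "countable B"
  proof -
    obtain D :: "'h set" where D: "countable D" "closure D = UNIV"
      using sep by (auto simp: separable_def)
    have "\<exists>d\<in>D. dist d b < 1 / 2" for b
    proof -
      have "b \<in> closure D" using D(2) by simp
      then have "\<forall>\<epsilon>>0. \<exists>d\<in>D. dist d b < \<epsilon>" by (simp only: closure_approachable)
      then show ?thesis by (rule allE[where x = "1 / 2"]) simp
    qed
    \<comment> \<open>Distinct orthonormal vectors are \<open>sqrt 2\<close> apart, while two
      vectors with the same approximant at distance below 1/2 would be less than 1 apart; hence
      \<open>f\<close> is injective on \<open>B\<close>.\<close>
    then obtain f where f: "\<And>b. f b \<in> D" "\<And>b. dist (f b) b < 1 / 2" by metis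
    have "inj_on f B"
    proof (rule inj_onI, rule ccontr)
      fix b c assume bc: "b \<in> B" "c \<in> B" "f b = f c" "b \<noteq> c"
      have "(norm (b - c))\<^sup>2 = 2"
        using bc orth[of b b] orth[of c c] orth[of b c] orth[of c b]
        by (simp add: norm_eq_Re_cinner cinner_algebra)
      moreover have "norm (b - c) < 1"
        using f(2)[of b] f(2)[of c] bc(3) dist_triangle2[of b c "f b"]
        by (simp add: dist_norm norm_minus_commute)
      then have "(norm (b - c))\<^sup>2 \<le> 1" by (simp add: power_le_one)
      ultimately show False by simp
    qed
    moreover have "countable (f ` B)" using f(1) D(1) by (meson countable_subset image_subsetI)
    ultimately show ?thesis by (rule countable_image_inj_on[rotated])
  qed
  moreover have "infinite B"
  proof
    assume fin: "finite B"
    have "x \<in> cspan B" for x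
    proof -
      \<comment> \<open>The projection of \<open>x\<close> onto the span of a finite
        \<open>B\<close>; totality forces it to equal \<open>x\<close>, so \<open>B\<close> would
        span the whole space.\<close>
      define y where "y = (\<Sum>b\<in>B. cinner b x *\<^sub>C b)"
      have "cinner c (x - y) = 0" if c: "c \<in> B" for c
      proof -
        have "cinner c y = (\<Sum>b\<in>B. if b = c then cinner c x else 0)"
          unfolding y_def cinner_sum_right
          by (rule sum.cong) (auto simp: cinner_scaleC_right orth c)
        then show ?thesis using fin c by (simp add: cinner_diff_right)
      qed
      then have "x - y = 0" by (rule total)
      then have "x = y" by simp
      moreover have "y \<in> cspan B"
        unfolding y_def by (intro cvec.span_sum cvec.span_scale cvec.span_base)
      ultimately show ?thesis by simp
    qed
    then show False using inf fin unfolding infinite_dimensional_def by blast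
  qed
  ultimately have "bij_betw (from_nat_into B) UNIV B" by (rule bij_betw_from_nat_into)
  moreover have "bij_betw (inv (nth_word :: nat \<Rightarrow> 'n list)) UNIV UNIV"
    using bij_nth_word by (rule bij_imp_bij_inv)
  ultimately have e: "bij_betw (from_nat_into B \<circ> inv (nth_word :: nat \<Rightarrow> 'n list)) UNIV B"
    by (rule bij_betw_trans[rotated])
  define e where "e = from_nat_into B \<circ> inv (nth_word :: nat \<Rightarrow> 'n list)"
  have inj: "e v = e w \<longleftrightarrow> v = w" for v w using e by (auto simp: e_def bij_betw_def inj_on_def)
  have range: "range e = B" using e by (simp add: e_def bij_betw_def)
  have "word_basis e"
  proof
    show "cinner (e v) (e w) = (if v = w then 1 else 0)" for v w
      using orth[of "e v" "e w"] range inj by auto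
    show "x = 0" if "\<And>w. cinner (e w) x = 0" for x
      by (rule total) (use that range in blast)
  qed
  then show ?thesis by (rule that)
qed

theorem theorem3p3:
  fixes \<phi> :: "('h::chilbert_space \<Rightarrow>\<^sub>L 'h) ^ 'n::finite \<Rightarrow> ('h \<Rightarrow>\<^sub>L 'h) ^ 'n"
  assumes "separable TYPE('h)" and "infinite_dimensional TYPE('h)"
    and "free_self_map \<phi>"
    and "elliptic \<phi> \<or> parabolic \<phi>"
  shows "spectral_radius_on H2_ball H2_norm (comp_op \<phi>) = 1"
proof -
  obtain e :: "'n list \<Rightarrow> 'h" where "word_basis e"
    using ex_word_basis[OF assms(1,2)] by blast
  then show ?thesis by (rule word_basis.spectral_radius_comp_op[OF _ assms(3,4)])
qed

end
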